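(* Let $1<a<\sqrt2$ and let $H(a)$ be the maximum of $h_n^1(a)$ over the (finitely many) integers $n\ge0$ with $n<\frac{2(a^2-1)}{2-a^2}$, i.e. those with $a>\alpha_n^1=\sqrt{\frac{2n+2}{n+2}}$. Then $H(a)$ is the upper bound of ellipticity for the pantographic family: $H(a)=\sup\{h>0:\ Pan(n,a,h)\text{ is elliptic for some integer }n\ge0\}$.
   Context: Elliptical stadium: for $a>1$, $h>0$, let $\Gamma$ be the closed curve bounding the region made of the two half-ellipses $\{(a\cos\lambda+h,\sin\lambda):|\lambda|\le\pi/2\}$ and its mirror image under $x\mapsto -x$, joined by the two straight segments $y=\pm1$, $|x|\le h$. Let $s\in[0,L)$ be arc length on $\Gamma$ ($L$ the length of $\Gamma$) and $\beta\in(-\pi/2,\pi/2)$ the angle of the direction of motion, immediately after a collision, with the normal to $\Gamma$ at the impact point. The billiard map $T_{a,h}$ on $[0,L)\times(-\pi/2,\pi/2)$ ($s$ taken mod $L$) sends $(s_0,\beta_0)$ to the data $(s_1,\beta_1)$ of the next impact (free motion inside $\Gamma$, elastic reflection). Pantographic orbit $Pan(n,a,h)$: a $(4+2n)$-periodic billiard orbit, symmetric with respect to the symmetry axes of the stadium, with exactly $2$ impacts at each half-ellipse, joined by a vertical segment, the remaining $2n$ impacts being on the straight segments, and crossing any vertical line (other than those containing the vertical segments) only twice. Its marked point is the impact point $P=(a\cos\lambda+h,\sin\lambda)$, $0<\lambda<\pi/2$, on the upper part of the right half-ellipse. With $t=\tan\lambda$, $t$ is the unique positive solution of $n=\frac{a^2t^2-1}{2at}h+\frac{(a^2-2)t^2-1}{2t\sqrt{1+t^2}}$.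 Here $\beta>0$ is the angle with the normal of the outgoing (non-vertical) trajectory at $P$, so $\tan\beta=\frac{1}{at}$, and $s$ is the arc length of $P$; thus $T_{a,h}^{4+2n}(s,\beta)=(s,\beta)$. For $1<a<\sqrt2$ the orbit exists for all $n\ge0$, $h>0$. It is elliptic if the eigenvalues of $DT_{a,h}^{4+2n}|_{(s,\beta)}$ have modulus $1$ and non-zero imaginary part. Let $\Delta_n(a,h)=\left(\frac{l_1K}{\cos\beta}-1\right)\left(\frac{l_2K}{\cos\beta}-1\right)$ with $l_1=2\sin\lambda$, $l_2=2\sqrt{(h+a\cos\lambda)^2+(n+\sin\lambda)^2}$, $K=a/(a^2\sin^2\lambda+\cos^2\lambda)^{3/2}$. For $\alpha_n^1<a<\sqrt2$, $h_n^1(a)$ denotes the unique $h>0$ with $\Delta_n(a,h)=1$. *)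

theory Defs
  imports
    "HOL-Analysis.Analysis"
    "HOL-Library.Real_Mod"
    "Jordan_Normal_Form.Char_Poly"
begin
definition right_half_ellipse :: "real \<Rightarrow> real \<Rightarrow> (real \<times> real) set" where
  "right_half_ellipse a h = (\<lambda>l. (a * cos l + h, sin l)) ` {- (pi/2) .. pi/2}"

definition left_half_ellipse :: "real \<Rightarrow> real \<Rightarrow> (real \<times> real) set" where
  "left_half_ellipse a h = (\<lambda>(x, y). (- x, y)) ` right_half_ellipse a h"

definition straight_segments :: "real \<Rightarrow> (real \<times> real) set" where
  "straight_segments h = {- h .. h} \<times> {-1, 1}"

definition stadium :: "real \<Rightarrow> real \<Rightarrow> (real \<times> real) set" where
  "stadium a h = right_half_ellipse a h \<union> left_half_ellipse a h \<union> straight_segments h"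

text \<open>
  Counterclockwise parametrization of the stadium by \<open>0 \<le> u < 2 * pi + 4 * h\<close>, starting at the
  rightmost point. The speed jumps at the four junctions; only the arc length parametrization
  below is used to speak about tangents.
\<close>

definition stadium_path :: "real \<Rightarrow> real \<Rightarrow> real \<Rightarrow> real \<times> real" where
  "stadium_path a h u =
    (if u \<le> pi/2 then (a * cos u + h, sin u)
     else if u \<le> pi/2 + 2*h then (h - (u - pi/2), 1)
     else if u \<le> 3*pi/2 + 2*h then (a * cos (u - 2*h) - h, sin (u - 2*h))
     else if u \<le> 3*pi/2 + 4*h then (- h + (u - (3*pi/2 + 2*h)), -1)
     else (a * cos (u - 4*h) + h, sin (u - 4*h)))"

definition stadium_arc_length :: "real \<Rightarrow> real \<Rightarrow> real \<Rightarrow> real" where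
  "stadium_arc_length a h u =
     integral {0..u} (\<lambda>v. norm (vector_derivative (stadium_path a h) (at v)))"

definition stadium_length :: "real \<Rightarrow> real \<Rightarrow> real" where
  "stadium_length a h = stadium_arc_length a h (2*pi + 4*h)"

text \<open>The point of the stadium with arc length \<open>s\<close>, as a periodic function on the whole line.\<close>

definition stadium_point :: "real \<Rightarrow> real \<Rightarrow> real \<Rightarrow> real \<times> real" where
  "stadium_point a h s =
     stadium_path a h (THE u. 0 \<le> u \<and> u < 2*pi + 4*h \<and>
                              stadium_arc_length a h u = s rmod stadium_length a h)"

definition stadium_tangent :: "real \<Rightarrow> real \<Rightarrow> real \<Rightarrow> real \<times> real" where
  "stadium_tangent a h s = vector_derivative (stadium_point a h) (at s)"

text \<open>The curve is traversed counterclockwise, so this is the normal pointing inwards.\<close>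

definition stadium_normal :: "real \<Rightarrow> real \<Rightarrow> real \<Rightarrow> real \<times> real" where
  "stadium_normal a h s = (- snd (stadium_tangent a h s), fst (stadium_tangent a h s))"

text \<open>
  Angles are measured from the inward normal towards the counterclockwise tangent. With this sign,
  the outgoing non-vertical direction at the marked point of a pantographic orbit has a
  positive angle.
\<close>

definition outgoing_direction :: "real \<Rightarrow> real \<Rightarrow> real \<times> real \<Rightarrow> real \<times> real" where
  "outgoing_direction a h = (\<lambda>(s, \<beta>).
     cos \<beta> *\<^sub>R stadium_normal a h s + sin \<beta> *\<^sub>R stadium_tangent a h s)"

definition phase_space :: "real \<Rightarrow> real \<Rightarrow> (real \<times> real) set" where
  "phase_space a h = {0 ..< stadium_length a h} \<times> {- (pi/2) <..< pi/2}"

definition reflect :: "real \<times> real \<Rightarrow> real \<times> real \<Rightarrow> real \<times> real" where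
  "reflect v d = d - (2 * inner d v) *\<^sub>R v"

definition next_impact :: "real \<Rightarrow> real \<Rightarrow> real \<times> real \<Rightarrow> real \<times> real \<Rightarrow> bool" where
  "next_impact a h x y \<longleftrightarrow>
     y \<in> phase_space a h \<and>
     (\<exists>r>0. stadium_point a h (fst y) = stadium_point a h (fst x) + r *\<^sub>R outgoing_direction a h x \<and>
        (\<forall>r'. 0 < r' \<and> r' < r \<longrightarrow>
           stadium_point a h (fst x) + r' *\<^sub>R outgoing_direction a h x \<notin> stadium a h)) \<and>
     outgoing_direction a h y = reflect (stadium_normal a h (fst y)) (outgoing_direction a h x)"

definition billiard_map :: "real \<Rightarrow> real \<Rightarrow> real \<times> real \<Rightarrow> real \<times> real" where
  "billiard_map a h x = (THE y. next_impact a h x y)"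

definition impact :: "real \<Rightarrow> real \<Rightarrow> real \<times> real \<Rightarrow> nat \<Rightarrow> real \<times> real" where
  "impact a h x k = stadium_point a h (fst ((billiard_map a h ^^ k) x))"

definition trajectory :: "real \<Rightarrow> real \<Rightarrow> real \<times> real \<Rightarrow> (real \<times> real) set" where
  "trajectory a h x = (\<Union>k. closed_segment (impact a h x k) (impact a h x (Suc k)))"

definition vertical_link :: "real \<Rightarrow> real \<Rightarrow> real \<times> real \<Rightarrow> nat \<Rightarrow> bool" where
  "vertical_link a h x k \<longleftrightarrow> fst (impact a h x k) = fst (impact a h x (Suc k))"

text \<open>
  The crossings of the vertical line at abscissa \<open>c\<close> during the first \<open>N\<close> links. A position is
  a link together with a parameter in \<open>[0, 1)\<close>, so that an impact point counts once, although
  it is an end point of two links.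
\<close>

definition crossings :: "real \<Rightarrow> real \<Rightarrow> real \<times> real \<Rightarrow> nat \<Rightarrow> real \<Rightarrow> (nat \<times> real) set" where
  "crossings a h x N c =
     {(k, r). k < N \<and> 0 \<le> r \<and> r < 1 \<and>
        fst ((1 - r) *\<^sub>R impact a h x k + r *\<^sub>R impact a h x (Suc k)) = c}"

definition pan_t :: "nat \<Rightarrow> real \<Rightarrow> real \<Rightarrow> real" where
  "pan_t n a h = (THE t. t > 0 \<and>
     real n = (a\<^sup>2 * t\<^sup>2 - 1) / (2 * a * t) * h
              + ((a\<^sup>2 - 2) * t\<^sup>2 - 1) / (2 * t * sqrt (1 + t\<^sup>2)))"

definition pan_lambda :: "nat \<Rightarrow> real \<Rightarrow> real \<Rightarrow> real" where
  "pan_lambda n a h = arctan (pan_t n a h)"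

definition pan_beta :: "nat \<Rightarrow> real \<Rightarrow> real \<Rightarrow> real" where
  "pan_beta n a h = arctan (1 / (a * pan_t n a h))"

text \<open>
  \<open>pantographic n a h x\<close>: the phase point \<open>x\<close> is the marked point of \<open>Pan(n, a, h)\<close>. Fixing the
  marked point by \<open>pan_lambda\<close> and \<open>pan_beta\<close> is not redundant: the purely geometric clauses
  also hold for other symmetric orbits, such as, for \<open>n = 0\<close>, the rectangle through the point with
  \<open>a * tan \<lambda> = 1\<close>.
\<close>

definition pantographic :: "nat \<Rightarrow> real \<Rightarrow> real \<Rightarrow> real \<times> real \<Rightarrow> bool" where
  "pantographic n a h x \<longleftrightarrow>
     x \<in> phase_space a h \<and>
     stadium_point a h (fst x) = (a * cos (pan_lambda n a h) + h, sin (pan_lambda n a h)) \<and>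
     snd x = pan_beta n a h \<and>
     (billiard_map a h ^^ (4 + 2*n)) x = x \<and>
     (\<forall>k. 0 < k \<and> k < 4 + 2*n \<longrightarrow> (billiard_map a h ^^ k) x \<noteq> x) \<and>
     (\<lambda>(u, v). (- u, v)) ` trajectory a h x = trajectory a h x \<and>
     (\<lambda>(u, v). (u, - v)) ` trajectory a h x = trajectory a h x \<and>
     card {k. k < 4 + 2*n \<and> impact a h x k \<in> right_half_ellipse a h} = 2 \<and>
     card {k. k < 4 + 2*n \<and> impact a h x k \<in> left_half_ellipse a h} = 2 \<and>
     card {k. k < 4 + 2*n \<and> impact a h x k \<in> straight_segments h} = 2*n \<and>
     (\<exists>k. impact a h x k \<in> right_half_ellipse a h \<and>
          impact a h x (Suc k) \<in> right_half_ellipse a h \<and> vertical_link a h x k) \<and>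
     (\<exists>k. impact a h x k \<in> left_half_ellipse a h \<and>
          impact a h x (Suc k) \<in> left_half_ellipse a h \<and> vertical_link a h x k) \<and>
     (\<forall>c. (\<nexists>k. vertical_link a h x k \<and> fst (impact a h x k) = c) \<longrightarrow>
          crossings a h x (4 + 2*n) c = {} \<or> card (crossings a h x (4 + 2*n) c) = 2)"

text \<open>The Jacobian matrix of a map of the plane with derivative \<open>D\<close>, with complex entries.\<close>

definition complex_jacobian :: "(real \<times> real \<Rightarrow> real \<times> real) \<Rightarrow> complex mat" where
  "complex_jacobian D = mat_of_rows_list 2
     [[complex_of_real (fst (D (1, 0))), complex_of_real (fst (D (0, 1)))],
      [complex_of_real (snd (D (1, 0))), complex_of_real (snd (D (0, 1)))]]"

definition elliptic_point :: "(real \<times> real \<Rightarrow> real \<times> real) \<Rightarrow> real \<times> real \<Rightarrow> bool" where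
  "elliptic_point F x \<longleftrightarrow>
     (\<exists>D. (F has_derivative D) (at x) \<and>
        (\<forall>\<mu>. eigenvalue (complex_jacobian D) \<mu> \<longrightarrow> cmod \<mu> = 1 \<and> Im \<mu> \<noteq> 0))"

definition pan_elliptic :: "nat \<Rightarrow> real \<Rightarrow> real \<Rightarrow> bool" where
  "pan_elliptic n a h \<longleftrightarrow>
     (\<exists>x. pantographic n a h x \<and> elliptic_point (billiard_map a h ^^ (4 + 2*n)) x)"

definition pan_Delta :: "nat \<Rightarrow> real \<Rightarrow> real \<Rightarrow> real" where
  "pan_Delta n a h =
     (let l = pan_lambda n a h;
          l1 = 2 * sin l;
          l2 = 2 * sqrt ((h + a * cos l)\<^sup>2 + (real n + sin l)\<^sup>2);
          K = a / (a\<^sup>2 * (sin l)\<^sup>2 + (cos l)\<^sup>2) powr (3/2)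
      in (l1 * K / cos (pan_beta n a h) - 1) * (l2 * K / cos (pan_beta n a h) - 1))"

definition pan_alpha1 :: "nat \<Rightarrow> real" where
  "pan_alpha1 n = sqrt ((2 * real n + 2) / (real n + 2))"

definition pan_h1 :: "nat \<Rightarrow> real \<Rightarrow> real" where
  "pan_h1 n a = (THE h. h > 0 \<and> pan_Delta n a h = 1)"

definition pan_indices :: "real \<Rightarrow> nat set" where
  "pan_indices a = {n. real n < 2 * (a\<^sup>2 - 1) / (2 - a\<^sup>2)}"

definition pan_H :: "real \<Rightarrow> real" where
  "pan_H a = Max ((\<lambda>n. pan_h1 n a) ` pan_indices a)"

lemma finite_pan_indices: "finite (pan_indices a)"
proof (rule finite_subset)
  show "pan_indices a \<subseteq> {.. nat \<lceil>2 * (a\<^sup>2 - 1) / (2 - a\<^sup>2)\<rceil>}"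
  proof
    fix n assume "n \<in> pan_indices a"
    then have "real n < 2 * (a\<^sup>2 - 1) / (2 - a\<^sup>2)" by (simp add: pan_indices_def)
    then show "n \<in> {.. nat \<lceil>2 * (a\<^sup>2 - 1) / (2 - a\<^sup>2)\<rceil>}" unfolding atMost_iff by linarith
  qed
qed simp

lemma square_less_2:
  fixes a :: real
  assumes "1 < a" "a < sqrt 2"
  shows "1 < a\<^sup>2" "a\<^sup>2 < 2"
proof -
  show "1 < a\<^sup>2"
    using assms(1) by (rule one_less_power) simp
  have "a\<^sup>2 < (sqrt 2)\<^sup>2"
    by (rule power_strict_mono) (use assms in auto)
  then show "a\<^sup>2 < 2" by simp
qed

lemma zero_in_pan_indices:
  assumes "1 < a" "a < sqrt 2"
  shows "0 \<in> pan_indices a"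
  using square_less_2[OF assms] by (simp add: pan_indices_def)

lemma pan_indices_eq:
  assumes "1 < a" "a < sqrt 2"
  shows "pan_indices a = {n. pan_alpha1 n < a}"
proof -
  have "real n < 2 * (a\<^sup>2 - 1) / (2 - a\<^sup>2) \<longleftrightarrow> pan_alpha1 n < a" for n
  proof -
    have "pan_alpha1 n < a \<longleftrightarrow> (2 * real n + 2) / (real n + 2) < a\<^sup>2"
    proof -
      have "pan_alpha1 n < a \<longleftrightarrow> pan_alpha1 n < sqrt (a\<^sup>2)"
        using assms(1) by simp
      then show ?thesis unfolding pan_alpha1_def by (simp only: real_sqrt_less_iff)
    qed
    also have "\<dots> \<longleftrightarrow> 2 * real n + 2 < a\<^sup>2 * (real n + 2)"
      by (simp add: pos_divide_less_eq)
    also have "\<dots> \<longleftrightarrow> real n * (2 - a\<^sup>2) < 2 * (a\<^sup>2 - 1)"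
      by (simp add: algebra_simps)
    also have "\<dots> \<longleftrightarrow> real n < 2 * (a\<^sup>2 - 1) / (2 - a\<^sup>2)"
      using square_less_2[OF assms] by (simp add: pos_less_divide_eq)
    finally show ?thesis by simp
  qed
  then show ?thesis by (simp add: pan_indices_def)
qed

end

theory Submission
  imports Defs
begin

text \<open>
  The argument combines the stability type of a pantographic orbit with the monotonicity of
  \<open>\<Delta>\<close> in \<open>h\<close>.

  Stability. Straight chords are better coordinates than initial conditions: the region bounded by
  the stadium is convex, so any two boundary points at different heights are joined by a chord that
  meets the boundary only at its ends. Sending a pair of arc lengths to the outgoing data at the
  start of the chord, respectively at its end, gives two explicit maps, and the billiard map is the
  second one after the inverse of the first. Invariance of domain makes this an identity on a full
  neighbourhood, and the derivative comes out as the classical matrix (\<open>billiard_leg\<close>). In the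
  coordinates \<open>(cos \<beta> ds, d\<beta>)\<close> this matrix is minus a product of shears, kick, drift, kick, where the
  kick \<open>\<kappa> / cos \<beta>\<close> vanishes on the segments. Hence the \<open>n\<close> impacts on the straight segments only add up
  lengths, half a period is a product of one leg of length \<open>l\<^sub>2\<close> and one of length \<open>l\<^sub>1\<close>
  with equal kicks at all ends, and its trace is \<open>4 \<Delta> - 2\<close> up to sign. The orbit is carried to itself
  by a symmetry that advances it by half a period, so the derivative over the period is the square
  of this matrix: it has determinant 1 and trace \<open>(4 \<Delta> - 2)\<^sup>2 - 2\<close>, and \<open>Pan (n, a, h)\<close> is elliptic
  exactly if this trace lies strictly between \<open>-2\<close> and \<open>2\<close> (\<open>pan_elliptic_iff\<close>). That \<open>Pan (n, a, h)\<close>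
  exists for all \<open>n\<close> and \<open>h\<close> is shown by writing down its impact points: reflecting the strip
  unfolds the links between the two vertical ones to straight lines, and \<open>a\<^sup>2 < 2\<close> keeps the impacts
  on the segments away from the junctions (\<open>pantographic_state\<close>).

  Monotonicity. Written in \<open>v = 1 / t\<^sup>2\<close>, \<open>\<Delta>\<close> is a product of two positive increasing factors, while \<open>h\<close>
  decreases in \<open>t\<close>. So \<open>\<Delta>\<close> is positive and strictly increasing in \<open>h\<close>, and its limit at \<open>h = 0\<close> is below 1
  exactly for the indices \<open>n < 2 (a\<^sup>2 - 1) / (2 - a\<^sup>2)\<close>. Consequently \<open>\<Delta> < 1\<close> holds exactly for those
  \<open>n\<close> and \<open>h < h\<^sub>n\<^sup>1(a)\<close>, which bounds the elliptic \<open>h\<close> by \<open>H(a)\<close>; and for an index that attains the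
  maximum, \<open>1/2 < \<Delta> < 1\<close> for \<open>h\<close> just below \<open>H(a)\<close>, which makes these orbits elliptic.
\<close>
section \<open>The pantographic equation and the monotonicity of \<open>\<Delta>\<close>\<close>

text \<open>
  The pantographic equation is linear in \<open>h\<close>; this is its solution for given \<open>t\<close>. Using \<open>t\<close> as the
  parameter of the family avoids all questions about the implicit function \<open>pan_t\<close>.
\<close>
definition pan_height :: "nat \<Rightarrow> real \<Rightarrow> real \<Rightarrow> real" where
  "pan_height n a t =
     (real n + ((2 - a\<^sup>2) * t\<^sup>2 + 1) / (2 * t * sqrt (1 + t\<^sup>2))) * (2 * a * t / (a\<^sup>2 * t\<^sup>2 - 1))"

text \<open>
  \<open>pan_Delta\<close> as a function of \<open>v = 1 / t\<^sup>2\<close>. In this variable both factors are increasing and remain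
  continuous at \<open>v = 0\<close>, the limit \<open>h \<rightarrow> 0\<close>.
\<close>
definition Delta_profile :: "nat \<Rightarrow> real \<Rightarrow> real \<Rightarrow> real" where
  "Delta_profile n a v =
     (v + (2 - a\<^sup>2)) / (v + a\<^sup>2) * (2 * (1 + v) * (1 + real n * sqrt (1 + v)) / (a\<^sup>2 - v) - 1)"

locale flat_ellipse =
  fixes a :: real
  assumes a_gt_1: "1 < a" and a_less_sqrt2: "a < sqrt 2"
begin

lemma a_sq: "1 < a\<^sup>2" "a\<^sup>2 < 2"
  using square_less_2[OF a_gt_1 a_less_sqrt2] by auto

lemma a_pos: "0 < a" using a_gt_1 by simp

lemma at_gt_1: assumes "1 / a < t" shows "0 < t" "1 < a * t" "1 < a\<^sup>2 * t\<^sup>2"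
proof -
  have "0 < 1 / a" using a_pos by simp
  then show "0 < t" using assms by linarith
  show *: "1 < a * t" using assms a_pos by (simp add: pos_divide_less_eq mult.commute)
  have "1 < (a * t)\<^sup>2" using * by (simp add: one_less_power)
  then show "1 < a\<^sup>2 * t\<^sup>2" by (simp add: power_mult_distrib)
qed

lemma pan_gap_pos:
  assumes "0 < t" shows "0 < ((2 - a\<^sup>2) * t\<^sup>2 + 1) / (2 * t * sqrt (1 + t\<^sup>2))"
proof (rule divide_pos_pos)
  have "0 \<le> (2 - a\<^sup>2) * t\<^sup>2" using a_sq by simp
  then show "0 < (2 - a\<^sup>2) * t\<^sup>2 + 1" by simp
  have "0 < sqrt (1 + t\<^sup>2)" by (auto intro: add_pos_nonneg)
  then show "0 < 2 * t * sqrt (1 + t\<^sup>2)" using assms by simp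
qed

text \<open>
  The \<open>h\<close>-free term of the equation is negative because \<open>a\<^sup>2 < 2\<close>, so a solution needs a positive
  coefficient of \<open>h\<close>, that is \<open>a t > 1\<close>: the trajectory leaving the marked point descends.
\<close>
lemma pan_equation_iff:
  assumes "0 < t" "0 < h"
  shows "real n = (a\<^sup>2 * t\<^sup>2 - 1) / (2 * a * t) * h + ((a\<^sup>2 - 2) * t\<^sup>2 - 1) / (2 * t * sqrt (1 + t\<^sup>2))
     \<longleftrightarrow> 1 / a < t \<and> pan_height n a t = h" (is "?L \<longleftrightarrow> ?R")
proof -
  define g where "g = ((2 - a\<^sup>2) * t\<^sup>2 + 1) / (2 * t * sqrt (1 + t\<^sup>2))"
  have g: "((a\<^sup>2 - 2) * t\<^sup>2 - 1) / (2 * t * sqrt (1 + t\<^sup>2)) = - g"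
    unfolding g_def minus_divide_left by (simp add: algebra_simps)
  have gpos: "0 < g"
    unfolding g_def using assms(1) by (rule pan_gap_pos)
  define m where "m = (a\<^sup>2 * t\<^sup>2 - 1) / (2 * a * t)"
  have ht: "pan_height n a t = (real n + g) / m"
    unfolding pan_height_def g_def[symmetric] m_def by simp
  have mpos: "0 < m \<longleftrightarrow> 1 / a < t"
  proof
    assume "0 < m"
    moreover have "a\<^sup>2 * t\<^sup>2 - 1 = m * (2 * a * t)" using assms a_pos by (simp add: m_def)
    ultimately have "0 < a\<^sup>2 * t\<^sup>2 - 1" using assms a_pos by simp
    then have "1\<^sup>2 < (a * t)\<^sup>2" by (simp add: power_mult_distrib)
    then have "1 < a * t" by (rule power_less_imp_less_base) (use assms a_pos in auto)
    then show "1 / a < t" using a_pos by (simp add: field_simps)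
  next
    assume "1 / a < t"
    from at_gt_1[OF this] show "0 < m" using a_pos by (simp add: m_def)
  qed
  have "?L \<longleftrightarrow> real n + g = m * h" unfolding g m_def by auto
  also have "\<dots> \<longleftrightarrow> ?R"
  proof
    assume *: "real n + g = m * h"
    then have "0 < m * h" using gpos by (metis add.commute add_pos_nonneg of_nat_0_le_iff)
    then have "0 < m" using assms by (simp add: zero_less_mult_iff)
    then show ?R using mpos * by (simp add: ht)
  next
    assume ?R then show "real n + g = m * h" using mpos by (auto simp: ht)
  qed
  finally show ?thesis .
qed

lemma pan_height_pos: assumes "1 / a < t" shows "0 < pan_height n a t"
proof -
  note t = at_gt_1[OF assms]
  have "0 < real n + ((2 - a\<^sup>2) * t\<^sup>2 + 1) / (2 * t * sqrt (1 + t\<^sup>2))"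
    by (rule add_nonneg_pos[OF of_nat_0_le_iff pan_gap_pos[OF t(1)]])
  moreover have "0 < 2 * a * t / (a\<^sup>2 * t\<^sup>2 - 1)" using t a_pos by simp
  ultimately show ?thesis unfolding pan_height_def by (rule mult_pos_pos)
qed

text \<open>
  Up to its sign the \<open>h\<close>-free term splits into two decreasing pieces, and the reciprocal of the coefficient of \<open>h\<close>
  is \<open>2 / (a t - 1 / (a t))\<close>, which is decreasing as well.
\<close>
lemma pan_height_strict_antimono:
  assumes "1 / a < t" "t < t'" shows "pan_height n a t' < pan_height n a t"
proof -
  note t = at_gt_1[OF assms(1)]
  have t': "0 < t'" "1 < a * t'" "1 < a\<^sup>2 * t'\<^sup>2" using at_gt_1[of t'] assms by auto
  have split: "((2 - a\<^sup>2) * u\<^sup>2 + 1) / (2 * u * sqrt (1 + u\<^sup>2))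
     = ((2 - a\<^sup>2) * sqrt (1 + 1 / u\<^sup>2) + (a\<^sup>2 - 1) / (u * sqrt (1 + u\<^sup>2))) / 2" if "0 < u" for u :: real
  proof -
    define r where "r = sqrt (1 + u\<^sup>2)"
    have r: "r > 0" "r\<^sup>2 = 1 + u\<^sup>2" unfolding r_def using that by (auto intro: add_pos_nonneg)
    have "sqrt (1 + 1 / u\<^sup>2) = r / u"
    proof -
      have "1 + 1 / u\<^sup>2 = (1 + u\<^sup>2) / u\<^sup>2" using that by (simp add: field_simps)
      then show ?thesis using that by (simp add: real_sqrt_divide r_def)
    qed
    moreover have "((2 - a\<^sup>2) * u\<^sup>2 + 1) / (2 * u * r) = ((2 - a\<^sup>2) * (r / u) + (a\<^sup>2 - 1) / (u * r)) / 2"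
    proof -
      have "(2 - a\<^sup>2) * (r / u) = (2 - a\<^sup>2) * r\<^sup>2 / (u * r)" using that r(1) by (simp add: power2_eq_square)
      then have "(2 - a\<^sup>2) * (r / u) + (a\<^sup>2 - 1) / (u * r) = ((2 - a\<^sup>2) * r\<^sup>2 + (a\<^sup>2 - 1)) / (u * r)"
        by (simp add: add_divide_distrib)
      also have "(2 - a\<^sup>2) * r\<^sup>2 + (a\<^sup>2 - 1) = (2 - a\<^sup>2) * u\<^sup>2 + 1" unfolding r(2) by (simp add: algebra_simps)
      finally show ?thesis by simp
    qed
    ultimately show ?thesis by (simp add: r_def)
  qed
  have "((2 - a\<^sup>2) * t'\<^sup>2 + 1) / (2 * t' * sqrt (1 + t'\<^sup>2)) \<le> ((2 - a\<^sup>2) * t\<^sup>2 + 1) / (2 * t * sqrt (1 + t\<^sup>2))"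
  proof -
    have sq: "t\<^sup>2 \<le> t'\<^sup>2" using t assms by (intro power_mono) auto
    have "sqrt (1 + 1 / t'\<^sup>2) \<le> sqrt (1 + 1 / t\<^sup>2)"
      using t sq by (simp add: frac_le)
    then have 1: "(2 - a\<^sup>2) * sqrt (1 + 1 / t'\<^sup>2) \<le> (2 - a\<^sup>2) * sqrt (1 + 1 / t\<^sup>2)"
      using a_sq by (intro mult_left_mono) auto
    have 2: "(a\<^sup>2 - 1) / (t' * sqrt (1 + t'\<^sup>2)) \<le> (a\<^sup>2 - 1) / (t * sqrt (1 + t\<^sup>2))"
      using t a_sq assms sq by (intro divide_left_mono mult_mono mult_pos_pos) (auto intro: add_pos_nonneg)
    show ?thesis unfolding split[OF t(1)] split[OF t'(1)] by (intro divide_right_mono add_mono 1 2) simp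
  qed
  moreover have "2 * a * t' / (a\<^sup>2 * t'\<^sup>2 - 1) < 2 * a * t / (a\<^sup>2 * t\<^sup>2 - 1)"
  proof -
    have e: "2 * a * u / (a\<^sup>2 * u\<^sup>2 - 1) = 2 / (a * u - 1 / (a * u))" if "1 < a * u" for u
    proof -
      have "2 / (z - 1 / z) = 2 * z / (z\<^sup>2 - 1)" if "z \<noteq> 0" for z :: real
      proof -
        have "z - 1 / z = (z\<^sup>2 - 1) / z" using that by (simp add: diff_divide_distrib power2_eq_square)
        then show ?thesis by simp
      qed
      moreover have "2 * a * u / (a\<^sup>2 * u\<^sup>2 - 1) = 2 * (a * u) / ((a * u)\<^sup>2 - 1)"
        by (simp only: power_mult_distrib mult.assoc)
      ultimately show ?thesis using \<open>1 < a * u\<close> by (metis not_one_less_zero)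
    qed
    have 1: "a * t < a * t'" using assms a_pos by simp
    have 2: "1 / (a * t') < 1 / (a * t)" using 1 t by (intro divide_strict_left_mono) auto
    have 3: "1 / (a * t) < 1" using t by simp
    then have "0 < a * t - 1 / (a * t)" using t(2) by linarith
    then show ?thesis unfolding e[OF t(2)] e[OF t'(2)] using 1 2
      by (intro divide_strict_left_mono mult_pos_pos) auto
  qed
  moreover have "0 < ((2 - a\<^sup>2) * t\<^sup>2 + 1) / (2 * t * sqrt (1 + t\<^sup>2))"
    using t(1) by (rule pan_gap_pos)
  moreover have "0 < real n + ((2 - a\<^sup>2) * t'\<^sup>2 + 1) / (2 * t' * sqrt (1 + t'\<^sup>2))"
    by (rule add_nonneg_pos[OF of_nat_0_le_iff pan_gap_pos[OF t'(1)]])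
  moreover have "0 \<le> 2 * a * t' / (a\<^sup>2 * t'\<^sup>2 - 1)" using t' a_pos by simp
  ultimately show ?thesis unfolding pan_height_def
    by (intro mult_le_less_imp_less add_left_mono)
qed

lemma pan_height_inj:
  assumes "1 / a < t" "1 / a < u" "pan_height n a t = pan_height n a u" shows "t = u"
  using pan_height_strict_antimono[of t u n] pan_height_strict_antimono[of u t n] assms
  by (cases t u rule: linorder_cases) auto

lemma pan_height_surj: assumes "0 < h" shows "\<exists>t. 1 / a < t \<and> pan_height n a t = h"
proof -
  define f where "f t = (a\<^sup>2 * t\<^sup>2 - 1) / (2 * a * t) * h + ((a\<^sup>2 - 2) * t\<^sup>2 - 1) / (2 * t * sqrt (1 + t\<^sup>2))" for t
  \<comment> \<open>The first term of \<open>f\<close> grows like \<open>h a t / 2\<close>; this \<open>b\<close> lets it outweigh \<open>n\<close> and the bounded rest.\<close>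
  define b where "b = 1 + 2 * (real n + 1 + h) / (h * a)"
  have b1: "1 \<le> b" using assms a_pos by (simp add: b_def)
  have "1 / a \<le> 1" using a_gt_1 by simp
  then have ba: "1 / a \<le> b" using b1 by linarith
  have apos: "0 < 1 / a" using a_pos by simp
  have "f (1 / a) \<le> real n"
  proof -
    have "((a\<^sup>2 - 2) * (1 / a)\<^sup>2 - 1) / (2 * (1 / a) * sqrt (1 + (1 / a)\<^sup>2)) \<le> 0"
    proof (rule divide_nonpos_pos)
      have "(a\<^sup>2 - 2) * (1 / a)\<^sup>2 \<le> 0" using a_sq by (intro mult_nonpos_nonneg) auto
      then show "(a\<^sup>2 - 2) * (1 / a)\<^sup>2 - 1 \<le> 0" by simp
    qed (use a_pos in \<open>intro mult_pos_pos, auto intro: add_pos_nonneg\<close>)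
    moreover have "a\<^sup>2 * (1 / a)\<^sup>2 - 1 = 0" using a_pos by (simp add: power_divide)
    ultimately show ?thesis unfolding f_def by simp
  qed
  moreover have "real n \<le> f b"
  proof -
    have 1: "(a\<^sup>2 * b\<^sup>2 - 1) / (2 * a * b) = a * b / 2 - 1 / (2 * a * b)"
      using b1 a_pos by (simp add: field_simps power2_eq_square)
    have 2: "1 / (2 * a * b) \<le> 1"
    proof -
      have "1 * 1 \<le> a * b" using b1 a_gt_1 by (intro mult_mono) auto
      then show ?thesis by (simp add: divide_le_eq_1)
    qed
    have 3: "-1 \<le> ((a\<^sup>2 - 2) * b\<^sup>2 - 1) / (2 * b * sqrt (1 + b\<^sup>2))"
    proof -
      have "b \<le> sqrt (1 + b\<^sup>2)" by (rule real_le_rsqrt) simp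
      then have "2 * b * b \<le> 2 * b * sqrt (1 + b\<^sup>2)" using b1 by (intro mult_left_mono) auto
      moreover have "1 \<le> b\<^sup>2" using b1 by (simp add: one_le_power)
      moreover have "- b\<^sup>2 \<le> (a\<^sup>2 - 2) * b\<^sup>2"
        using mult_right_mono[of "-1" "a\<^sup>2 - 2" "b\<^sup>2"] a_sq by simp
      ultimately have "- (2 * b * sqrt (1 + b\<^sup>2)) \<le> (a\<^sup>2 - 2) * b\<^sup>2 - 1"
        by (simp add: power2_eq_square)
      moreover have "0 < 2 * b * sqrt (1 + b\<^sup>2)" using b1 by (intro mult_pos_pos) (auto intro: add_pos_nonneg)
      ultimately show ?thesis by (simp add: pos_le_divide_eq)
    qed
    have "h * (a * b / 2) = h * a / 2 + (real n + 1 + h)"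
      using assms a_pos unfolding b_def by (simp add: field_simps)
    moreover have "h * (1 / (2 * a * b)) \<le> h * 1" using 2 assms by (intro mult_left_mono) auto
    moreover have "0 < h * a / 2" using assms a_pos by simp
    ultimately have "real n + 1 \<le> (a\<^sup>2 * b\<^sup>2 - 1) / (2 * a * b) * h"
      unfolding 1 left_diff_distrib by (simp only: mult.commute[of _ h])
    then show ?thesis unfolding f_def using 3 by simp
  qed
  moreover have "continuous_on {1 / a .. b} f"
    unfolding f_def using apos a_pos
    by (intro continuous_intros) (auto simp: add_nonneg_eq_0_iff)
  ultimately obtain t where t: "1 / a \<le> t" "f t = real n" using IVT'[of f "1 / a" "real n" b] ba by auto
  then have "0 < t" using apos by linarith
  with t pan_equation_iff[OF this assms, of n] show ?thesis unfolding f_def by auto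
qed

lemma pan_t:
  assumes "0 < h" shows "1 / a < pan_t n a h" "pan_height n a (pan_t n a h) = h"
proof -
  obtain t where t: "1 / a < t" "pan_height n a t = h" using pan_height_surj[OF assms] by blast
  have "pan_t n a h = t" unfolding pan_t_def
  proof (rule the_equality)
    show "0 < t \<and> real n = (a\<^sup>2 * t\<^sup>2 - 1) / (2 * a * t) * h + ((a\<^sup>2 - 2) * t\<^sup>2 - 1) / (2 * t * sqrt (1 + t\<^sup>2))"
      using t at_gt_1 pan_equation_iff assms by auto
  next
    fix u assume "0 < u \<and> real n = (a\<^sup>2 * u\<^sup>2 - 1) / (2 * a * u) * h + ((a\<^sup>2 - 2) * u\<^sup>2 - 1) / (2 * u * sqrt (1 + u\<^sup>2))"
    then have "1 / a < u" "pan_height n a u = h" using pan_equation_iff[of u h n] assms by auto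
    then show "u = t" using t by (intro pan_height_inj[of u t n]) simp_all
  qed
  with t show "1 / a < pan_t n a h" "pan_height n a (pan_t n a h) = h" by auto
qed

lemma pan_t_height: assumes "1 / a < t" shows "pan_t n a (pan_height n a t) = t"
  using pan_t[OF pan_height_pos[OF assms]] assms by (intro pan_height_inj[of _ t n]) simp_all

lemma pan_t_strict_antimono: assumes "0 < h" "h < h'" shows "pan_t n a h' < pan_t n a h"
proof (cases "pan_t n a h" "pan_t n a h'" rule: linorder_cases)
  case less
  then have "pan_height n a (pan_t n a h') < pan_height n a (pan_t n a h)"
    using pan_t(1) assms by (intro pan_height_strict_antimono) auto
  then show ?thesis using assms by (simp add: pan_t(2))
next
  case equal
  then have "pan_height n a (pan_t n a h) = pan_height n a (pan_t n a h')" by simp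
  then show ?thesis using assms by (simp add: pan_t(2))
qed

lemma Delta_profile_factors_pos:
  assumes "0 \<le> v" "v < a\<^sup>2"
  shows "0 < (v + (2 - a\<^sup>2)) / (v + a\<^sup>2)"
    and "0 < 2 * (1 + v) * (1 + real n * sqrt (1 + v)) / (a\<^sup>2 - v) - 1"
proof -
  show "0 < (v + (2 - a\<^sup>2)) / (v + a\<^sup>2)" using assms a_sq by (intro divide_pos_pos) auto
  have "0 \<le> real n * sqrt (1 + v)" using assms by simp
  then have "2 * (1 + v) * 1 \<le> 2 * (1 + v) * (1 + real n * sqrt (1 + v))"
    using assms by (intro mult_left_mono) auto
  moreover have "a\<^sup>2 - v < 2 * (1 + v) * 1" using assms a_sq by simp
  ultimately have "a\<^sup>2 - v < 2 * (1 + v) * (1 + real n * sqrt (1 + v))"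
    by (rule less_le_trans[rotated])
  then show "0 < 2 * (1 + v) * (1 + real n * sqrt (1 + v)) / (a\<^sup>2 - v) - 1"
    using assms by (simp add: less_divide_eq_1)
qed

lemma Delta_profile_strict_mono:
  assumes "0 \<le> v" "v < w" "w < a\<^sup>2"
  shows "Delta_profile n a v < Delta_profile n a w"
proof -
  have "(v + (2 - a\<^sup>2)) / (v + a\<^sup>2) < (w + (2 - a\<^sup>2)) / (w + a\<^sup>2)"
  proof -
    have e: "(u + (2 - a\<^sup>2)) / (u + a\<^sup>2) = 1 - (2 * a\<^sup>2 - 2) / (u + a\<^sup>2)" if "0 \<le> u" for u
      using that a_sq by (simp add: field_simps)
    have "(2 * a\<^sup>2 - 2) / (w + a\<^sup>2) < (2 * a\<^sup>2 - 2) / (v + a\<^sup>2)"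
      using assms a_sq by (intro divide_strict_left_mono) (auto intro!: mult_pos_pos)
    then show ?thesis using e[of v] e[of w] assms by simp
  qed
  moreover have "2 * (1 + v) * (1 + real n * sqrt (1 + v)) / (a\<^sup>2 - v) - 1
     \<le> 2 * (1 + w) * (1 + real n * sqrt (1 + w)) / (a\<^sup>2 - w) - 1"
    using assms by (intro diff_right_mono frac_le mult_mono add_mono mult_nonneg_nonneg) auto
  ultimately show ?thesis unfolding Delta_profile_def
    using Delta_profile_factors_pos(1)[of v] Delta_profile_factors_pos(1)[of w]
      Delta_profile_factors_pos(2)[of v n] Delta_profile_factors_pos(2)[of w n] assms
    by (intro mult_less_le_imp_less) auto
qed

text \<open>
  The admissible indices are exactly those for which \<open>\<Delta>\<close> starts below 1 as \<open>h\<close> leaves 0.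
\<close>
lemma Delta_profile_0: "Delta_profile n a 0 < 1 \<longleftrightarrow> n \<in> pan_indices a"
proof -
  have "Delta_profile n a 0 < 1 \<longleftrightarrow> (2 - a\<^sup>2) * (2 * (1 + real n) - a\<^sup>2) < a\<^sup>2 * a\<^sup>2"
  proof -
    have "Delta_profile n a 0 = (2 - a\<^sup>2) * (2 * (1 + real n) - a\<^sup>2) / (a\<^sup>2 * a\<^sup>2)"
    proof -
      have "2 * (1 + real n) / a\<^sup>2 - 1 = (2 * (1 + real n) - a\<^sup>2) / a\<^sup>2"
        using a_pos by (simp add: diff_divide_distrib)
      then have "Delta_profile n a 0 = (2 - a\<^sup>2) / a\<^sup>2 * ((2 * (1 + real n) - a\<^sup>2) / a\<^sup>2)"
        by (simp add: Delta_profile_def)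
      then show ?thesis by (simp only: times_divide_times_eq)
    qed
    then show ?thesis using a_pos by (simp add: pos_divide_less_eq)
  qed
  also have "\<dots> \<longleftrightarrow> real n * (2 - a\<^sup>2) < 2 * (a\<^sup>2 - 1)"
  proof -
    have "(2 - a\<^sup>2) * (2 * (1 + real n) - a\<^sup>2) - a\<^sup>2 * a\<^sup>2 = 2 * (real n * (2 - a\<^sup>2) - 2 * (a\<^sup>2 - 1))"
      by (simp add: algebra_simps)
    moreover have "x < y \<longleftrightarrow> z < w" if "x - y = 2 * (z - w)" for x y z w :: real
      using that by (smt (verit))
    ultimately show ?thesis by blast
  qed
  also have "\<dots> \<longleftrightarrow> n \<in> pan_indices a"
    using a_sq by (simp add: pan_indices_def pos_less_divide_eq)
  finally show ?thesis .
qed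

lemma Delta_profile_eq_1: assumes "n \<in> pan_indices a"
  shows "\<exists>v. 0 < v \<and> v < a\<^sup>2 \<and> Delta_profile n a v = 1"
proof -
  \<comment> \<open>At this point \<open>a\<^sup>2 - v = 2 - a\<^sup>2\<close>, and the lower bounds for the two factors are reciprocal to each other.\<close>
  let ?b = "2 * a\<^sup>2 - 2"
  have b: "0 \<le> ?b" "?b < a\<^sup>2" using a_sq by auto
  have 1: "1 \<le> Delta_profile n a ?b"
  proof -
    have ab: "a\<^sup>2 - ?b = 2 - a\<^sup>2" by simp
    have "(2 - a\<^sup>2) / a\<^sup>2 \<le> (?b + (2 - a\<^sup>2)) / (?b + a\<^sup>2)"
    proof -
      have "0 \<le> 4 * (a\<^sup>2 - 1)\<^sup>2" by simp
      then have "(2 - a\<^sup>2) * (?b + a\<^sup>2) \<le> (?b + (2 - a\<^sup>2)) * a\<^sup>2"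
        by (simp add: algebra_simps power2_eq_square)
      moreover have "0 < a\<^sup>2" "0 < ?b + a\<^sup>2" using a_sq by auto
      ultimately show ?thesis by (simp only: pos_divide_le_eq pos_le_divide_eq times_divide_eq_left)
    qed
    moreover have "a\<^sup>2 / (2 - a\<^sup>2) \<le> 2 * (1 + ?b) * (1 + real n * sqrt (1 + ?b)) / (a\<^sup>2 - ?b) - 1"
    proof -
      have "2 * 1 * (1 + 0) \<le> 2 * (1 + ?b) * (1 + real n * sqrt (1 + ?b))"
        using b by (intro mult_mono add_mono) auto
      then have "2 / (2 - a\<^sup>2) \<le> 2 * (1 + ?b) * (1 + real n * sqrt (1 + ?b)) / (2 - a\<^sup>2)"
        using a_sq by (intro divide_right_mono) auto
      moreover have "a\<^sup>2 / (2 - a\<^sup>2) = 2 / (2 - a\<^sup>2) - 1" using a_sq by (simp add: field_simps)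
      ultimately show ?thesis by (simp only: ab)
    qed
    ultimately have "(2 - a\<^sup>2) / a\<^sup>2 * (a\<^sup>2 / (2 - a\<^sup>2)) \<le> Delta_profile n a ?b"
      unfolding Delta_profile_def using a_sq by (intro mult_mono) auto
    then show ?thesis using a_sq a_pos by simp
  qed
  have "continuous_on {0 .. ?b} (Delta_profile n a)"
    unfolding Delta_profile_def using b a_sq by (intro continuous_intros) auto
  then obtain v where v: "0 \<le> v" "v \<le> ?b" "Delta_profile n a v = 1"
    using IVT'[of "Delta_profile n a" 0 1 ?b] 1 b Delta_profile_0 assms by force
  moreover have "v \<noteq> 0" using v Delta_profile_0[of n] assms by auto
  ultimately show ?thesis using b by (intro exI[of _ v]) auto
qed

lemma inverse_square_bounds:
  assumes "1 / a < t" shows "0 < 1 / t\<^sup>2" "1 / t\<^sup>2 < a\<^sup>2"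
  using at_gt_1[OF assms] by (auto simp: field_simps)

lemma pan_sin_cos:
  assumes "0 < h"
  shows "sin (pan_lambda n a h) = pan_t n a h / sqrt (1 + (pan_t n a h)\<^sup>2)"
    and "cos (pan_lambda n a h) = 1 / sqrt (1 + (pan_t n a h)\<^sup>2)"
    and "sin (pan_beta n a h) = 1 / sqrt (1 + (a * pan_t n a h)\<^sup>2)"
    and "cos (pan_beta n a h) = a * pan_t n a h / sqrt (1 + (a * pan_t n a h)\<^sup>2)"
proof -
  let ?x = "a * pan_t n a h"
  have x: "0 < ?x" using at_gt_1[OF pan_t(1)[OF assms]] a_pos by simp
  have *: "sqrt (1 + (1 / ?x)\<^sup>2) = sqrt (1 + ?x\<^sup>2) / ?x"
  proof -
    have "1 + (1 / z)\<^sup>2 = (1 + z\<^sup>2) / z\<^sup>2" if "0 < z" for z :: real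
      using that by (simp add: field_simps)
    from this[OF x] have "1 + (1 / ?x)\<^sup>2 = (1 + ?x\<^sup>2) / ?x\<^sup>2" .
    then show ?thesis using x by (simp add: real_sqrt_divide)
  qed
  show "sin (pan_lambda n a h) = pan_t n a h / sqrt (1 + (pan_t n a h)\<^sup>2)"
    "cos (pan_lambda n a h) = 1 / sqrt (1 + (pan_t n a h)\<^sup>2)"
    unfolding pan_lambda_def by (simp_all add: sin_arctan cos_arctan)
  show "sin (pan_beta n a h) = 1 / sqrt (1 + ?x\<^sup>2)"
    unfolding pan_beta_def sin_arctan * using x by auto
  show "cos (pan_beta n a h) = ?x / sqrt (1 + ?x\<^sup>2)"
    unfolding pan_beta_def cos_arctan * by simp
qed

text \<open>
  The geometric content of the pantographic equation: in the strip unfolded by reflections, the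
  line with this slope through the marked point meets the vertical axis of symmetry at height \<open>-n\<close>.
\<close>
lemma half_chord_identity:
  fixes h n
  assumes "0 < h"
  defines "t \<equiv> pan_t n a h" and "l \<equiv> pan_lambda n a h"
  shows "real n + sin l = (a\<^sup>2 * t\<^sup>2 - 1) / (2 * a * t) * (h + a * cos l)"
proof -
  have t: "0 < t" "1 / a < t" unfolding t_def using at_gt_1[OF pan_t(1)[OF assms(1)]] pan_t(1)[OF assms(1)] by auto
  have "real n = (a\<^sup>2 * t\<^sup>2 - 1) / (2 * a * t) * h + ((a\<^sup>2 - 2) * t\<^sup>2 - 1) / (2 * t * sqrt (1 + t\<^sup>2))"
    using pan_equation_iff[OF t(1) assms(1)] t pan_t(2)[OF assms(1)] by (simp add: t_def)
  moreover have "sin l = t / sqrt (1 + t\<^sup>2)" "cos l = 1 / sqrt (1 + t\<^sup>2)"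
    using pan_sin_cos[OF assms(1)] by (auto simp: t_def l_def)
  moreover have "(a\<^sup>2 * t\<^sup>2 - 1) / (2 * a * t) * (a * (1 / r)) - t / r = ((a\<^sup>2 - 2) * t\<^sup>2 - 1) / (2 * t * r)"
    if "0 < r" for r
    using t a_pos that by (simp add: field_simps power2_eq_square)
  from this[of "sqrt (1 + t\<^sup>2)"]
  have "(a\<^sup>2 * t\<^sup>2 - 1) / (2 * a * t) * (a * (1 / sqrt (1 + t\<^sup>2))) - t / sqrt (1 + t\<^sup>2)
      = ((a\<^sup>2 - 2) * t\<^sup>2 - 1) / (2 * t * sqrt (1 + t\<^sup>2))" by (simp add: add_pos_nonneg)
  ultimately show ?thesis by (simp only: distrib_left)
qed

text \<open>
  By Pythagoras, since \<open>1 + m\<^sup>2\<close> is a perfect square for the slope \<open>m = (a\<^sup>2 t\<^sup>2 - 1) / (2 a t)\<close>.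
\<close>
lemma pan_chord_length:
  fixes h n
  assumes "0 < h"
  defines "t \<equiv> pan_t n a h" and "l \<equiv> pan_lambda n a h"
  shows "sqrt ((h + a * cos l)\<^sup>2 + (real n + sin l)\<^sup>2)
     = (real n + sin l) * (a\<^sup>2 * t\<^sup>2 + 1) / (a\<^sup>2 * t\<^sup>2 - 1)"
proof -
  define X where "X = h + a * cos l"
  have t: "0 < t" "1 < a\<^sup>2 * t\<^sup>2" using at_gt_1[OF pan_t(1)[OF assms(1)]] by (auto simp: t_def)
  have "0 < cos l" using pan_sin_cos(2)[OF assms(1)] unfolding l_def by (auto intro: add_pos_nonneg)
  then have X: "0 < X" using assms(1) a_pos by (simp add: X_def add_pos_pos)
  have n: "real n + sin l = (a\<^sup>2 * t\<^sup>2 - 1) / (2 * a * t) * X"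
    unfolding X_def t_def l_def by (rule half_chord_identity[OF assms(1)])
  have m: "1 + ((a\<^sup>2 * t\<^sup>2 - 1) / (2 * a * t))\<^sup>2 = ((a\<^sup>2 * t\<^sup>2 + 1) / (2 * a * t))\<^sup>2"
    using t a_pos by (simp add: field_simps power2_eq_square)
  have "X\<^sup>2 + (real n + sin l)\<^sup>2 = X\<^sup>2 * (1 + ((a\<^sup>2 * t\<^sup>2 - 1) / (2 * a * t))\<^sup>2)"
    unfolding n power_mult_distrib by (simp add: algebra_simps)
  also have "\<dots> = (X * ((a\<^sup>2 * t\<^sup>2 + 1) / (2 * a * t)))\<^sup>2" unfolding m power_mult_distrib ..
  finally have "sqrt (X\<^sup>2 + (real n + sin l)\<^sup>2) = X * ((a\<^sup>2 * t\<^sup>2 + 1) / (2 * a * t))"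
    using X t a_pos by simp
  also have "\<dots> = (real n + sin l) * (a\<^sup>2 * t\<^sup>2 + 1) / (a\<^sup>2 * t\<^sup>2 - 1)"
    unfolding n using t a_pos by simp
  finally show ?thesis by (simp add: X_def)
qed

lemma pan_Delta_profile:
  assumes h: "0 < h" shows "pan_Delta n a h = Delta_profile n a (1 / (pan_t n a h)\<^sup>2)"
proof -
  define t where "t = pan_t n a h"
  define l where "l = pan_lambda n a h"
  define r where "r = sqrt (1 + t\<^sup>2)"
  define S where "S = sqrt (1 + (a * t)\<^sup>2)"
  have t: "0 < t" "1 < a\<^sup>2 * t\<^sup>2" using at_gt_1[OF pan_t(1)[OF h]] by (auto simp: t_def)
  have r: "0 < r" "r\<^sup>2 = 1 + t\<^sup>2" and S: "0 < S" "S\<^sup>2 = 1 + a\<^sup>2 * t\<^sup>2"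
    unfolding r_def S_def by (auto intro: add_pos_nonneg simp: power_mult_distrib)
  have sc: "sin l = t / r" "cos l = 1 / r" "cos (pan_beta n a h) = a * t / S"
    using pan_sin_cos[OF h, of n] by (simp_all add: l_def t_def r_def S_def)
  have "a\<^sup>2 * (sin l)\<^sup>2 + (cos l)\<^sup>2 = (S / r)\<^sup>2"
    unfolding sc power_divide S by (simp add: add_divide_distrib)
  then have p: "(a\<^sup>2 * (sin l)\<^sup>2 + (cos l)\<^sup>2) powr (3/2) = (S / r) ^ 3"
    using r S by (simp add: powr_powr flip: powr_numeral)
  have k: "a / (a\<^sup>2 * (sin l)\<^sup>2 + (cos l)\<^sup>2) powr (3/2) / cos (pan_beta n a h) = r ^ 3 / (S\<^sup>2 * t)"
    unfolding sc(3) p using r(1) S(1) t a_pos by (simp add: field_simps power3_eq_cube power2_eq_square)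
  have v: "sqrt (1 + 1 / t\<^sup>2) = r / t"
  proof -
    have "1 + 1 / t\<^sup>2 = (r / t)\<^sup>2" unfolding power_divide using t by (simp add: r field_simps)
    then show ?thesis by (simp only: real_sqrt_abs) (use r t in simp)
  qed
  have 1: "2 * sin l * (r ^ 3 / (S\<^sup>2 * t)) - 1 = (1 / t\<^sup>2 + (2 - a\<^sup>2)) / (1 / t\<^sup>2 + a\<^sup>2)"
  proof -
    have "2 * sin l * (r ^ 3 / (S\<^sup>2 * t)) = 2 * r\<^sup>2 / S\<^sup>2"
      using r t by (simp add: sc power3_eq_cube power2_eq_square)
    also have "\<dots> - 1 = (2 * r\<^sup>2 - S\<^sup>2) / S\<^sup>2" using S(1) by (simp add: diff_divide_distrib)
    also have "\<dots> = (1 + (2 - a\<^sup>2) * t\<^sup>2) / (1 + a\<^sup>2 * t\<^sup>2)" unfolding r S by (simp add: algebra_simps)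
    also have "\<dots> = ((1 + (2 - a\<^sup>2) * t\<^sup>2) / t\<^sup>2) / ((1 + a\<^sup>2 * t\<^sup>2) / t\<^sup>2)" using t by simp
    also have "(1 + (2 - a\<^sup>2) * t\<^sup>2) / t\<^sup>2 = 1 / t\<^sup>2 + (2 - a\<^sup>2)" using t by (simp add: add_divide_distrib)
    also have "(1 + a\<^sup>2 * t\<^sup>2) / t\<^sup>2 = 1 / t\<^sup>2 + a\<^sup>2" using t by (simp add: add_divide_distrib)
    finally show ?thesis .
  qed
  have 2: "2 * sqrt ((h + a * cos l)\<^sup>2 + (real n + sin l)\<^sup>2) * (r ^ 3 / (S\<^sup>2 * t))
     = 2 * (1 + 1 / t\<^sup>2) * (1 + real n * (r / t)) / (a\<^sup>2 - 1 / t\<^sup>2)"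
  proof -
    have "2 * sqrt ((h + a * cos l)\<^sup>2 + (real n + sin l)\<^sup>2) * (r ^ 3 / (S\<^sup>2 * t))
       = 2 * ((real n + sin l) * S\<^sup>2 / (a\<^sup>2 * t\<^sup>2 - 1)) * (r ^ 3 / (S\<^sup>2 * t))"
      unfolding l_def pan_chord_length[OF h] t_def[symmetric] S(2) by (simp add: add.commute)
    also have "\<dots> = 2 * (real n + t / r) * r ^ 3 / (t * (a\<^sup>2 * t\<^sup>2 - 1))"
    proof -
      have "2 * (N * S\<^sup>2 / E) * (r ^ 3 / (S\<^sup>2 * t)) = 2 * N * r ^ 3 / (t * E)" for N E
        using S(1) by (simp add: mult_ac)
      then show ?thesis unfolding sc(1) .
    qed
    also have "\<dots> = 2 * r\<^sup>2 * (real n * r + t) / (t * (a\<^sup>2 * t\<^sup>2 - 1))"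
    proof -
      have "2 * (real n + t / r) * r ^ 3 = 2 * r\<^sup>2 * (real n * r + t)"
        using r(1) by (simp add: field_simps power2_eq_square power3_eq_cube)
      then show ?thesis by (rule arg_cong)
    qed
    also have "\<dots> = 2 * (r\<^sup>2 / t\<^sup>2) * ((real n * r + t) / t) / ((a\<^sup>2 * t\<^sup>2 - 1) / t\<^sup>2)"
      using t(1) by (simp add: power2_eq_square)
    also have "r\<^sup>2 / t\<^sup>2 = 1 + 1 / t\<^sup>2" unfolding r using t by (simp add: add_divide_distrib)
    also have "(real n * r + t) / t = 1 + real n * (r / t)" using t by (simp add: add_divide_distrib)
    also have "(a\<^sup>2 * t\<^sup>2 - 1) / t\<^sup>2 = a\<^sup>2 - 1 / t\<^sup>2" using t by (simp add: diff_divide_distrib)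
    finally show ?thesis .
  qed
  have "pan_Delta n a h = (2 * sin l * (r ^ 3 / (S\<^sup>2 * t)) - 1)
     * (2 * sqrt ((h + a * cos l)\<^sup>2 + (real n + sin l)\<^sup>2) * (r ^ 3 / (S\<^sup>2 * t)) - 1)"
    unfolding pan_Delta_def Let_def l_def[symmetric] k[symmetric] by (simp only: times_divide_eq_right)
  also have "\<dots> = Delta_profile n a (1 / t\<^sup>2)"
    unfolding 1 2 Delta_profile_def v ..
  finally show ?thesis by (simp add: t_def)
qed

lemma pan_Delta_strict_mono:
  assumes "0 < h" "h < h'" shows "pan_Delta n a h < pan_Delta n a h'"
proof -
  have t: "0 < pan_t n a h'" "pan_t n a h' < pan_t n a h"
    using at_gt_1[OF pan_t(1), of h' n] pan_t_strict_antimono assms by auto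
  then have "1 / (pan_t n a h)\<^sup>2 < 1 / (pan_t n a h')\<^sup>2"
    by (intro divide_strict_left_mono power_strict_mono mult_pos_pos zero_less_power) auto
  then show ?thesis
    using inverse_square_bounds[OF pan_t(1), of h n] inverse_square_bounds[OF pan_t(1), of h' n] assms
    by (simp add: pan_Delta_profile Delta_profile_strict_mono)
qed

lemma pan_h1:
  assumes "n \<in> pan_indices a"
  shows "0 < pan_h1 n a" "pan_Delta n a (pan_h1 n a) = 1"
proof -
  obtain v where v: "0 < v" "v < a\<^sup>2" "Delta_profile n a v = 1" using Delta_profile_eq_1[OF assms] by blast
  define t where "t = 1 / sqrt v"
  have "sqrt v < a" using v a_pos by (simp add: real_less_lsqrt)
  then have t: "1 / a < t" unfolding t_def using v a_pos by (intro divide_strict_left_mono) auto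
  have tv: "1 / t\<^sup>2 = v" unfolding t_def using v by (simp add: power_divide)
  let ?h = "pan_height n a t"
  have h: "0 < ?h" "pan_Delta n a ?h = 1"
    using pan_height_pos[OF t] by (auto simp: pan_Delta_profile pan_t_height[OF t] tv v)
  have "pan_h1 n a = ?h" unfolding pan_h1_def
  proof (rule the_equality)
    fix u assume u: "0 < u \<and> pan_Delta n a u = 1"
    show "u = ?h"
      using pan_Delta_strict_mono[of u ?h n] pan_Delta_strict_mono[of ?h u n] h u
      by (cases u ?h rule: linorder_cases) auto
  qed (use h in auto)
  then show "0 < pan_h1 n a" "pan_Delta n a (pan_h1 n a) = 1" using h by auto
qed

text \<open>
  \<open>\<Delta>\<close> exceeds its limit at \<open>h = 0\<close>, so \<open>\<Delta> < 1\<close> forces that limit below 1.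
\<close>
lemma pan_Delta_less_1:
  assumes "0 < h" "pan_Delta n a h < 1" shows "n \<in> pan_indices a" "h < pan_h1 n a"
proof -
  let ?v = "1 / (pan_t n a h)\<^sup>2"
  have "Delta_profile n a 0 < Delta_profile n a ?v"
    using inverse_square_bounds[OF pan_t(1)[OF assms(1), of n]]
    by (intro Delta_profile_strict_mono) auto
  then show n: "n \<in> pan_indices a" using assms by (simp add: pan_Delta_profile flip: Delta_profile_0)
  show "h < pan_h1 n a"
  proof (rule ccontr)
    assume "\<not> h < pan_h1 n a"
    then have "pan_Delta n a (pan_h1 n a) \<le> pan_Delta n a h"
      using pan_Delta_strict_mono[OF pan_h1(1)[OF n], of h n] by (cases "h = pan_h1 n a") auto
    then show False using pan_h1[OF n] assms by simp
  qed
qed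

text \<open>
  Both \<open>h\<close> and \<open>\<Delta>\<close> are continuous in \<open>t\<close>, so \<open>t\<close> slightly larger than the value belonging to
  \<open>h\<^sub>n\<^sup>1\<close> gives \<open>h\<close> slightly smaller and \<open>\<Delta>\<close> slightly below 1.
\<close>
lemma pan_Delta_near_1:
  assumes n: "n \<in> pan_indices a" and y: "y < pan_h1 n a"
  shows "\<exists>h. 0 < h \<and> y < h \<and> 1/2 < pan_Delta n a h \<and> pan_Delta n a h < 1"
proof -
  let ?h = "pan_h1 n a"
  note h = pan_h1[OF n]
  let ?t = "pan_t n a ?h"
  note t = pan_t[OF h(1), of n]
  note t0 = at_gt_1[OF t(1)]
  have r: "sqrt (1 + ?t\<^sup>2) \<noteq> 0" by (simp add: add_nonneg_eq_0_iff)
  have c1: "isCont (pan_height n a) ?t"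
    unfolding pan_height_def using t0 r by (intro continuous_intros) auto
  have D: "Delta_profile n a (1 / ?t\<^sup>2) = 1" using pan_Delta_profile[OF h(1), of n] h by simp
  have c2: "isCont (\<lambda>t. Delta_profile n a (1 / t\<^sup>2)) ?t"
  proof (rule isCont_o2[where f="\<lambda>t. 1 / t\<^sup>2"])
    show "isCont (\<lambda>t. 1 / t\<^sup>2) ?t" using t0 by (intro continuous_intros) auto
    have "isCont (Delta_profile n a) v" if "0 < v" "v < a\<^sup>2" for v
    proof -
      have "v + a\<^sup>2 \<noteq> 0" "a\<^sup>2 - v \<noteq> 0" using that by auto
      then show ?thesis unfolding Delta_profile_def by (intro continuous_intros)
    qed
    then show "isCont (Delta_profile n a) (1 / ?t\<^sup>2)"
      using inverse_square_bounds[OF t(1)] by blast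
  qed
  have "eventually (\<lambda>t. max y 0 < pan_height n a t) (at_right ?t)"
    using order_tendstoD(1)[OF c1[unfolded isCont_def], of "max y 0"] t h y
    by (auto simp: eventually_at_split)
  moreover have "eventually (\<lambda>t. 1/2 < Delta_profile n a (1 / t\<^sup>2)) (at_right ?t)"
    using order_tendstoD(1)[OF c2[unfolded isCont_def], of "1/2"] D
    by (auto simp: eventually_at_split)
  moreover have "eventually (\<lambda>t. ?t < t) (at_right ?t)" by (simp add: eventually_at_right_less)
  ultimately have "eventually (\<lambda>t. max y 0 < pan_height n a t \<and> 1/2 < Delta_profile n a (1 / t\<^sup>2) \<and> ?t < t) (at_right ?t)"
    by eventually_elim auto
  then obtain u where u: "max y 0 < pan_height n a u" "1/2 < Delta_profile n a (1 / u\<^sup>2)" "?t < u"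
    using eventually_happens'[OF trivial_limit_at_right_real] by blast
  have ua: "1 / a < u" using u t by simp
  have "pan_height n a u < ?h" using pan_height_strict_antimono[OF t(1) u(3), of n] t by simp
  then have "pan_Delta n a (pan_height n a u) < 1"
    using pan_Delta_strict_mono[of "pan_height n a u" ?h n] u h by auto
  moreover have "1/2 < pan_Delta n a (pan_height n a u)"
    using u by (simp add: pan_Delta_profile[OF pan_height_pos[OF ua]] pan_t_height[OF ua])
  ultimately show ?thesis using u by (intro exI[of _ "pan_height n a u"]) auto
qed

end

section \<open>The stadium: convexity and arc length\<close>

text \<open>
  The horizontal distance to the central rectangle, in units of the semi-axis \<open>a\<close>.
\<close>
definition excess :: "real \<Rightarrow> real \<Rightarrow> real \<Rightarrow> real" where
  "excess a h x = max 0 ((\<bar>x\<bar> - h) / a)"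

text \<open>
  A convex function whose unit level set is the stadium. It replaces a description of the interior by
  cases and makes the convexity of the region available as an inequality.
\<close>
definition stadium_gauge :: "real \<Rightarrow> real \<Rightarrow> real \<times> real \<Rightarrow> real" where
  "stadium_gauge a h p = (snd p)\<^sup>2 + (excess a h (fst p))\<^sup>2"

definition ellipse_speed :: "real \<Rightarrow> real \<Rightarrow> real" where
  "ellipse_speed a l = sqrt (a\<^sup>2 * (sin l)\<^sup>2 + (cos l)\<^sup>2)"

text \<open>
  The derivative of \<open>stadium_path\<close>, with the left derivative at the four junctions.
\<close>
definition stadium_velocity :: "real \<Rightarrow> real \<Rightarrow> real \<Rightarrow> real \<times> real" where
  "stadium_velocity a h u =
    (if u \<le> pi/2 then (- (a * sin u), cos u)
     else if u \<le> pi/2 + 2*h then (- 1, 0)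
     else if u \<le> 3*pi/2 + 2*h then (- (a * sin (u - 2*h)), cos (u - 2*h))
     else if u \<le> 3*pi/2 + 4*h then (1, 0)
     else (- (a * sin (u - 4*h)), cos (u - 4*h)))"

definition stadium_parameter :: "real \<Rightarrow> real \<Rightarrow> real \<Rightarrow> real" where
  "stadium_parameter a h s =
     (THE u. 0 \<le> u \<and> u < 2*pi + 4*h \<and> stadium_arc_length a h u = s rmod stadium_length a h)"

text \<open>
  All that the billiard map uses of the curve near a parameter \<open>s\<close>: a unit tangent that is continuous
  near \<open>s\<close> and rotates with curvature \<open>\<kappa>\<close> at \<open>s\<close>, and a normal that points into the region. The curvature
  jumps at the junctions, and \<open>s = 0\<close> is the base point of the parametrization; both are excluded.
\<close>
definition regular_at :: "real \<Rightarrow> real \<Rightarrow> real \<Rightarrow> real \<Rightarrow> bool" where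
  "regular_at a h s \<kappa> \<longleftrightarrow>
     0 < s \<and> s < stadium_length a h \<and>
     (stadium_tangent a h has_vector_derivative \<kappa> *\<^sub>R stadium_normal a h s) (at s) \<and>
     (\<forall>\<^sub>F s' in nhds s.
        (stadium_point a h has_vector_derivative stadium_tangent a h s') (at s') \<and>
        norm (stadium_tangent a h s') = 1 \<and> isCont (stadium_tangent a h) s' \<and>
        (\<forall>q. stadium_gauge a h q < 1 \<longrightarrow> 0 < inner (q - stadium_point a h s') (stadium_normal a h s')))"

locale elliptical_stadium =
  fixes a h :: real
  assumes a_gt1: "1 < a" and h_pos: "0 < h"
begin

lemma a0: "0 < a" using a_gt1 by simp

abbreviation "\<gamma> \<equiv> stadium_point a h"
abbreviation "\<tau> \<equiv> stadium_tangent a h"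
abbreviation "\<nu> \<equiv> stadium_normal a h"
abbreviation "len \<equiv> stadium_length a h"
abbreviation "curve \<equiv> stadium_path a h"
abbreviation "arc_length \<equiv> stadium_arc_length a h"
abbreviation "vel \<equiv> stadium_velocity a h"
abbreviation "par \<equiv> stadium_parameter a h"
abbreviation "u_end \<equiv> 2*pi + 4*h"
abbreviation "junctions \<equiv> {pi/2, pi/2 + 2*h, 3*pi/2 + 2*h, 3*pi/2 + 4*h}"
abbreviation "smooth_parameters \<equiv> {0 <..< u_end} - junctions"

lemma excess_nonneg: "0 \<le> excess a h x"
  by (simp add: excess_def)

lemma excess_convex:
  assumes "0 \<le> r" "r \<le> 1"
  shows "excess a h ((1 - r) * x + r * y) \<le> (1 - r) * excess a h x + r * excess a h y"
proof -
  have "\<bar>(1 - r) * x + r * y\<bar> \<le> (1 - r) * \<bar>x\<bar> + r * \<bar>y\<bar>"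
    using assms abs_triangle_ineq[of "(1 - r) * x" "r * y"] by (simp add: abs_mult)
  then have "\<bar>(1 - r) * x + r * y\<bar> - h \<le> (1 - r) * (\<bar>x\<bar> - h) + r * (\<bar>y\<bar> - h)"
    by (simp add: algebra_simps)
  then have "(\<bar>(1 - r) * x + r * y\<bar> - h) / a \<le> ((1 - r) * (\<bar>x\<bar> - h) + r * (\<bar>y\<bar> - h)) / a"
    using a0 by (intro divide_right_mono) auto
  also have "\<dots> = (1 - r) * ((\<bar>x\<bar> - h) / a) + r * ((\<bar>y\<bar> - h) / a)"
    by (simp add: add_divide_distrib)
  also have "\<dots> \<le> (1 - r) * excess a h x + r * excess a h y"
    using assms by (intro add_mono mult_left_mono) (auto simp: excess_def)
  finally have "(\<bar>(1 - r) * x + r * y\<bar> - h) / a \<le> (1 - r) * excess a h x + r * excess a h y" .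
  moreover have "0 \<le> (1 - r) * excess a h x + r * excess a h y"
    using assms excess_nonneg by simp
  ultimately show ?thesis unfolding excess_def[of a h "(1 - r) * x + r * y"] by simp
qed

lemma square_convex_gap:
  fixes x y r :: real
  shows "((1 - r) * x + r * y)\<^sup>2 = (1 - r) * x\<^sup>2 + r * y\<^sup>2 - r * (1 - r) * (x - y)\<^sup>2"
  by (simp add: power2_eq_square algebra_simps)

text \<open>
  The square of the height is strictly convex, so different heights at the ends suffice; chords along
  one of the straight segments have to be excluded in any case.
\<close>
lemma gauge_open_chord:
  assumes "stadium_gauge a h p \<le> 1" "stadium_gauge a h q \<le> 1" "snd p \<noteq> snd q" "0 < r" "r < 1"
  shows "stadium_gauge a h (p + r *\<^sub>R (q - p)) < 1"
proof -
  have p: "p + r *\<^sub>R (q - p) = ((1 - r) * fst p + r * fst q, (1 - r) * snd p + r * snd q)"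
    by (simp add: prod_eq_iff algebra_simps)
  let ?x = "excess a h (fst p)" and ?y = "excess a h (fst q)"
  have "(excess a h ((1 - r) * fst p + r * fst q))\<^sup>2 \<le> ((1 - r) * ?x + r * ?y)\<^sup>2"
    using assms by (intro power_mono excess_convex excess_nonneg) auto
  also have "\<dots> \<le> (1 - r) * ?x\<^sup>2 + r * ?y\<^sup>2" unfolding square_convex_gap using assms by simp
  finally have 1: "(excess a h ((1 - r) * fst p + r * fst q))\<^sup>2 \<le> (1 - r) * ?x\<^sup>2 + r * ?y\<^sup>2" .
  have "0 < r * (1 - r) * (snd p - snd q)\<^sup>2" using assms by simp
  then have 2: "((1 - r) * snd p + r * snd q)\<^sup>2 < (1 - r) * (snd p)\<^sup>2 + r * (snd q)\<^sup>2"
    unfolding square_convex_gap by simp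
  have "stadium_gauge a h (p + r *\<^sub>R (q - p)) < (1 - r) * stadium_gauge a h p + r * stadium_gauge a h q"
    unfolding p stadium_gauge_def using 1 2 by (simp add: algebra_simps)
  also have "\<dots> \<le> (1 - r) * 1 + r * 1"
    using assms by (intro add_mono mult_left_mono) auto
  finally show ?thesis by simp
qed

lemma excess_right: "0 \<le> c \<Longrightarrow> excess a h (a * c + h) = c"
  using a0 h_pos by (simp add: excess_def abs_of_nonneg)

lemma excess_minus: "excess a h (- x) = excess a h x" by (simp add: excess_def)

lemma excess_flat: "\<bar>x\<bar> \<le> h \<Longrightarrow> excess a h x = 0"
  unfolding excess_def using a0 by (intro max_absorb1 divide_nonpos_pos) auto

lemma gauge_stadium: assumes "p \<in> stadium a h" shows "stadium_gauge a h p = 1"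
proof -
  have *: "stadium_gauge a h (a * cos l + h, sin l) = 1" "stadium_gauge a h (- (a * cos l + h), sin l) = 1"
    if "l \<in> {- (pi/2)..pi/2}" for l
    using that cos_ge_zero[of l] by (auto simp: stadium_gauge_def excess_right excess_minus simp del: minus_add_distrib)
  from assms consider "p \<in> right_half_ellipse a h" | "p \<in> left_half_ellipse a h" | "p \<in> straight_segments h"
    by (auto simp: stadium_def)
  then show ?thesis
  proof cases
    case 1 then show ?thesis using * by (auto simp: right_half_ellipse_def)
  next
    case 2 then show ?thesis using * by (auto simp: left_half_ellipse_def right_half_ellipse_def simp del: minus_add_distrib)
  next
    case 3 then show ?thesis by (auto simp: straight_segments_def stadium_gauge_def excess_flat)
  qed
qed

lemma pi_half_bounds: "0 < pi / 2" "pi/2 < 3*pi/2" "3*pi/2 < 2*pi" by auto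

lemma piece_conditions:
  "pi/2 < u \<Longrightarrow> \<not> u \<le> pi/2"
  "pi/2 + 2*h < u \<Longrightarrow> \<not> u \<le> pi/2" "pi/2 + 2*h < u \<Longrightarrow> \<not> u \<le> pi/2 + 2*h"
  "3*pi/2 + 2*h < u \<Longrightarrow> \<not> u \<le> pi/2" "3*pi/2 + 2*h < u \<Longrightarrow> \<not> u \<le> pi/2 + 2*h"
  "3*pi/2 + 2*h < u \<Longrightarrow> \<not> u \<le> 3*pi/2 + 2*h"
  "3*pi/2 + 4*h < u \<Longrightarrow> \<not> u \<le> pi/2" "3*pi/2 + 4*h < u \<Longrightarrow> \<not> u \<le> pi/2 + 2*h"
  "3*pi/2 + 4*h < u \<Longrightarrow> \<not> u \<le> 3*pi/2 + 2*h" "3*pi/2 + 4*h < u \<Longrightarrow> \<not> u \<le> 3*pi/2 + 4*h"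
  using pi_gt_zero h_pos by linarith+

lemma curve_pieces:
  "u \<le> pi/2 \<Longrightarrow> curve u = (a * cos u + h, sin u)"
  "pi/2 < u \<Longrightarrow> u \<le> pi/2 + 2*h \<Longrightarrow> curve u = (h - (u - pi/2), 1)"
  "pi/2 + 2*h < u \<Longrightarrow> u \<le> 3*pi/2 + 2*h \<Longrightarrow> curve u = (a * cos (u - 2*h) - h, sin (u - 2*h))"
  "3*pi/2 + 2*h < u \<Longrightarrow> u \<le> 3*pi/2 + 4*h \<Longrightarrow> curve u = (- h + (u - (3*pi/2 + 2*h)), -1)"
  "3*pi/2 + 4*h < u \<Longrightarrow> curve u = (a * cos (u - 4*h) + h, sin (u - 4*h))"
proof -
  note c = piece_conditions
  show "u \<le> pi/2 \<Longrightarrow> curve u = (a * cos u + h, sin u)"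
    "pi/2 < u \<Longrightarrow> u \<le> pi/2 + 2*h \<Longrightarrow> curve u = (h - (u - pi/2), 1)"
    "pi/2 + 2*h < u \<Longrightarrow> u \<le> 3*pi/2 + 2*h \<Longrightarrow> curve u = (a * cos (u - 2*h) - h, sin (u - 2*h))"
    "3*pi/2 + 2*h < u \<Longrightarrow> u \<le> 3*pi/2 + 4*h \<Longrightarrow> curve u = (- h + (u - (3*pi/2 + 2*h)), -1)"
    "3*pi/2 + 4*h < u \<Longrightarrow> curve u = (a * cos (u - 4*h) + h, sin (u - 4*h))"
    unfolding stadium_path_def using c by presburger+
qed

lemma velocity_pieces:
  "u \<le> pi/2 \<Longrightarrow> vel u = (- (a * sin u), cos u)"
  "pi/2 < u \<Longrightarrow> u \<le> pi/2 + 2*h \<Longrightarrow> vel u = (-1, 0)"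
  "pi/2 + 2*h < u \<Longrightarrow> u \<le> 3*pi/2 + 2*h \<Longrightarrow> vel u = (- (a * sin (u - 2*h)), cos (u - 2*h))"
  "3*pi/2 + 2*h < u \<Longrightarrow> u \<le> 3*pi/2 + 4*h \<Longrightarrow> vel u = (1, 0)"
  "3*pi/2 + 4*h < u \<Longrightarrow> vel u = (- (a * sin (u - 4*h)), cos (u - 4*h))"
proof -
  note c = piece_conditions
  show "u \<le> pi/2 \<Longrightarrow> vel u = (- (a * sin u), cos u)"
    "pi/2 < u \<Longrightarrow> u \<le> pi/2 + 2*h \<Longrightarrow> vel u = (-1, 0)"
    "pi/2 + 2*h < u \<Longrightarrow> u \<le> 3*pi/2 + 2*h \<Longrightarrow> vel u = (- (a * sin (u - 2*h)), cos (u - 2*h))"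
    "3*pi/2 + 2*h < u \<Longrightarrow> u \<le> 3*pi/2 + 4*h \<Longrightarrow> vel u = (1, 0)"
    "3*pi/2 + 4*h < u \<Longrightarrow> vel u = (- (a * sin (u - 4*h)), cos (u - 4*h))"
    unfolding stadium_velocity_def using c by presburger+
qed

lemma path_in_stadium: assumes "0 \<le> u" "u \<le> u_end" shows "curve u \<in> stadium a h"
proof -
  consider "u \<le> pi/2" | "pi/2 < u" "u \<le> pi/2 + 2*h" | "pi/2 + 2*h < u" "u \<le> 3*pi/2 + 2*h"
    | "3*pi/2 + 2*h < u" "u \<le> 3*pi/2 + 4*h" | "3*pi/2 + 4*h < u" by linarith
  then show ?thesis
  proof cases
    case 1
    then have "curve u = (a * cos u + h, sin u)" by (simp add: curve_pieces)
    moreover have "u \<in> {- (pi/2)..pi/2}" using 1 assms by auto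
    ultimately show ?thesis by (auto simp: stadium_def right_half_ellipse_def)
  next
    case 2
    then show ?thesis by (auto simp: curve_pieces stadium_def straight_segments_def)
  next
    case 3
    define l where "l = pi - (u - 2*h)"
    have l: "l \<in> {- (pi/2)..pi/2}" using 3 by (auto simp: l_def field_simps)
    have "curve u = (a * cos (u - 2*h) - h, sin (u - 2*h))"
      using 3 h_pos pi_half_bounds by (simp add: curve_pieces)
    also have "u - 2*h = pi - l" by (simp add: l_def)
    finally have "curve u = (\<lambda>(x, y). (- x, y)) (a * cos l + h, sin l)" by simp
    then have "curve u \<in> left_half_ellipse a h"
      unfolding left_half_ellipse_def right_half_ellipse_def using l by blast
    then show ?thesis by (simp add: stadium_def)
  next
    case 4
    then show ?thesis using h_pos by (auto simp: curve_pieces stadium_def straight_segments_def)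
  next
    case 5
    define l where "l = u - 4*h - 2*pi"
    have l: "l \<in> {- (pi/2)..pi/2}" using 5 assms by (auto simp: l_def field_simps)
    have "curve u = (a * cos (u - 4*h) + h, sin (u - 4*h))"
      using 5 h_pos pi_half_bounds by (simp add: curve_pieces)
    also have "u - 4*h = l + 2*pi" by (simp add: l_def)
    finally have "curve u = (a * cos l + h, sin l)" by simp
    then show ?thesis using l by (auto simp: stadium_def right_half_ellipse_def)
  qed
qed

text \<open>
  An explicit left inverse avoids comparing the five pieces pairwise.
\<close>
lemma path_inj: "inj_on curve {0..<u_end}"
proof -
  define position where "position = (\<lambda>(x, y). if y = 1 then pi/2 + h - x else if y = - 1 then 3*pi/2 + 3*h + x
     else if x < 0 then pi - arcsin y + 2*h else if 0 \<le> y then arcsin y else 2*pi + arcsin y + 4*h)"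
  have "position (curve u) = u" if "u \<in> {0..<u_end}" for u
  proof -
    consider "u = pi/2" | "u < pi/2" | "pi/2 < u" "u \<le> pi/2 + 2*h"
      | "pi/2 + 2*h < u" "u < 3*pi/2 + 2*h" | "u = 3*pi/2 + 2*h"
      | "3*pi/2 + 2*h < u" "u \<le> 3*pi/2 + 4*h" | "3*pi/2 + 4*h < u" by linarith
    then show ?thesis
    proof cases
      case 1
      have "curve u = (h, 1)" unfolding 1 by (simp add: curve_pieces(1))
      then show ?thesis by (simp add: position_def 1)
    next
      case 2
      have "sin u < sin (pi/2)" using 2 that by (intro sin_monotone_2pi) auto
      moreover have "0 \<le> sin u" using 2 that by (intro sin_ge_zero) auto
      moreover have "0 \<le> cos u" using 2 that by (intro cos_ge_zero) auto
      moreover have "arcsin (sin u) = u" using 2 that by (intro arcsin_sin) auto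
      ultimately show ?thesis using 2 a0 h_pos
        by (simp add: position_def curve_pieces not_less add_nonneg_nonneg)
    next
      case 3 then show ?thesis by (simp add: position_def curve_pieces)
    next
      case 4
      define l where "l = pi - (u - 2*h)"
      have l: "- (pi/2) < l" "l < pi/2" using 4 by (auto simp: l_def field_simps)
      have "curve u = (a * cos (u - 2*h) - h, sin (u - 2*h))"
        using 4 h_pos pi_half_bounds by (simp add: curve_pieces)
      also have "u - 2*h = pi - l" by (simp add: l_def)
      finally have p: "curve u = (- (a * cos l) - h, sin l)" by simp
      have "sin l < sin (pi/2)" using l by (intro sin_monotone_2pi) auto
      moreover have "sin (- (pi/2)) < sin l" using l by (intro sin_monotone_2pi) auto
      moreover have "0 < cos l" using l by (intro cos_gt_zero_pi) auto
      moreover have "arcsin (sin l) = l" using l by (intro arcsin_sin) auto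
      moreover have "- (a * cos l) - h < 0" using a0 h_pos calculation(3) mult_pos_pos[of a "cos l"] by linarith
      ultimately show ?thesis unfolding p position_def by (simp add: l_def)
    next
      case 5
      have "curve u = (a * cos (3*pi/2) - h, sin (3*pi/2))"
        unfolding 5 using h_pos pi_half_bounds by (simp add: curve_pieces)
      also have "cos (3*pi/2) = 0" using cos_3over2_pi by simp
      also have "sin (3*pi/2) = -1" using sin_3over2_pi by simp
      finally show ?thesis by (simp add: position_def 5)
    next
      case 6 then show ?thesis using h_pos pi_half_bounds by (simp add: position_def curve_pieces)
    next
      case 7
      define l where "l = u - 4*h - 2*pi"
      have l: "- (pi/2) < l" "l < 0" using 7 that by (auto simp: l_def field_simps)
      have "curve u = (a * cos (u - 4*h) + h, sin (u - 4*h))"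
        using 7 h_pos pi_half_bounds by (simp add: curve_pieces)
      also have "u - 4*h = l + 2*pi" by (simp add: l_def)
      finally have p: "curve u = (a * cos l + h, sin l)" by simp
      have "sin l < sin 0" using l by (intro sin_monotone_2pi) auto
      moreover have "sin (- (pi/2)) < sin l" using l by (intro sin_monotone_2pi) auto
      moreover have "0 < cos l" using l by (intro cos_gt_zero_pi) auto
      moreover have "arcsin (sin l) = l" using l by (intro arcsin_sin) auto
      moreover have "0 < a * cos l + h" using a0 h_pos calculation(3) by (simp add: add_pos_pos)
      ultimately show ?thesis unfolding p position_def by (simp add: l_def)
    qed
  qed
  then show ?thesis by (rule inj_on_inverseI)
qed

lemma ellipse_speed_ge1: "1 \<le> ellipse_speed a l"
proof -
  have "1 * (sin l)\<^sup>2 \<le> a\<^sup>2 * (sin l)\<^sup>2" using a_gt1 by (intro mult_right_mono) (auto simp: one_le_power)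
  then have "1 \<le> a\<^sup>2 * (sin l)\<^sup>2 + (cos l)\<^sup>2" using sin_cos_squared_add[of l] by linarith
  then show ?thesis by (simp add: ellipse_speed_def)
qed

lemma norm_ellipse_velocity: "norm (- (a * sin l), cos l) = ellipse_speed a l"
  by (simp add: ellipse_speed_def norm_Pair power_mult_distrib)

lemma norm_velocity_ge1: "1 \<le> norm (vel u)"
proof -
  have "norm (- 1 :: real, 0 :: real) = 1" "norm (1 :: real, 0 :: real) = 1" by (simp_all add: norm_Pair)
  then show ?thesis by (simp add: stadium_velocity_def norm_ellipse_velocity ellipse_speed_ge1)
qed

lemma ellipse_path_derivative:
  "((\<lambda>u. (a * cos (u - c) + e, sin (u - c))) has_vector_derivative (- (a * sin (u - c)), cos (u - c))) (at u)"
  by (auto intro!: derivative_eq_intros has_vector_derivative_Pair simp flip: has_real_derivative_iff_has_vector_derivative)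

lemma path_velocity: assumes "u \<notin> junctions" shows "(curve has_vector_derivative vel u) (at u)"
proof -
  consider "u < pi/2" | "pi/2 < u" "u < pi/2 + 2*h" | "pi/2 + 2*h < u" "u < 3*pi/2 + 2*h"
    | "3*pi/2 + 2*h < u" "u < 3*pi/2 + 4*h" | "3*pi/2 + 4*h < u" using assms by force
  then show ?thesis
  proof cases
    case 1
    have "((\<lambda>u. (a * cos (u - 0) + h, sin (u - 0))) has_vector_derivative vel u) (at u)"
      using ellipse_path_derivative[of 0 h u] 1 by (simp add: velocity_pieces)
    then show ?thesis
      by (rule has_vector_derivative_transform_within_open[where S="{..<pi/2}"]) (use 1 in \<open>auto simp: curve_pieces\<close>)
  next
    case 2
    have "((\<lambda>u. (h - (u - pi/2), 1)) has_vector_derivative vel u) (at u)"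
      using 2 by (auto simp: velocity_pieces intro!: derivative_eq_intros has_vector_derivative_Pair
        simp flip: has_real_derivative_iff_has_vector_derivative)
    then show ?thesis
      by (rule has_vector_derivative_transform_within_open[where S="{pi/2<..<pi/2+2*h}"]) (use 2 in \<open>auto simp: curve_pieces\<close>)
  next
    case 3
    have "((\<lambda>u. (a * cos (u - 2*h) + (- h), sin (u - 2*h))) has_vector_derivative vel u) (at u)"
      using ellipse_path_derivative[of "2*h" "-h" u] 3 h_pos by (simp add: velocity_pieces)
    then show ?thesis
      by (rule has_vector_derivative_transform_within_open[where S="{pi/2+2*h<..<3*pi/2+2*h}"])
        (use 3 h_pos in \<open>auto simp: curve_pieces\<close>)
  next
    case 4
    have "((\<lambda>u. (- h + (u - (3*pi/2 + 2*h)), -1)) has_vector_derivative vel u) (at u)"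
      using 4 h_pos by (auto simp: velocity_pieces intro!: derivative_eq_intros has_vector_derivative_Pair
        simp flip: has_real_derivative_iff_has_vector_derivative)
    then show ?thesis
      by (rule has_vector_derivative_transform_within_open[where S="{3*pi/2+2*h<..<3*pi/2+4*h}"])
        (use 4 h_pos in \<open>auto simp: curve_pieces\<close>)
  next
    case 5
    have "((\<lambda>u. (a * cos (u - 4*h) + h, sin (u - 4*h))) has_vector_derivative vel u) (at u)"
      using ellipse_path_derivative[of "4*h" h u] 5 h_pos pi_half_bounds by (simp add: velocity_pieces)
    then show ?thesis
      by (rule has_vector_derivative_transform_within_open[where S="{3*pi/2+4*h<..}"])
        (use 5 h_pos in \<open>auto simp: curve_pieces\<close>)
  qed
qed

lemma arc_length_integral: "arc_length u = integral {0..u} (\<lambda>v. norm (vel v))"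
  unfolding stadium_arc_length_def
  by (rule integral_spike[of junctions]) (auto simp: vector_derivative_at[OF path_velocity])

lemma isCont_velocity: assumes "u \<notin> junctions" shows "isCont vel u"
proof -
  have e: "isCont (\<lambda>u. (- (a * sin (u - c)), cos (u - c))) u" for c
    by (intro continuous_intros)
  consider "u < pi/2" | "pi/2 < u" "u < pi/2 + 2*h" | "pi/2 + 2*h < u" "u < 3*pi/2 + 2*h"
    | "3*pi/2 + 2*h < u" "u < 3*pi/2 + 4*h" | "3*pi/2 + 4*h < u" using assms by force
  then show ?thesis
  proof cases
    case 1
    have "\<forall>\<^sub>F v in nhds u. v \<in> {..<pi/2}" using 1 by (intro eventually_nhds_in_open) auto
    then have "\<forall>\<^sub>F v in nhds u. (- (a * sin (v - 0)), cos (v - 0)) = vel v"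
      by eventually_elim (simp add: velocity_pieces)
    then show ?thesis using e[of 0] by (rule isCont_cong[THEN iffD1])
  next
    case 2
    have "\<forall>\<^sub>F v in nhds u. v \<in> {pi/2<..<pi/2+2*h}" using 2 by (intro eventually_nhds_in_open) auto
    then have "\<forall>\<^sub>F v in nhds u. (-1, 0) = vel v"
      by eventually_elim (simp add: velocity_pieces)
    then show ?thesis using continuous_const by (rule isCont_cong[THEN iffD1])
  next
    case 3
    have "\<forall>\<^sub>F v in nhds u. v \<in> {pi/2+2*h<..<3*pi/2+2*h}" using 3 by (intro eventually_nhds_in_open) auto
    then have "\<forall>\<^sub>F v in nhds u. (- (a * sin (v - 2*h)), cos (v - 2*h)) = vel v"
      by eventually_elim (use h_pos in \<open>simp add: velocity_pieces\<close>)
    then show ?thesis using e[of "2*h"] by (rule isCont_cong[THEN iffD1])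
  next
    case 4
    have "\<forall>\<^sub>F v in nhds u. v \<in> {3*pi/2+2*h<..<3*pi/2+4*h}" using 4 by (intro eventually_nhds_in_open) auto
    then have "\<forall>\<^sub>F v in nhds u. (1, 0) = vel v"
      by eventually_elim (use h_pos in \<open>simp add: velocity_pieces\<close>)
    then show ?thesis using continuous_const by (rule isCont_cong[THEN iffD1])
  next
    case 5
    have "\<forall>\<^sub>F v in nhds u. v \<in> {3*pi/2+4*h<..}" using 5 by (intro eventually_nhds_in_open) auto
    then have "\<forall>\<^sub>F v in nhds u. (- (a * sin (v - 4*h)), cos (v - 4*h)) = vel v"
      by eventually_elim (use h_pos pi_half_bounds in \<open>simp add: velocity_pieces\<close>)
    then show ?thesis using e[of "4*h"] by (rule isCont_cong[THEN iffD1])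
  qed
qed

lemma speed_integrable: "(\<lambda>v. norm (vel v)) integrable_on {0..u}"
proof -
  have 0: "(\<lambda>v. norm (vel v)) integrable_on {x..y}"
    if "\<And>v. x < v \<Longrightarrow> v < y \<Longrightarrow> norm (vel v) = ellipse_speed a (v - c)" for x y c
  proof (rule integrable_spike_finite[of "{x, y}"])
    show "(\<lambda>v. ellipse_speed a (v - c)) integrable_on {x..y}"
      unfolding ellipse_speed_def by (intro integrable_continuous_real continuous_intros)
  qed (use that in auto)
  have 1: "(\<lambda>v. norm (vel v)) integrable_on {x..y}"
    if "\<And>v. x < v \<Longrightarrow> v < y \<Longrightarrow> norm (vel v) = 1" for x y
    by (rule integrable_spike_finite[of "{x, y}" _ _ "\<lambda>_. 1"]) (use that in auto)
  define w where "w = max (3*pi/2 + 4*h + 1) u"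
  have j: "0 \<le> pi/2" "pi/2 \<le> pi/2 + 2*h" "pi/2 + 2*h \<le> 3*pi/2 + 2*h" "3*pi/2 + 2*h \<le> 3*pi/2 + 4*h"
    "3*pi/2 + 4*h \<le> w" using h_pos by (auto simp: w_def)
  have "(\<lambda>v. norm (vel v)) integrable_on {0..pi/2}"
    by (rule 0[where c=0]) (auto simp: velocity_pieces norm_ellipse_velocity)
  moreover have "(\<lambda>v. norm (vel v)) integrable_on {pi/2..pi/2 + 2*h}"
    by (rule 1) (auto simp: velocity_pieces norm_Pair)
  moreover have "(\<lambda>v. norm (vel v)) integrable_on {pi/2 + 2*h..3*pi/2 + 2*h}"
    by (rule 0[where c="2*h"]) (use h_pos in \<open>auto simp: velocity_pieces norm_ellipse_velocity\<close>)
  moreover have "(\<lambda>v. norm (vel v)) integrable_on {3*pi/2 + 2*h..3*pi/2 + 4*h}"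
    by (rule 1) (use h_pos in \<open>auto simp: velocity_pieces norm_Pair\<close>)
  moreover have "(\<lambda>v. norm (vel v)) integrable_on {3*pi/2 + 4*h..w}"
    by (rule 0[where c="4*h"]) (use h_pos pi_half_bounds in \<open>auto simp: velocity_pieces norm_ellipse_velocity\<close>)
  ultimately have "(\<lambda>v. norm (vel v)) integrable_on {0..w}"
    using j by (meson Henstock_Kurzweil_Integration.integrable_combine order_trans)
  then show ?thesis by (rule integrable_on_subinterval) (auto simp: w_def)
qed

text \<open>
  The speed is at least 1 because the short semi-axis is 1.
\<close>
lemma arc_length_diff:
  assumes "0 \<le> u" "u \<le> v" shows "v - u \<le> arc_length v - arc_length u"
proof -
  have "arc_length u + integral {u..v} (\<lambda>v. norm (vel v)) = arc_length v"
    unfolding arc_length_integral using assms speed_integrable by (intro Henstock_Kurzweil_Integration.integral_combine) auto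
  moreover have "integral {u..v} (\<lambda>v. 1) \<le> integral {u..v} (\<lambda>v. norm (vel v))"
    using integrable_on_subinterval[OF speed_integrable[of v], of u v] assms norm_velocity_ge1
    by (intro integral_le) auto
  ultimately show ?thesis using assms by simp
qed

lemma arc_length_strict_mono: "0 \<le> u \<Longrightarrow> u < v \<Longrightarrow> arc_length u < arc_length v"
  using arc_length_diff[of u v] by simp

lemma arc_length_0: "arc_length 0 = 0" by (simp add: stadium_arc_length_def)

lemma arc_length_continuous: "continuous_on {0..u} arc_length"
  using indefinite_integral_continuous_1[OF speed_integrable[of u]] by (simp add: arc_length_integral)

lemma length_pos: "0 < len"
  unfolding stadium_length_def using arc_length_strict_mono[of 0 u_end] h_pos by (simp add: arc_length_0 add_pos_pos)

lemma arc_length_bounds: assumes "0 \<le> u" "u < u_end" shows "0 \<le> arc_length u" "arc_length u < len"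
  using assms arc_length_strict_mono[of 0 u] arc_length_strict_mono[of u u_end]
  by (cases "u = 0"; auto simp: arc_length_0 stadium_length_def)+

lemma par_arc_length: assumes "0 \<le> u" "u < u_end" shows "par (arc_length u) = u"
proof -
  have mod: "arc_length u rmod len = arc_length u"
    using arc_length_bounds[OF assms] length_pos by (intro rmod_unique[of _ _ _ 0]) auto
  show ?thesis unfolding stadium_parameter_def
  proof (rule the_equality)
    fix v assume v: "0 \<le> v \<and> v < u_end \<and> arc_length v = arc_length u rmod len"
    show "v = u" using v mod assms arc_length_strict_mono[of u v] arc_length_strict_mono[of v u]
      by (cases u v rule: linorder_cases) simp_all
  qed (use assms mod in simp)
qed

lemma arc_length_surj: assumes "0 \<le> s" "s < len" shows "\<exists>u. 0 \<le> u \<and> u < u_end \<and> arc_length u = s"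
proof -
  have "\<exists>u\<ge>0. u \<le> u_end \<and> arc_length u = s"
    using assms arc_length_continuous h_pos by (intro IVT') (auto simp: arc_length_0 stadium_length_def)
  then show ?thesis using assms by (metis less_eq_real_def less_irrefl stadium_length_def)
qed

lemma par: assumes "0 \<le> s" "s < len" shows "0 \<le> par s" "par s < u_end" "arc_length (par s) = s"
proof -
  obtain u where "0 \<le> u" "u < u_end" "arc_length u = s" using arc_length_surj[OF assms] by blast
  with par_arc_length[of u] show "0 \<le> par s" "par s < u_end" "arc_length (par s) = s" by auto
qed

lemma point_par: "\<gamma> s = curve (par s)"
  unfolding stadium_point_def stadium_parameter_def ..

lemma point_in_stadium: "0 \<le> s \<Longrightarrow> s < len \<Longrightarrow> \<gamma> s \<in> stadium a h"
  unfolding point_par using par[of s] by (intro path_in_stadium) auto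

lemma point_inj: "inj_on \<gamma> {0..<len}"
proof (rule inj_onI)
  fix s s' assume *: "s \<in> {0..<len}" "s' \<in> {0..<len}" "\<gamma> s = \<gamma> s'"
  have "par s = par s'"
    using *(3) par(1,2)[of s] par(1,2)[of s'] *(1,2) unfolding point_par by (intro inj_onD[OF path_inj]) auto
  then show "s = s'" using *(1,2) by (metis atLeastLessThan_iff par(3))
qed

definition rot :: "real \<times> real \<Rightarrow> real \<times> real" where "rot v = (- snd v, fst v)"

definition unit_velocity :: "real \<Rightarrow> real \<times> real" where
  "unit_velocity u = (1 / norm (vel u)) *\<^sub>R vel u"

lemma normal_rot: "\<nu> s = rot (\<tau> s)" by (simp add: stadium_normal_def rot_def)

lemma open_smooth_parameters: "open smooth_parameters"
  by (intro open_Diff open_greaterThanLessThan) (simp add: finite_imp_closed)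

lemma arc_length_derivative:
  assumes "u \<in> smooth_parameters" shows "(arc_length has_real_derivative norm (vel u)) (at u)"
proof -
  have "((\<lambda>u. integral {0..u} (\<lambda>v. norm (vel v))) has_vector_derivative norm (vel u)) (at u within {0..u_end} - {})"
    using assms isCont_velocity[of u]
    by (intro integral_has_vector_derivative_continuous_at speed_integrable)
      (auto intro!: continuous_at_imp_continuous_at_within continuous_intros)
  then have "((\<lambda>u. integral {0..u} (\<lambda>v. norm (vel v))) has_vector_derivative norm (vel u)) (at u within {0..u_end})"
    by simp
  moreover have "at u within {0..u_end} = at u" using assms by (intro at_within_interior) auto
  ultimately have "(arc_length has_vector_derivative norm (vel u)) (at u)"
    by (simp only: arc_length_integral[abs_def])
  then show ?thesis by (simp add: has_real_derivative_iff_has_vector_derivative)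
qed

lemma norm_velocity_pos: "0 < norm (vel u)"
  using norm_velocity_ge1[of u] by linarith

lemma par_derivative:
  assumes "u \<in> smooth_parameters"
  shows "(par has_real_derivative inverse (norm (vel u))) (at (arc_length u))"
  unfolding has_field_derivative_def
proof (rule has_derivative_inverse_strong[where S="{0<..<u_end}" and f=arc_length and g=par and x=u])
  show "(arc_length has_derivative (*) (norm (vel u))) (at u)"
    using arc_length_derivative[OF assms] by (simp only: has_field_derivative_def)
  show "(*) (norm (vel u)) \<circ> (*) (inverse (norm (vel u))) = id"
    using norm_velocity_pos[of u] by (simp add: fun_eq_iff)
  show "continuous_on {0<..<u_end} arc_length"
    by (rule continuous_on_subset[OF arc_length_continuous[of u_end]]) auto
  show "\<And>z. z \<in> {0<..<u_end} \<Longrightarrow> par (arc_length z) = z" by (simp add: par_arc_length)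
qed (use assms in auto)

lemma arc_length_interior: assumes "u \<in> smooth_parameters" shows "0 < arc_length u" "arc_length u < len"
  using assms arc_length_strict_mono[of 0 u] arc_length_bounds[of u] by (auto simp: arc_length_0)

lemma eventually_smooth:
  assumes "u \<in> smooth_parameters"
  shows "\<forall>\<^sub>F s in nhds (arc_length u). par s \<in> smooth_parameters \<and> arc_length (par s) = s"
proof -
  have "isCont par (arc_length u)" by (rule DERIV_isCont[OF par_derivative[OF assms]])
  moreover have "par (arc_length u) = u" using assms by (intro par_arc_length) auto
  ultimately have "(par \<longlongrightarrow> u) (nhds (arc_length u))"
    using tendsto_at_iff_tendsto_nhds[of par "arc_length u"] by (simp only: isCont_def)
  then have "\<forall>\<^sub>F s in nhds (arc_length u). par s \<in> smooth_parameters"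
    using topological_tendstoD[OF _ open_smooth_parameters assms] by blast
  moreover have "\<forall>\<^sub>F s in nhds (arc_length u). s \<in> {0<..<len}"
    using arc_length_interior[OF assms] by (intro eventually_nhds_in_open) auto
  ultimately show ?thesis
    by eventually_elim (simp add: par(3))
qed

text \<open>
  Arc length as parameter turns the velocity into a unit vector, whatever its jumps at the junctions.
\<close>
lemma point_derivative:
  assumes "u \<in> smooth_parameters"
  shows "(\<gamma> has_vector_derivative unit_velocity u) (at (arc_length u))"
proof -
  have u: "par (arc_length u) = u" using assms by (intro par_arc_length) auto
  have "(curve \<circ> par has_vector_derivative inverse (norm (vel u)) *\<^sub>R vel u) (at (arc_length u))"
    by (rule vector_diff_chain_at)
      (use assms path_velocity[of u] par_derivative[OF assms] in
        \<open>simp_all add: u has_real_derivative_iff_has_vector_derivative\<close>)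
  moreover have "curve \<circ> par = \<gamma>" by (simp add: fun_eq_iff point_par)
  ultimately show ?thesis by (simp add: unit_velocity_def divide_inverse)
qed

lemma tangent_smooth: "u \<in> smooth_parameters \<Longrightarrow> \<tau> (arc_length u) = unit_velocity u"
  unfolding stadium_tangent_def by (rule vector_derivative_at[OF point_derivative])

lemma norm_unit_velocity: "norm (unit_velocity u) = 1"
  using norm_velocity_pos[of u] by (simp add: unit_velocity_def)

text \<open>
  The supporting line of the ellipse, by the Cauchy-Schwarz inequality for \<open>(\<xi>, y)\<close> and \<open>(c, s)\<close>.
\<close>
lemma inward_right:
  assumes "0 < c" "c\<^sup>2 + s\<^sup>2 = 1" "stadium_gauge a h q < 1"
  shows "0 < inner (q - (a * c + h, s)) (- c, - (a * s))"
proof -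
  obtain x y where q: "q = (x, y)" by (cases q)
  define \<xi> where "\<xi> = excess a h x"
  have "(\<xi> * c + y * s)\<^sup>2 + (\<xi> * s - y * c)\<^sup>2 = (y\<^sup>2 + \<xi>\<^sup>2) * (c\<^sup>2 + s\<^sup>2)"
    by (simp add: power2_eq_square algebra_simps)
  moreover have "y\<^sup>2 + \<xi>\<^sup>2 < 1" using assms(3) by (simp add: q stadium_gauge_def \<xi>_def)
  ultimately have "(\<xi> * c + y * s)\<^sup>2 < 1\<^sup>2"
    using zero_le_power2[of "\<xi> * s - y * c"] unfolding assms(2) power_one mult_1_right by linarith
  then have "\<xi> * c + y * s < 1" by (rule power_less_imp_less_base) simp
  then have "a * (\<xi> * c + y * s) < a * 1" using a0 by (intro mult_strict_left_mono) auto
  moreover have "x - h \<le> a * \<xi>"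
  proof -
    have "(x - h) / a \<le> \<xi>" unfolding \<xi>_def excess_def
      using a0 by (intro max.coboundedI2 divide_right_mono) auto
    then show ?thesis using a0 by (simp add: pos_divide_le_eq mult.commute)
  qed
  then have "(x - h) * c \<le> a * \<xi> * c" using assms(1) by (intro mult_right_mono) auto
  moreover have "inner (q - (a * c + h, s)) (- c, - (a * s)) = a * (c\<^sup>2 + s\<^sup>2) - (x - h) * c - a * (y * s)"
    by (simp add: q inner_Pair power2_eq_square algebra_simps)
  ultimately show ?thesis using assms(2) by (simp add: algebra_simps)
qed

lemma inward_left:
  assumes "c < 0" "c\<^sup>2 + s\<^sup>2 = 1" "stadium_gauge a h q < 1"
  shows "0 < inner (q - (a * c - h, s)) (- c, - (a * s))"
proof -
  have "0 < inner ((- fst q, snd q) - (a * (- c) + h, s)) (- (- c), - (a * s))"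
    using assms by (intro inward_right) (auto simp: stadium_gauge_def excess_minus)
  then show ?thesis by (cases q) (simp add: inner_Pair algebra_simps)
qed

lemma smooth_intros:
  "pi/2 < u \<Longrightarrow> u < pi/2 + 2*h \<Longrightarrow> u \<in> smooth_parameters"
  "pi/2 + 2*h < u \<Longrightarrow> u < 3*pi/2 + 2*h \<Longrightarrow> u \<in> smooth_parameters"
  "3*pi/2 + 2*h < u \<Longrightarrow> u < 3*pi/2 + 4*h \<Longrightarrow> u \<in> smooth_parameters"
proof -
  have *: "u \<in> smooth_parameters" if "0 < u" "u < u_end" "u \<noteq> pi/2" "u \<noteq> pi/2 + 2*h" "u \<noteq> 3*pi/2 + 2*h" "u \<noteq> 3*pi/2 + 4*h"
    using that by simp
  show "pi/2 < u \<Longrightarrow> u < pi/2 + 2*h \<Longrightarrow> u \<in> smooth_parameters"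
    "pi/2 + 2*h < u \<Longrightarrow> u < 3*pi/2 + 2*h \<Longrightarrow> u \<in> smooth_parameters"
    "3*pi/2 + 2*h < u \<Longrightarrow> u < 3*pi/2 + 4*h \<Longrightarrow> u \<in> smooth_parameters"
    by (rule *; use pi_gt_zero h_pos in linarith)+
qed

lemma smooth_cases:
  assumes "u \<in> smooth_parameters"
  obtains (upper_right) "0 < u" "u < pi/2" | (top) "pi/2 < u" "u < pi/2 + 2*h"
    | (left) "pi/2 + 2*h < u" "u < 3*pi/2 + 2*h"
    | (bottom) "3*pi/2 + 2*h < u" "u < 3*pi/2 + 4*h" | (lower_right) "3*pi/2 + 4*h < u" "u < u_end"
  using assms by force

lemma inward:
  assumes "u \<in> smooth_parameters" "stadium_gauge a h q < 1"
  shows "0 < inner (q - curve u) (rot (unit_velocity u))"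
proof -
  have y: "- 1 < snd q" "snd q < 1"
  proof -
    have "(snd q)\<^sup>2 < 1\<^sup>2" using assms(2) zero_le_power2[of "excess a h (fst q)"]
      unfolding stadium_gauge_def power_one by linarith
    then have "\<bar>snd q\<bar> < 1" using abs_square_less_1[of "snd q"] by simp
    then show "- 1 < snd q" "snd q < 1" by auto
  qed
  have "0 < inner (q - curve u) (rot (vel u))"
    using assms(1)
  proof (cases rule: smooth_cases)
    case upper_right
    then have "0 < cos u" by (intro cos_gt_zero_pi) auto
    then show ?thesis using inward_right[of "cos u" "sin u" q] upper_right assms(2)
      by (simp add: curve_pieces(1) velocity_pieces(1) rot_def)
  next
    case top
    then show ?thesis using y
      by (cases q) (simp add: curve_pieces(2) velocity_pieces(2) rot_def inner_Pair)
  next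
    case left
    have "cos (u - 2*h) = - cos (u - 2*h - pi)" by (simp add: cos_diff)
    moreover have "0 < cos (u - 2*h - pi)" using left by (intro cos_gt_zero_pi) auto
    ultimately have "cos (u - 2*h) < 0" by simp
    then show ?thesis using inward_left[of "cos (u - 2*h)" "sin (u - 2*h)" q] left assms(2)
      by (simp add: curve_pieces(3) velocity_pieces(3) rot_def)
  next
    case bottom
    then show ?thesis using y
      by (cases q) (simp add: curve_pieces(4) velocity_pieces(4) rot_def inner_Pair)
  next
    case lower_right
    have "cos (u - 4*h) = cos (u - 4*h - 2*pi)" by (simp add: cos_diff)
    moreover have "0 < cos (u - 4*h - 2*pi)" using lower_right by (intro cos_gt_zero_pi) auto
    ultimately have "0 < cos (u - 4*h)" by simp
    then show ?thesis using inward_right[of "cos (u - 4*h)" "sin (u - 4*h)" q] lower_right assms(2)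
      by (simp add: curve_pieces(5) velocity_pieces(5) rot_def)
  qed
  moreover have "rot (unit_velocity u) = (1 / norm (vel u)) *\<^sub>R rot (vel u)"
    by (simp add: rot_def unit_velocity_def)
  ultimately show ?thesis using norm_velocity_pos[of u] by (simp only: inner_scaleR_right) simp
qed

text \<open>
  The curvature of the ellipse is \<open>a / e\<^sup>3\<close> for the speed \<open>e\<close>; the parameter is the angle and not
  arc length, which accounts for the additional factor \<open>e\<close>.
\<close>
lemma ellipse_unit_derivative:
  fixes u c
  defines "e \<equiv> ellipse_speed a (u - c)"
  shows "((\<lambda>u. (1 / ellipse_speed a (u - c)) *\<^sub>R (- (a * sin (u - c)), cos (u - c)))
     has_vector_derivative (e * (a / e ^ 3)) *\<^sub>R rot ((1 / e) *\<^sub>R (- (a * sin (u - c)), cos (u - c)))) (at u)"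
proof -
  let ?s = "sin (u - c)" and ?c = "cos (u - c)"
  have e: "0 < e" "e\<^sup>2 = a\<^sup>2 * ?s\<^sup>2 + ?c\<^sup>2"
    unfolding e_def using ellipse_speed_ge1[of "u - c"] by (simp, simp add: ellipse_speed_def)
  have sc: "?s\<^sup>2 + ?c\<^sup>2 = 1" by simp
  have de: "((\<lambda>u. ellipse_speed a (u - c)) has_real_derivative (a\<^sup>2 - 1) * ?s * ?c / e) (at u)"
  proof -
    have "((\<lambda>u. a\<^sup>2 * (sin (u - c))\<^sup>2 + (cos (u - c))\<^sup>2) has_real_derivative 2 * (a\<^sup>2 - 1) * ?s * ?c) (at u)"
      by (auto intro!: derivative_eq_intros simp: algebra_simps)
    then have "((\<lambda>u. sqrt (a\<^sup>2 * (sin (u - c))\<^sup>2 + (cos (u - c))\<^sup>2)) has_real_derivative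
        (inverse (sqrt (a\<^sup>2 * ?s\<^sup>2 + ?c\<^sup>2)) / 2) * (2 * (a\<^sup>2 - 1) * ?s * ?c)) (at u)"
      by (rule DERIV_chain2[OF DERIV_real_sqrt, rotated]) (use e in \<open>simp flip: e(2)\<close>)
    moreover have "inverse (sqrt (a\<^sup>2 * ?s\<^sup>2 + ?c\<^sup>2)) / 2 * (2 * (a\<^sup>2 - 1) * ?s * ?c) = (a\<^sup>2 - 1) * ?s * ?c / e"
      unfolding e(2)[symmetric] using e(1) by (simp add: field_simps)
    ultimately show ?thesis by (simp only: ellipse_speed_def)
  qed
  have 1: "((\<lambda>u. (1 / ellipse_speed a (u - c)) * - (a * sin (u - c))) has_real_derivative
     - (a * ?c / e ^ 3)) (at u)"
  proof -
    have "((\<lambda>u. - (a * sin (u - c)) / ellipse_speed a (u - c)) has_real_derivative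
       (- (a * ?c) * e - - (a * ?s) * ((a\<^sup>2 - 1) * ?s * ?c / e)) / (e * e)) (at u)"
    proof -
      have n: "((\<lambda>u. - (a * sin (u - c))) has_real_derivative - (a * ?c)) (at u)"
        by (auto intro!: derivative_eq_intros)
      show ?thesis using DERIV_divide[OF n de] e(1) unfolding e_def by simp
    qed
    moreover have "(- (a * ?c) * e - - (a * ?s) * ((a\<^sup>2 - 1) * ?s * ?c / e)) / (e * e)
       = (- (a * ?c) * e\<^sup>2 + a * ?c * (a\<^sup>2 - 1) * ?s\<^sup>2) / e ^ 3"
      using e(1) by (simp add: field_simps power2_eq_square power3_eq_cube)
    moreover have "- (a * ?c) * e\<^sup>2 + a * ?c * (a\<^sup>2 - 1) * ?s\<^sup>2 = - (a * ?c)"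
    proof -
      have "- (a * ?c) * e\<^sup>2 + a * ?c * (a\<^sup>2 - 1) * ?s\<^sup>2 = - (a * ?c) * (?s\<^sup>2 + ?c\<^sup>2)"
      proof -
        have "- (a * C) * (a\<^sup>2 * S\<^sup>2 + C\<^sup>2) + a * C * (a\<^sup>2 - 1) * S\<^sup>2 = - (a * C) * (S\<^sup>2 + C\<^sup>2)" for S C :: real
          by (simp add: algebra_simps power2_eq_square)
        then show ?thesis unfolding e(2) .
      qed
      then show ?thesis unfolding sc by simp
    qed
    moreover have "(\<lambda>u. 1 / ellipse_speed a (u - c) * - (a * sin (u - c)))
        = (\<lambda>u. - (a * sin (u - c)) / ellipse_speed a (u - c))" by simp
    ultimately show ?thesis by (simp only: minus_divide_left)
  qed
  have 2: "((\<lambda>u. (1 / ellipse_speed a (u - c)) * cos (u - c)) has_real_derivative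
     - (a * (a * ?s) / e ^ 3)) (at u)"
  proof -
    have "((\<lambda>u. cos (u - c) / ellipse_speed a (u - c)) has_real_derivative
       (- ?s * e - ?c * ((a\<^sup>2 - 1) * ?s * ?c / e)) / (e * e)) (at u)"
    proof -
      have n: "((\<lambda>u. cos (u - c)) has_real_derivative - ?s) (at u)"
        by (auto intro!: derivative_eq_intros)
      show ?thesis using DERIV_divide[OF n de] e(1) unfolding e_def by simp
    qed
    moreover have "(- ?s * e - ?c * ((a\<^sup>2 - 1) * ?s * ?c / e)) / (e * e)
       = (- ?s * e\<^sup>2 - ?s * (a\<^sup>2 - 1) * ?c\<^sup>2) / e ^ 3"
      using e(1) by (simp add: field_simps power2_eq_square power3_eq_cube)
    moreover have "- ?s * e\<^sup>2 - ?s * (a\<^sup>2 - 1) * ?c\<^sup>2 = - (a * (a * ?s))"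
    proof -
      have "- ?s * e\<^sup>2 - ?s * (a\<^sup>2 - 1) * ?c\<^sup>2 = - (a * (a * ?s)) * (?s\<^sup>2 + ?c\<^sup>2)"
      proof -
        have "- S * (a\<^sup>2 * S\<^sup>2 + C\<^sup>2) - S * (a\<^sup>2 - 1) * C\<^sup>2 = - (a * (a * S)) * (S\<^sup>2 + C\<^sup>2)" for S C :: real
          by (simp add: algebra_simps power2_eq_square)
        then show ?thesis unfolding e(2) .
      qed
      then show ?thesis unfolding sc by simp
    qed
    moreover have "(\<lambda>u. 1 / ellipse_speed a (u - c) * cos (u - c))
        = (\<lambda>u. cos (u - c) / ellipse_speed a (u - c))" by simp
    ultimately show ?thesis by (simp only: minus_divide_left)
  qed
  have "((\<lambda>u. ((1 / ellipse_speed a (u - c)) * - (a * sin (u - c)), (1 / ellipse_speed a (u - c)) * cos (u - c)))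
     has_vector_derivative (- (a * ?c / e ^ 3), - (a * (a * ?s) / e ^ 3))) (at u)"
    using 1 2 by (intro has_vector_derivative_Pair) (simp_all add: has_real_derivative_iff_has_vector_derivative)
  moreover have "(e * (a / e ^ 3)) *\<^sub>R rot ((1 / e) *\<^sub>R (- (a * ?s), ?c)) = (- (a * ?c / e ^ 3), - (a * (a * ?s) / e ^ 3))"
    using e(1) by (simp add: rot_def power3_eq_cube)
  ultimately show ?thesis by simp
qed

definition curvature :: "real \<Rightarrow> real" where
  "curvature u = (if pi/2 < u \<and> u < pi/2 + 2*h \<or> 3*pi/2 + 2*h < u \<and> u < 3*pi/2 + 4*h then 0
     else a / norm (vel u) ^ 3)"

lemma unit_velocity_derivative:
  assumes "u \<in> smooth_parameters"
  shows "(unit_velocity has_vector_derivative (norm (vel u) * curvature u) *\<^sub>R rot (unit_velocity u)) (at u)"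
proof -
  have ell: ?thesis if "open S" "u \<in> S" "\<And>v. v \<in> S \<Longrightarrow> vel v = (- (a * sin (v - c)), cos (v - c))"
    "curvature u = a / norm (vel u) ^ 3" for S c
  proof (rule has_vector_derivative_transform_within_open[OF _ that(1,2)])
    show "((\<lambda>u. (1 / ellipse_speed a (u - c)) *\<^sub>R (- (a * sin (u - c)), cos (u - c)))
      has_vector_derivative (norm (vel u) * curvature u) *\<^sub>R rot (unit_velocity u)) (at u)"
      using ellipse_unit_derivative[of c u] that(2-4)
      by (simp add: norm_ellipse_velocity unit_velocity_def)
  qed (simp add: unit_velocity_def that(3) norm_ellipse_velocity)
  have flat: ?thesis if "open S" "u \<in> S" "\<And>v. v \<in> S \<Longrightarrow> vel v = d" "curvature u = 0" for S d
    using has_vector_derivative_transform_within_open[OF has_vector_derivative_const[of "unit_velocity u"] that(1,2)]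
      that(2-4) by (simp add: unit_velocity_def)
  show ?thesis using assms
  proof (cases rule: smooth_cases)
    case upper_right
    then show ?thesis using pi_gt_zero h_pos by (intro ell[of "{..<pi/2}" 0]) (auto simp: velocity_pieces(1) curvature_def)
  next
    case top
    then show ?thesis by (intro flat[of "{pi/2<..<pi/2+2*h}" "(-1,0)"]) (auto simp: velocity_pieces(2) curvature_def)
  next
    case left
    then show ?thesis by (intro ell[of "{pi/2+2*h<..<3*pi/2+2*h}" "2*h"]) (auto simp: velocity_pieces(3) curvature_def)
  next
    case bottom
    then show ?thesis by (intro flat[of "{3*pi/2+2*h<..<3*pi/2+4*h}" "(1,0)"]) (auto simp: velocity_pieces(4) curvature_def)
  next
    case lower_right
    then have "\<not> u < pi/2 + 2*h" using pi_gt_zero h_pos by linarith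
    then show ?thesis using lower_right by (intro ell[of "{3*pi/2+4*h<..}" "4*h"]) (auto simp: velocity_pieces(5) curvature_def)
  qed
qed

lemma tangent_derivative:
  assumes "u \<in> smooth_parameters"
  shows "(\<tau> has_vector_derivative curvature u *\<^sub>R \<nu> (arc_length u)) (at (arc_length u))"
proof -
  have u: "par (arc_length u) = u" using assms by (intro par_arc_length) auto
  have "(unit_velocity \<circ> par has_vector_derivative
      inverse (norm (vel u)) *\<^sub>R ((norm (vel u) * curvature u) *\<^sub>R rot (unit_velocity u))) (at (arc_length u))"
    by (rule vector_diff_chain_at)
      (use unit_velocity_derivative[OF assms] par_derivative[OF assms] in
        \<open>simp_all add: u has_real_derivative_iff_has_vector_derivative\<close>)
  moreover have "inverse (norm (vel u)) *\<^sub>R ((norm (vel u) * curvature u) *\<^sub>R rot (unit_velocity u))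
     = curvature u *\<^sub>R \<nu> (arc_length u)"
    using norm_velocity_pos[of u] by (simp add: normal_rot tangent_smooth[OF assms])
  moreover have "\<forall>\<^sub>F s in nhds (arc_length u). (unit_velocity \<circ> par) s = \<tau> s"
    using eventually_smooth[OF assms]
  proof eventually_elim
    case (elim s)
    then show ?case using tangent_smooth[of "par s"] by simp
  qed
  ultimately show ?thesis
    using has_vector_derivative_cong_ev[of UNIV "unit_velocity \<circ> par" \<tau> "arc_length u"]
      eventually_nhds_x_imp_x[of "\<lambda>s. (unit_velocity \<circ> par) s = \<tau> s" "arc_length u"] by simp
qed

lemma regular_arc_length:
  assumes "u \<in> smooth_parameters"
  shows "regular_at a h (arc_length u) (curvature u)"
  unfolding regular_at_def
proof (intro conjI)
  show "\<forall>\<^sub>F s in nhds (arc_length u). (\<gamma> has_vector_derivative \<tau> s) (at s) \<and> norm (\<tau> s) = 1 \<and> isCont \<tau> s \<and>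
     (\<forall>q. stadium_gauge a h q < 1 \<longrightarrow> 0 < inner (q - \<gamma> s) (\<nu> s))"
    using eventually_smooth[OF assms]
  proof eventually_elim
    case (elim s)
    define v where "v = par s"
    have v: "v \<in> smooth_parameters" "arc_length v = s" using elim by (auto simp: v_def)
    have "(\<gamma> has_vector_derivative \<tau> s) (at s)" "norm (\<tau> s) = 1"
      using point_derivative[OF v(1)] tangent_smooth[OF v(1)] norm_unit_velocity[of v] by (simp_all add: v(2))
    moreover have "isCont \<tau> s"
      using tangent_derivative[OF v(1)] has_vector_derivative_continuous unfolding v(2) by blast
    moreover have "0 < inner (q - \<gamma> s) (\<nu> s)" if "stadium_gauge a h q < 1" for q
      using inward[OF v(1) that] tangent_smooth[OF v(1)] by (simp add: v(2) normal_rot point_par v_def[symmetric])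
    ultimately show ?case by blast
  qed
qed (use arc_length_interior[OF assms] tangent_derivative[OF assms] in auto)

text \<open>
  The value \<open>l = 0\<close> is the rightmost point, where the arc length jumps from \<open>len\<close> to 0.
\<close>
lemma regular_right:
  assumes "- (pi/2) < l" "l < pi/2" "l \<noteq> 0"
  shows "\<exists>s. regular_at a h s (a / ellipse_speed a l ^ 3) \<and> \<gamma> s = (a * cos l + h, sin l) \<and>
     \<tau> s = (1 / ellipse_speed a l) *\<^sub>R (- (a * sin l), cos l)"
proof -
  define u where "u = (if 0 < l then l else l + 2*pi + 4*h)"
  have u: "u \<in> smooth_parameters" unfolding u_def using assms h_pos pi_gt_zero by (auto split: if_splits)
  have cu: "curve u = (a * cos l + h, sin l)" "vel u = (- (a * sin l), cos l)"
  proof -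
    have "curve u = (a * cos l + h, sin l) \<and> vel u = (- (a * sin l), cos l)"
    proof (cases "0 < l")
      case True
      then show ?thesis using assms by (simp add: u_def curve_pieces(1) velocity_pieces(1))
    next
      case False
      then have "3*pi/2 + 4*h < u" using assms by (simp add: u_def)
      moreover have "u - 4*h = l + 2*pi" using False by (simp add: u_def)
      ultimately show ?thesis by (simp add: curve_pieces(5) velocity_pieces(5))
    qed
    then show "curve u = (a * cos l + h, sin l)" "vel u = (- (a * sin l), cos l)" by auto
  qed
  have "\<not> (pi/2 < u \<and> u < pi/2 + 2*h \<or> 3*pi/2 + 2*h < u \<and> u < 3*pi/2 + 4*h)"
    unfolding u_def using assms h_pos pi_gt_zero by (auto split: if_splits)
  then have "curvature u = a / ellipse_speed a l ^ 3"
    unfolding curvature_def cu norm_ellipse_velocity by (rule if_not_P)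
  then show ?thesis using regular_arc_length[OF u] tangent_smooth[OF u] u
    by (intro exI[of _ "arc_length u"]) (simp add: unit_velocity_def cu norm_ellipse_velocity point_par par_arc_length)
qed

lemma regular_left:
  assumes "- (pi/2) < l" "l < pi/2"
  shows "\<exists>s. regular_at a h s (a / ellipse_speed a l ^ 3) \<and> \<gamma> s = (- (a * cos l + h), sin l) \<and>
     \<tau> s = (1 / ellipse_speed a l) *\<^sub>R (- (a * sin l), - cos l)"
proof -
  define u where "u = pi - l + 2*h"
  have u': "pi/2 + 2*h < u" "u < 3*pi/2 + 2*h" unfolding u_def using assms by auto
  then have u: "u \<in> smooth_parameters" by (rule smooth_intros)
  have "u - 2*h = pi - l" by (simp add: u_def)
  then have cu: "curve u = (- (a * cos l + h), sin l)" "vel u = (- (a * sin l), - cos l)"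
    using u' by (simp_all add: curve_pieces(3) velocity_pieces(3))
  have n: "norm (vel u) = ellipse_speed a l"
    by (simp add: cu ellipse_speed_def norm_Pair power_mult_distrib)
  have "curvature u = a / ellipse_speed a l ^ 3" using u' by (simp add: curvature_def n)
  then show ?thesis using regular_arc_length[OF u] tangent_smooth[OF u] u
    by (intro exI[of _ "arc_length u"]) (simp add: unit_velocity_def cu n[unfolded cu] point_par par_arc_length)
qed

lemma regular_top:
  assumes "\<bar>x\<bar> < h" shows "\<exists>s. regular_at a h s 0 \<and> \<gamma> s = (x, 1) \<and> \<tau> s = (-1, 0)"
proof -
  define u where "u = pi/2 + h - x"
  have u': "pi/2 < u" "u < pi/2 + 2*h" unfolding u_def using assms by auto
  then have u: "u \<in> smooth_parameters" by (rule smooth_intros)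
  have cu: "curve u = (x, 1)" "vel u = (-1, 0)" using u' by (simp_all add: curve_pieces(2) velocity_pieces(2) u_def)
  have "curvature u = 0" using u' by (simp add: curvature_def)
  then show ?thesis using regular_arc_length[OF u] tangent_smooth[OF u] u
    by (intro exI[of _ "arc_length u"]) (simp add: unit_velocity_def cu norm_Pair point_par par_arc_length)
qed

lemma regular_bottom:
  assumes "\<bar>x\<bar> < h" shows "\<exists>s. regular_at a h s 0 \<and> \<gamma> s = (x, -1) \<and> \<tau> s = (1, 0)"
proof -
  define u where "u = 3*pi/2 + 3*h + x"
  have u': "3*pi/2 + 2*h < u" "u < 3*pi/2 + 4*h" unfolding u_def using assms by auto
  then have u: "u \<in> smooth_parameters" by (rule smooth_intros)
  have cu: "curve u = (x, -1)" "vel u = (1, 0)" using u' by (simp_all add: curve_pieces(4) velocity_pieces(4) u_def)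
  have "curvature u = 0" using u' by (simp add: curvature_def)
  then show ?thesis using regular_arc_length[OF u] tangent_smooth[OF u] u
    by (intro exI[of _ "arc_length u"]) (simp add: unit_velocity_def cu norm_Pair point_par par_arc_length)
qed

section \<open>The derivative of the billiard map\<close>

lemma inner_rot_self: "inner v (rot v) = 0" "inner (rot v) v = 0"
  by (simp_all add: rot_def inner_prod_def)

lemma unit_frame_expansion:
  assumes "norm v = 1" shows "w = inner w v *\<^sub>R v + inner w (rot v) *\<^sub>R rot v"
    and "inner w w = (inner w v)\<^sup>2 + (inner w (rot v))\<^sup>2"
proof -
  obtain x y where v: "v = (x, y)" by (cases v)
  obtain p q where w: "w = (p, q)" by (cases w)
  have 1: "x * x + y * y = 1"
    using assms by (simp add: v norm_eq_1 inner_Pair)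
  have "p = p * (x * x + y * y)" "q = q * (x * x + y * y)" unfolding 1 by simp_all
  then show "w = inner w v *\<^sub>R v + inner w (rot v) *\<^sub>R rot v"
    by (simp add: v w rot_def inner_Pair algebra_simps)
  have "p * p + q * q = (p * p + q * q) * (x * x + y * y)" unfolding 1 by simp
  then show "inner w w = (inner w v)\<^sup>2 + (inner w (rot v))\<^sup>2"
    by (simp add: v w rot_def inner_Pair algebra_simps power2_eq_square)
qed

text \<open>
  The first boundary point on a ray is unique, it determines \<open>s\<close>, and the tangential component of the
  outgoing direction determines \<open>\<beta>\<close>.
\<close>
lemma next_impact_unique:
  assumes y: "next_impact a h x y" and y': "next_impact a h x y'" and n: "norm (\<tau> (fst y)) = 1"
  shows "y' = y"
proof -
  obtain r where r: "0 < r" "\<gamma> (fst y) = \<gamma> (fst x) + r *\<^sub>R outgoing_direction a h x"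
    "\<And>r'. 0 < r' \<Longrightarrow> r' < r \<Longrightarrow> \<gamma> (fst x) + r' *\<^sub>R outgoing_direction a h x \<notin> stadium a h"
    using y unfolding next_impact_def by blast
  obtain q where q: "0 < q" "\<gamma> (fst y') = \<gamma> (fst x) + q *\<^sub>R outgoing_direction a h x"
    "\<And>r'. 0 < r' \<Longrightarrow> r' < q \<Longrightarrow> \<gamma> (fst x) + r' *\<^sub>R outgoing_direction a h x \<notin> stadium a h"
    using y' unfolding next_impact_def by blast
  have ph: "fst y \<in> {0..<len}" "fst y' \<in> {0..<len}"
    "snd y \<in> {- (pi/2) <..< pi/2}" "snd y' \<in> {- (pi/2) <..< pi/2}"
    using y y' by (auto simp: next_impact_def phase_space_def mem_Times_iff)
  then have "\<gamma> (fst y) \<in> stadium a h" "\<gamma> (fst y') \<in> stadium a h"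
    using point_in_stadium by auto
  then have "r = q" using r q by (metis linorder_neqE_linordered_idom)
  then have "\<gamma> (fst y) = \<gamma> (fst y')" using r q by simp
  then have s: "fst y = fst y'" by (rule inj_onD[OF point_inj]) (use ph in auto)
  have "outgoing_direction a h y = outgoing_direction a h y'"
    using y y' s by (simp add: next_impact_def)
  moreover have "inner (outgoing_direction a h z) (\<tau> (fst y)) = sin (snd z)" if "fst z = fst y" for z
    using that n by (cases z) (simp add: outgoing_direction_def normal_rot inner_add_left inner_rot_self dot_square_norm)
  ultimately have "sin (snd y) = sin (snd y')" using s by metis
  moreover have "arcsin (sin (snd y)) = snd y" "arcsin (sin (snd y')) = snd y'"
    using ph by (auto intro!: arcsin_sin)
  ultimately show ?thesis using s by (metis prod.expand)
qed

lemma billiard_map_eq: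
  "next_impact a h x y \<Longrightarrow> norm (\<tau> (fst y)) = 1 \<Longrightarrow> billiard_map a h x = y"
  unfolding billiard_map_def by (rule the_equality) (auto intro: next_impact_unique)

text \<open>
  For a pair of arc lengths, \<open>chord_start\<close> and \<open>chord_end\<close> are the phase points after the impacts at the
  two ends of the chord. Reflection preserves the tangential component, so both angles are given by
  the tangential component of the same direction.
\<close>
definition chord_direction :: "real \<times> real \<Rightarrow> real \<times> real" where
  "chord_direction z = (1 / norm (\<gamma> (snd z) - \<gamma> (fst z))) *\<^sub>R (\<gamma> (snd z) - \<gamma> (fst z))"

definition chord_start :: "real \<times> real \<Rightarrow> real \<times> real" where
  "chord_start z = (fst z, arcsin (inner (chord_direction z) (\<tau> (fst z))))"

definition chord_end :: "real \<times> real \<Rightarrow> real \<times> real" where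
  "chord_end z = (snd z, arcsin (inner (chord_direction z) (\<tau> (snd z))))"

definition proper_chord :: "real \<times> real \<Rightarrow> bool" where
  "proper_chord z \<longleftrightarrow> fst z \<in> {0<..<len} \<and> snd z \<in> {0<..<len} \<and>
     snd (\<gamma> (fst z)) \<noteq> snd (\<gamma> (snd z)) \<and>
     norm (\<tau> (fst z)) = 1 \<and> norm (\<tau> (snd z)) = 1 \<and>
     (\<forall>q. stadium_gauge a h q < 1 \<longrightarrow> 0 < inner (q - \<gamma> (fst z)) (\<nu> (fst z))) \<and>
     (\<forall>q. stadium_gauge a h q < 1 \<longrightarrow> 0 < inner (q - \<gamma> (snd z)) (\<nu> (snd z)))"

text \<open>
  The inner points of the chord have gauge below 1. Hence they are not on the stadium, and the inward
  normals at both ends see the midpoint on their positive side, so the chord is transversal.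
\<close>
lemma proper_chord_direction:
  assumes "proper_chord z"
  defines "u \<equiv> chord_direction z"
  shows "norm u = 1" "0 < norm (\<gamma> (snd z) - \<gamma> (fst z))"
    "\<gamma> (snd z) = \<gamma> (fst z) + norm (\<gamma> (snd z) - \<gamma> (fst z)) *\<^sub>R u"
    "0 < inner u (\<nu> (fst z))" "inner u (\<nu> (snd z)) < 0"
    "\<And>r. 0 < r \<Longrightarrow> r < norm (\<gamma> (snd z) - \<gamma> (fst z)) \<Longrightarrow> \<gamma> (fst z) + r *\<^sub>R u \<notin> stadium a h"
proof -
  define p q where "p = \<gamma> (fst z)" and "q = \<gamma> (snd z)"
  define l where "l = norm (q - p)"
  note z = assms(1)[unfolded proper_chord_def, folded p_def q_def]
  have "p \<noteq> q" using z by auto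
  then have l: "0 < l" by (simp add: l_def)
  have ud: "u = (1 / l) *\<^sub>R (q - p)" by (simp add: u_def chord_direction_def l_def p_def q_def)
  have qp: "q = p + l *\<^sub>R u" using l by (simp add: ud)
  have st: "p \<in> stadium a h" "q \<in> stadium a h" using z point_in_stadium by (auto simp: p_def q_def)
  have inside: "stadium_gauge a h (p + r *\<^sub>R u) < 1" if "0 < r" "r < l" for r
  proof -
    have "stadium_gauge a h (p + (r / l) *\<^sub>R (q - p)) < 1"
      using gauge_stadium[OF st(1)] gauge_stadium[OF st(2)] z that l by (intro gauge_open_chord) auto
    then show ?thesis by (simp add: ud)
  qed
  have mid: "stadium_gauge a h (p + (l / 2) *\<^sub>R u) < 1" using l by (intro inside) auto
  have "p + (l / 2) *\<^sub>R u - p = (l / 2) *\<^sub>R u" by simp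
  moreover have "p + (l / 2) *\<^sub>R u - q = (- l / 2) *\<^sub>R u"
  proof -
    have "p + (l / 2) *\<^sub>R u - (p + l *\<^sub>R u) = (l / 2 - l) *\<^sub>R u"
      by (simp only: scaleR_left_diff_distrib add_diff_cancel_left)
    then show ?thesis by (simp flip: qp)
  qed
  ultimately have i: "0 < inner ((l / 2) *\<^sub>R u) (\<nu> (fst z))" "0 < inner ((- l / 2) *\<^sub>R u) (\<nu> (snd z))"
    using z mid by metis+
  show "norm u = 1" unfolding ud using l by (simp add: l_def)
  show "0 < norm (\<gamma> (snd z) - \<gamma> (fst z))" using l by (simp add: l_def p_def q_def)
  show "\<gamma> (snd z) = \<gamma> (fst z) + norm (\<gamma> (snd z) - \<gamma> (fst z)) *\<^sub>R u"
    using qp unfolding l_def p_def q_def .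
  show "0 < inner u (\<nu> (fst z))" using i(1) l by (simp add: zero_less_mult_iff)
  show "inner u (\<nu> (snd z)) < 0" using i(2) l by (simp add: mult_less_0_iff)
  show "\<gamma> (fst z) + r *\<^sub>R u \<notin> stadium a h" if "0 < r" "r < norm (\<gamma> (snd z) - \<gamma> (fst z))" for r
    using inside[of r] that gauge_stadium by (fastforce simp: l_def p_def q_def)
qed

lemma proper_chord_angles:
  assumes "proper_chord z"
  defines "u \<equiv> chord_direction z"
  shows "sin (snd (chord_start z)) = inner u (\<tau> (fst z))" "cos (snd (chord_start z)) = inner u (\<nu> (fst z))"
    "sin (snd (chord_end z)) = inner u (\<tau> (snd z))" "cos (snd (chord_end z)) = - inner u (\<nu> (snd z))"
    "snd (chord_start z) \<in> {- (pi/2) <..< pi/2}" "snd (chord_end z) \<in> {- (pi/2) <..< pi/2}"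
    "\<bar>inner u (\<tau> (fst z))\<bar> < 1" "\<bar>inner u (\<tau> (snd z))\<bar> < 1"
proof -
  note z = assms(1)[unfolded proper_chord_def]
  note d = proper_chord_direction[OF assms(1), folded u_def]
  have uu: "inner u u = 1" using d(1) by (simp add: dot_square_norm)
  have s0: "1 = (inner u (\<tau> (fst z)))\<^sup>2 + (inner u (\<nu> (fst z)))\<^sup>2"
    using unit_frame_expansion(2)[of "\<tau> (fst z)" u] z uu by (simp add: normal_rot)
  have s1: "1 = (inner u (\<tau> (snd z)))\<^sup>2 + (inner u (\<nu> (snd z)))\<^sup>2"
    using unit_frame_expansion(2)[of "\<tau> (snd z)" u] z uu by (simp add: normal_rot)
  have "0 < (inner u (\<nu> (fst z)))\<^sup>2" "0 < (inner u (\<nu> (snd z)))\<^sup>2" using d(4,5) by auto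
  then have "(inner u (\<tau> (fst z)))\<^sup>2 < 1" "(inner u (\<tau> (snd z)))\<^sup>2 < 1" using s0 s1 by linarith+
  then show b: "\<bar>inner u (\<tau> (fst z))\<bar> < 1" "\<bar>inner u (\<tau> (snd z))\<bar> < 1" by (simp_all add: abs_square_less_1)
  show "sin (snd (chord_start z)) = inner u (\<tau> (fst z))" "sin (snd (chord_end z)) = inner u (\<tau> (snd z))"
    using b by (simp_all add: chord_start_def chord_end_def u_def)
  have "cos (snd (chord_start z)) = sqrt (1 - (inner u (\<tau> (fst z)))\<^sup>2)"
    using b by (simp add: chord_start_def u_def cos_arcsin)
  also have "1 - (inner u (\<tau> (fst z)))\<^sup>2 = (inner u (\<nu> (fst z)))\<^sup>2" using s0 by linarith
  finally show "cos (snd (chord_start z)) = inner u (\<nu> (fst z))" using d(4) by simp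
  have "cos (snd (chord_end z)) = sqrt (1 - (inner u (\<tau> (snd z)))\<^sup>2)"
    using b by (simp add: chord_end_def u_def cos_arcsin)
  also have "1 - (inner u (\<tau> (snd z)))\<^sup>2 = (inner u (\<nu> (snd z)))\<^sup>2" using s1 by linarith
  finally show "cos (snd (chord_end z)) = - inner u (\<nu> (snd z))" using d(5) by simp
  show "snd (chord_start z) \<in> {- (pi/2) <..< pi/2}" "snd (chord_end z) \<in> {- (pi/2) <..< pi/2}"
    using b arcsin_lt_bounded by (auto simp: chord_start_def chord_end_def u_def abs_less_iff)
qed

lemma outgoing_chord_start:
  assumes "proper_chord z" shows "outgoing_direction a h (chord_start z) = chord_direction z"
proof -
  have "outgoing_direction a h (chord_start z) =
      cos (snd (chord_start z)) *\<^sub>R \<nu> (fst z) + sin (snd (chord_start z)) *\<^sub>R \<tau> (fst z)"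
    by (simp add: outgoing_direction_def chord_start_def)
  also have "\<dots> = inner (chord_direction z) (\<tau> (fst z)) *\<^sub>R \<tau> (fst z)
      + inner (chord_direction z) (rot (\<tau> (fst z))) *\<^sub>R rot (\<tau> (fst z))"
    unfolding proper_chord_angles[OF assms] normal_rot by (rule add.commute)
  also have "\<dots> = chord_direction z"
    using assms unfolding proper_chord_def by (intro unit_frame_expansion(1)[symmetric]) blast
  finally show ?thesis .
qed

lemma proper_chord_next_impact:
  assumes "proper_chord z" shows "next_impact a h (chord_start z) (chord_end z)"
proof -
  note z = assms(1)[unfolded proper_chord_def]
  note d = proper_chord_direction[OF assms]
  note o = outgoing_chord_start[OF assms]
  let ?u = "chord_direction z"
  have "outgoing_direction a h (chord_end z) =
      cos (snd (chord_end z)) *\<^sub>R \<nu> (snd z) + sin (snd (chord_end z)) *\<^sub>R \<tau> (snd z)"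
    by (simp add: outgoing_direction_def chord_end_def)
  also have "\<dots> = (inner ?u (\<tau> (snd z)) *\<^sub>R \<tau> (snd z) + inner ?u (\<nu> (snd z)) *\<^sub>R \<nu> (snd z))
      - (2 * inner ?u (\<nu> (snd z))) *\<^sub>R \<nu> (snd z)"
  proof -
    have "(- n) *\<^sub>R w + t = (t + n *\<^sub>R w) - (2 * n) *\<^sub>R w" for n and t w :: "real \<times> real"
      by (simp only: mult_2 scaleR_add_left) simp
    then show ?thesis unfolding proper_chord_angles(3,4)[OF assms] .
  qed
  also have "\<dots> = reflect (\<nu> (snd z)) ?u"
  proof -
    have "inner ?u (\<tau> (snd z)) *\<^sub>R \<tau> (snd z) + inner ?u (rot (\<tau> (snd z))) *\<^sub>R rot (\<tau> (snd z)) = ?u"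
      using z by (intro unit_frame_expansion(1)[symmetric]) blast
    then show ?thesis by (simp only: reflect_def normal_rot)
  qed
  finally have "outgoing_direction a h (chord_end z) = reflect (\<nu> (snd z)) ?u" .
  moreover have "chord_end z \<in> phase_space a h"
    using z proper_chord_angles(6)[OF assms] by (simp add: phase_space_def chord_end_def mem_Times_iff)
  moreover have "fst (chord_start z) = fst z" "fst (chord_end z) = snd z"
    by (simp_all add: chord_start_def chord_end_def)
  ultimately show ?thesis
    unfolding next_impact_def o using d(2,3,6) by metis
qed

lemma billiard_chord:
  assumes "proper_chord z" shows "billiard_map a h (chord_start z) = chord_end z"
  using proper_chord_next_impact[OF assms] assms
  by (intro billiard_map_eq) (auto simp: proper_chord_def chord_end_def)

text \<open>
  The classical derivative of one billiard step of length \<open>l\<close> in the coordinates \<open>(s, \<beta>)\<close>, where \<open>c\<^sub>i\<close>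
  stands for \<open>cos \<beta>\<^sub>i\<close>.
\<close>
definition leg_derivative :: "real \<Rightarrow> real \<Rightarrow> real \<Rightarrow> real \<Rightarrow> real \<Rightarrow> real \<times> real \<Rightarrow> real \<times> real" where
  "leg_derivative l c0 \<kappa>0 c1 \<kappa>1 v =
     (((l * \<kappa>0 - c0) * fst v - l * snd v) / c1,
      (\<kappa>0 - \<kappa>1 * (l * \<kappa>0 - c0) / c1) * fst v + (l * \<kappa>1 / c1 - 1) * snd v)"

text \<open>
  Up to sign the tangential components are the partial derivatives of the length of the chord, a
  generating function of the billiard map. The fraction is the rotation of the chord direction, the last
  summand the rotation of the tangent.
\<close>
lemma tangential_derivative:
  fixes z :: "real \<times> real"
  assumes p: "proper_chord z" and i: "i = fst \<or> i = snd"
    and d0: "(\<gamma> has_vector_derivative \<tau> (fst z)) (at (fst z))"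
    and d1: "(\<gamma> has_vector_derivative \<tau> (snd z)) (at (snd z))"
    and k: "(\<tau> has_vector_derivative \<kappa> *\<^sub>R \<nu> (i z)) (at (i z))"
  defines "u \<equiv> chord_direction z" and "l \<equiv> norm (\<gamma> (snd z) - \<gamma> (fst z))"
  shows "((\<lambda>z. inner (chord_direction z) (\<tau> (i z))) has_derivative
     (\<lambda>v. (inner (snd v *\<^sub>R \<tau> (snd z) - fst v *\<^sub>R \<tau> (fst z)) (\<tau> (i z))
            - inner (snd v *\<^sub>R \<tau> (snd z) - fst v *\<^sub>R \<tau> (fst z)) u * inner u (\<tau> (i z))) / l
          + \<kappa> * i v * inner u (\<nu> (i z)))) (at z)"
proof -
  have D0: "((\<lambda>z. \<gamma> (fst z)) has_derivative (\<lambda>v. fst v *\<^sub>R \<tau> (fst z))) (at z)"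
    using has_derivative_compose[OF has_derivative_fst[OF has_derivative_ident] d0[unfolded has_vector_derivative_def]] by simp
  have D1: "((\<lambda>z. \<gamma> (snd z)) has_derivative (\<lambda>v. snd v *\<^sub>R \<tau> (snd z))) (at z)"
    using has_derivative_compose[OF has_derivative_snd[OF has_derivative_ident] d1[unfolded has_vector_derivative_def]] by simp
  have bi: "bounded_linear i" using i bounded_linear_fst bounded_linear_snd by auto
  have DT: "((\<lambda>z. \<tau> (i z)) has_derivative (\<lambda>v. i v *\<^sub>R (\<kappa> *\<^sub>R \<nu> (i z)))) (at z)"
    using has_derivative_compose[OF bounded_linear_imp_has_derivative[OF bi] k[unfolded has_vector_derivative_def]] .
  have l: "0 < l" using proper_chord_direction(2)[OF p] by (simp add: l_def)
  let ?D = "\<lambda>z. \<gamma> (snd z) - \<gamma> (fst z)"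
  let ?w = "\<lambda>v. snd v *\<^sub>R \<tau> (snd z) - fst v *\<^sub>R \<tau> (fst z)"
  have D: "(?D has_derivative ?w) (at z)" by (intro has_derivative_diff D0 D1)
  have Dz: "?D z = l *\<^sub>R u" using l by (simp add: u_def chord_direction_def l_def)
  have "((\<lambda>z. norm (?D z)) has_derivative (\<lambda>v. inner (?w v) (sgn (?D z)))) (at z)"
    by (rule has_derivative_compose[OF D has_derivative_norm[of "?D z", THEN iffD2 [OF refl]]]) (use l l_def in auto)
  then have N: "((\<lambda>z. norm (?D z)) has_derivative (\<lambda>v. inner (?w v) u)) (at z)"
    by (simp add: sgn_div_norm u_def chord_direction_def divide_inverse)
  have I: "((\<lambda>z. inner (?D z) (\<tau> (i z))) has_derivative
      (\<lambda>v. inner (?D z) (i v *\<^sub>R (\<kappa> *\<^sub>R \<nu> (i z))) + inner (?w v) (\<tau> (i z)))) (at z)"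
    by (rule has_derivative_inner[OF D DT])
  have "((\<lambda>z. inner (?D z) (\<tau> (i z)) / norm (?D z)) has_derivative
      (\<lambda>v. ((inner (?D z) (i v *\<^sub>R (\<kappa> *\<^sub>R \<nu> (i z))) + inner (?w v) (\<tau> (i z))) * norm (?D z)
         - inner (?D z) (\<tau> (i z)) * inner (?w v) u) / (norm (?D z) * norm (?D z)))) (at z)"
    by (rule has_derivative_divide'[OF I N]) (use l l_def in auto)
  moreover have "(\<lambda>z. inner (?D z) (\<tau> (i z)) / norm (?D z)) = (\<lambda>z. inner (chord_direction z) (\<tau> (i z)))"
    by (simp add: chord_direction_def)
  moreover have "((inner (?D z) (i v *\<^sub>R (\<kappa> *\<^sub>R \<nu> (i z))) + inner (?w v) (\<tau> (i z))) * norm (?D z)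
         - inner (?D z) (\<tau> (i z)) * inner (?w v) u) / (norm (?D z) * norm (?D z))
     = (inner (?w v) (\<tau> (i z)) - inner (?w v) u * inner u (\<tau> (i z))) / l + \<kappa> * i v * inner u (\<nu> (i z))" for v
  proof -
    have "((i v * (\<kappa> * (l * n)) + w) * l - l * t * x) / (l * l) = (w - x * t) / l + \<kappa> * i v * n" for n w t x
      using l by (simp add: field_simps)
    moreover have "inner (?D z) x = l * inner u x" for x by (simp only: Dz inner_scaleR_left)
    moreover have "norm (?D z) = l" by (simp add: l_def)
    ultimately show ?thesis by (simp only: inner_scaleR_right)
  qed
  ultimately show ?thesis by simp
qed

lemma inner_rot_rot: "inner (rot x) y = - inner x (rot y)"
  by (simp add: rot_def inner_prod_def)

lemma arcsin_derivative:
  fixes f :: "real \<times> real \<Rightarrow> real"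
  assumes "(f has_derivative f') (at z)" "\<bar>f z\<bar> < 1"
  shows "((\<lambda>z. arcsin (f z)) has_derivative (\<lambda>v. f' v / cos (arcsin (f z)))) (at z)"
proof -
  have "DERIV arcsin (f z) :> inverse (sqrt (1 - (f z)\<^sup>2))" using assms(2) by (intro DERIV_arcsin) auto
  then have "(arcsin has_derivative (*) (inverse (cos (arcsin (f z))))) (at (f z))"
    using assms(2) by (simp add: has_field_derivative_def cos_arcsin)
  from has_derivative_compose[OF assms(1) this] show ?thesis by (simp add: divide_inverse mult.commute)
qed

lemma regular_neighbourhood:
  assumes "regular_at a h s \<kappa>"
  obtains U where "open U" "s \<in> U" "U \<subseteq> {0<..<len}"
    "\<And>s'. s' \<in> U \<Longrightarrow> (\<gamma> has_vector_derivative \<tau> s') (at s')" "\<And>s'. s' \<in> U \<Longrightarrow> norm (\<tau> s') = 1"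
    "continuous_on U \<gamma>" "continuous_on U \<tau>"
    "\<And>s' q. s' \<in> U \<Longrightarrow> stadium_gauge a h q < 1 \<Longrightarrow> 0 < inner (q - \<gamma> s') (\<nu> s')"
proof -
  obtain V where V: "open V" "s \<in> V" "\<forall>s'\<in>V. (\<gamma> has_vector_derivative \<tau> s') (at s') \<and> norm (\<tau> s') = 1 \<and>
      isCont \<tau> s' \<and> (\<forall>q. stadium_gauge a h q < 1 \<longrightarrow> 0 < inner (q - \<gamma> s') (\<nu> s'))"
    using assms unfolding regular_at_def eventually_nhds by blast
  have "continuous_on (V \<inter> {0<..<len}) \<gamma>"
    using V(3) has_vector_derivative_continuous by (intro continuous_at_imp_continuous_on) blast
  moreover have "continuous_on (V \<inter> {0<..<len}) \<tau>"
    using V(3) by (intro continuous_at_imp_continuous_on) blast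
  ultimately show thesis
    using V assms by (intro that[of "V \<inter> {0<..<len}"]) (auto simp: regular_at_def)
qed

text \<open>
  The map \<open>chord_start\<close> has a left inverse that is expressed by the billiard map itself: the next impact
  recovers the second arc length. This makes it injective near the given pair, so that its image is
  open by invariance of domain and its inverse is differentiable there.
\<close>
lemma billiard_leg:
  assumes r0: "regular_at a h s0 \<kappa>0" and r1: "regular_at a h s1 \<kappa>1" and y: "snd (\<gamma> s0) \<noteq> snd (\<gamma> s1)"
  defines "l \<equiv> norm (\<gamma> s1 - \<gamma> s0)"
    and "c0 \<equiv> cos (snd (chord_start (s0, s1)))" and "c1 \<equiv> cos (snd (chord_end (s0, s1)))"
  shows "proper_chord (s0, s1)"
    and "(billiard_map a h has_derivative leg_derivative l c0 \<kappa>0 c1 \<kappa>1) (at (chord_start (s0, s1)))"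
proof -
  let ?z = "(s0, s1)"
  obtain U0 where U0: "open U0" "s0 \<in> U0" "U0 \<subseteq> {0<..<len}"
    "\<And>s'. s' \<in> U0 \<Longrightarrow> (\<gamma> has_vector_derivative \<tau> s') (at s')" "\<And>s'. s' \<in> U0 \<Longrightarrow> norm (\<tau> s') = 1"
    "continuous_on U0 \<gamma>" "continuous_on U0 \<tau>"
    "\<And>s' q. s' \<in> U0 \<Longrightarrow> stadium_gauge a h q < 1 \<Longrightarrow> 0 < inner (q - \<gamma> s') (\<nu> s')"
    using regular_neighbourhood[OF r0] by blast
  obtain U1 where U1: "open U1" "s1 \<in> U1" "U1 \<subseteq> {0<..<len}"
    "\<And>s'. s' \<in> U1 \<Longrightarrow> (\<gamma> has_vector_derivative \<tau> s') (at s')" "\<And>s'. s' \<in> U1 \<Longrightarrow> norm (\<tau> s') = 1"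
    "continuous_on U1 \<gamma>" "continuous_on U1 \<tau>"
    "\<And>s' q. s' \<in> U1 \<Longrightarrow> stadium_gauge a h q < 1 \<Longrightarrow> 0 < inner (q - \<gamma> s') (\<nu> s')"
    using regular_neighbourhood[OF r1] by blast
  have "continuous_on (U0 \<times> U1) (\<lambda>z. \<gamma> (fst z))"
    by (rule continuous_on_compose2[OF U0(6)]) (auto intro!: continuous_intros)
  moreover have "continuous_on (U0 \<times> U1) (\<lambda>z. \<gamma> (snd z))"
    by (rule continuous_on_compose2[OF U1(6)]) (auto intro!: continuous_intros)
  moreover have "continuous_on (U0 \<times> U1) (\<lambda>z. \<tau> (fst z))"
    by (rule continuous_on_compose2[OF U0(7)]) (auto intro!: continuous_intros)
  ultimately have cont: "continuous_on (U0 \<times> U1) (\<lambda>z. \<gamma> (fst z))"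
    "continuous_on (U0 \<times> U1) (\<lambda>z. \<gamma> (snd z))" "continuous_on (U0 \<times> U1) (\<lambda>z. \<tau> (fst z))"
    by blast+
  define S where "S = (U0 \<times> U1) \<inter> (\<lambda>z. snd (\<gamma> (fst z)) - snd (\<gamma> (snd z))) -` (- {0})"
  have "open S" unfolding S_def
    by (rule continuous_open_preimage) (use cont U0(1) U1(1) in \<open>auto intro!: continuous_intros open_Times\<close>)
  have zS: "?z \<in> S" using U0 U1 y by (simp add: S_def)
  have proper: "proper_chord z" if "z \<in> S" for z
    unfolding proper_chord_def using that U0(3,5,8) U1(3,5,8) by (auto simp: S_def mem_Times_iff subset_iff)
  show p: "proper_chord ?z" by (rule proper[OF zS])
  note u = proper_chord_direction[OF p] and ang = proper_chord_angles[OF p]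
  let ?u = "chord_direction ?z"
  have c: "0 < c0" "0 < c1" using u(4,5) ang(2,4) by (simp_all add: c0_def c1_def)
  have l: "0 < l" using u(2) by (simp add: l_def)
  have n: "inner ?u (\<nu> s0) = c0" "inner ?u (\<nu> s1) = - c1" using ang(2,4) by (simp_all add: c0_def c1_def)
  define S0 S1 where "S0 = inner ?u (\<tau> s0)" and "S1 = inner ?u (\<tau> s1)"
  have tt: "inner (\<tau> s0) (\<tau> s0) = 1" "inner (\<tau> s1) (\<tau> s1) = 1"
    using U0(5)[OF U0(2)] U1(5)[OF U1(2)] by (simp_all add: dot_square_norm)
  have uu: "inner ?u ?u = 1" using u(1) by (simp add: dot_square_norm)
  have sq: "1 = S0\<^sup>2 + c0\<^sup>2" "1 = S1\<^sup>2 + c1\<^sup>2"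
    using unit_frame_expansion(2)[OF U0(5)[OF U0(2)], of ?u] unit_frame_expansion(2)[OF U1(5)[OF U1(2)], of ?u]
      n uu by (simp_all add: normal_rot S0_def S1_def)
  \<comment> \<open>Both tangents are expanded in the orthonormal frame of the chord direction.\<close>
  have t01: "inner (\<tau> s1) (\<tau> s0) = S1 * S0 - c0 * c1"
  proof -
    have "inner (\<tau> s1) (\<tau> s0) = inner (\<tau> s1) ?u * inner (\<tau> s0) ?u + inner (\<tau> s1) (rot ?u) * inner (\<tau> s0) (rot ?u)"
      by (subst unit_frame_expansion(1)[OF u(1), of "\<tau> s1"])
        (simp add: inner_add_left inner_add_right inner_commute[of _ "\<tau> s0"])
    moreover have "inner (\<tau> s1) (rot ?u) = c1" "inner (\<tau> s0) (rot ?u) = - c0"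
      using n inner_rot_rot[of "\<tau> s1" ?u] inner_rot_rot[of "\<tau> s0" ?u] by (simp_all add: normal_rot inner_commute)
    ultimately show ?thesis by (simp add: S0_def S1_def inner_commute)
  qed
  define A' where "A' = (\<lambda>v. (fst v, \<kappa>0 * fst v - (c0 * fst v + c1 * snd v) / l))"
  define B' where "B' = (\<lambda>v. (snd v, (c0 * fst v + c1 * snd v) / l - \<kappa>1 * snd v))"
  \<comment> \<open>\<open>g\<close> is the inverse of \<open>chord_start\<close>, and \<open>g'\<close> that of its derivative \<open>A'\<close>.\<close>
  define g where "g = (\<lambda>x. (fst x, fst (billiard_map a h x)))"
  define g' where "g' = (\<lambda>v. (fst v, ((l * \<kappa>0 - c0) * fst v - l * snd v) / c1))"
  have k0: "(\<tau> has_vector_derivative \<kappa>0 *\<^sub>R \<nu> s0) (at s0)" and k1: "(\<tau> has_vector_derivative \<kappa>1 *\<^sub>R \<nu> s1) (at s1)"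
    using r0 r1 by (auto simp: regular_at_def)
  have A: "(chord_start has_derivative A') (at ?z)"
  proof -
    have "((\<lambda>z. inner (chord_direction z) (\<tau> (fst z))) has_derivative
       (\<lambda>v. (inner (snd v *\<^sub>R \<tau> s1 - fst v *\<^sub>R \<tau> s0) (\<tau> s0)
            - inner (snd v *\<^sub>R \<tau> s1 - fst v *\<^sub>R \<tau> s0) ?u * S0) / l + \<kappa>0 * fst v * c0)) (at ?z)"
      using tangential_derivative[OF p, of fst \<kappa>0] U0(4)[OF U0(2)] U1(4)[OF U1(2)] k0
      by (simp add: n S0_def l_def)
    also have "(\<lambda>v. (inner (snd v *\<^sub>R \<tau> s1 - fst v *\<^sub>R \<tau> s0) (\<tau> s0)
            - inner (snd v *\<^sub>R \<tau> s1 - fst v *\<^sub>R \<tau> s0) ?u * S0) / l + \<kappa>0 * fst v * c0)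
        = (\<lambda>v. c0 * (\<kappa>0 * fst v - (c0 * fst v + c1 * snd v) / l))"
    proof
      fix v :: "real \<times> real"
      have e1: "inner (snd v *\<^sub>R \<tau> s1 - fst v *\<^sub>R \<tau> s0) (\<tau> s0) = snd v * (S1 * S0 - c0 * c1) - fst v * (S0\<^sup>2 + c0\<^sup>2)"
        unfolding sq(1)[symmetric] by (simp add: inner_diff_left t01 tt)
      have e2: "inner (snd v *\<^sub>R \<tau> s1 - fst v *\<^sub>R \<tau> s0) ?u = snd v * S1 - fst v * S0"
        by (simp only: inner_diff_left inner_scaleR_left S0_def S1_def inner_commute[of ?u])
      show "(inner (snd v *\<^sub>R \<tau> s1 - fst v *\<^sub>R \<tau> s0) (\<tau> s0)
            - inner (snd v *\<^sub>R \<tau> s1 - fst v *\<^sub>R \<tau> s0) ?u * S0) / l + \<kappa>0 * fst v * c0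
        = c0 * (\<kappa>0 * fst v - (c0 * fst v + c1 * snd v) / l)"
        unfolding e1 e2 using l by (simp add: field_simps power2_eq_square)
    qed
    finally have "((\<lambda>z. arcsin (inner (chord_direction z) (\<tau> (fst z)))) has_derivative
       (\<lambda>v. c0 * (\<kappa>0 * fst v - (c0 * fst v + c1 * snd v) / l) / c0)) (at ?z)"
      using arcsin_derivative ang(7) by (fastforce simp: c0_def chord_start_def)
    then show ?thesis
      unfolding chord_start_def[abs_def] A'_def using c by (intro has_derivative_Pair has_derivative_fst has_derivative_ident) simp
  qed
  have B: "(chord_end has_derivative B') (at ?z)"
  proof -
    have "((\<lambda>z. inner (chord_direction z) (\<tau> (snd z))) has_derivative
       (\<lambda>v. (inner (snd v *\<^sub>R \<tau> s1 - fst v *\<^sub>R \<tau> s0) (\<tau> s1)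
            - inner (snd v *\<^sub>R \<tau> s1 - fst v *\<^sub>R \<tau> s0) ?u * S1) / l + \<kappa>1 * snd v * (- c1))) (at ?z)"
      using tangential_derivative[OF p, of snd \<kappa>1] U0(4)[OF U0(2)] U1(4)[OF U1(2)] k1
      by (simp add: n S1_def l_def)
    also have "(\<lambda>v. (inner (snd v *\<^sub>R \<tau> s1 - fst v *\<^sub>R \<tau> s0) (\<tau> s1)
            - inner (snd v *\<^sub>R \<tau> s1 - fst v *\<^sub>R \<tau> s0) ?u * S1) / l + \<kappa>1 * snd v * (- c1))
        = (\<lambda>v. c1 * ((c0 * fst v + c1 * snd v) / l - \<kappa>1 * snd v))"
    proof
      fix v :: "real \<times> real"
      have e1: "inner (snd v *\<^sub>R \<tau> s1 - fst v *\<^sub>R \<tau> s0) (\<tau> s1) = snd v * (S1\<^sup>2 + c1\<^sup>2) - fst v * (S1 * S0 - c0 * c1)"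
        unfolding sq(2)[symmetric] by (simp add: inner_diff_left t01 tt inner_commute[of "\<tau> s0" "\<tau> s1"])
      have e2: "inner (snd v *\<^sub>R \<tau> s1 - fst v *\<^sub>R \<tau> s0) ?u = snd v * S1 - fst v * S0"
        by (simp only: inner_diff_left inner_scaleR_left S0_def S1_def inner_commute[of ?u])
      show "(inner (snd v *\<^sub>R \<tau> s1 - fst v *\<^sub>R \<tau> s0) (\<tau> s1)
            - inner (snd v *\<^sub>R \<tau> s1 - fst v *\<^sub>R \<tau> s0) ?u * S1) / l + \<kappa>1 * snd v * (- c1)
        = c1 * ((c0 * fst v + c1 * snd v) / l - \<kappa>1 * snd v)"
        unfolding e1 e2 using l by (simp add: field_simps power2_eq_square)
    qed
    finally have "((\<lambda>z. arcsin (inner (chord_direction z) (\<tau> (snd z)))) has_derivative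
       (\<lambda>v. c1 * ((c0 * fst v + c1 * snd v) / l - \<kappa>1 * snd v) / c1)) (at ?z)"
      using arcsin_derivative ang(8) by (fastforce simp: c1_def chord_end_def)
    then show ?thesis
      unfolding chord_end_def[abs_def] B'_def using c by (intro has_derivative_Pair has_derivative_snd has_derivative_ident) simp
  qed
  have contA: "continuous_on S chord_start"
  proof -
    have SU: "S \<subseteq> U0 \<times> U1" by (auto simp: S_def)
    note cS = cont[THEN continuous_on_subset[OF _ SU]]
    have ne: "norm (\<gamma> (snd z) - \<gamma> (fst z)) \<noteq> 0" if "z \<in> S" for z
      using proper_chord_direction(2)[OF proper[OF that]] by linarith
    have "continuous_on S (\<lambda>z. inner (chord_direction z) (\<tau> (fst z)))"
      unfolding chord_direction_def by (intro continuous_intros cS) (use ne in blast)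
    then have "continuous_on S (\<lambda>z. arcsin (inner (chord_direction z) (\<tau> (fst z))))"
      using proper_chord_angles(7)[OF proper]
      by (intro continuous_on_arcsin) (auto simp: abs_less_iff intro: less_imp_le)
    with continuous_on_fst[OF continuous_on_id] show ?thesis
      unfolding chord_start_def[abs_def] by (rule continuous_on_Pair)
  qed
  have gA: "g (chord_start z) = z" if "z \<in> S" for z
    using billiard_chord[OF proper[OF that]] by (simp add: g_def chord_start_def chord_end_def)
  have G: "(g has_derivative g') (at (chord_start ?z))"
  proof (rule has_derivative_inverse_strong[OF \<open>open S\<close> zS contA gA A])
    show "A' \<circ> g' = id"
    proof
      fix v :: "real \<times> real"
      show "(A' \<circ> g') v = id v" using c l by (cases v) (simp add: A'_def g'_def field_simps)
    qed
  qed
  have opn: "open (chord_start ` S)"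
    by (rule invariance_of_domain[OF contA \<open>open S\<close>]) (rule inj_on_inverseI[of S g], rule gA)
  have eq: "(chord_end \<circ> g) x = billiard_map a h x" if "x \<in> chord_start ` S" for x
    using that gA billiard_chord[OF proper] by auto
  have "(chord_end \<circ> g has_derivative B' \<circ> g') (at (chord_start ?z))"
    using G by (rule diff_chain_at) (simp add: gA[OF zS] B)
  then have "(billiard_map a h has_derivative B' \<circ> g') (at (chord_start ?z))"
    by (rule has_derivative_transform_within_open[OF _ opn imageI[OF zS] eq])
  moreover have "B' \<circ> g' = leg_derivative l c0 \<kappa>0 c1 \<kappa>1"
  proof
    fix v :: "real \<times> real"
    show "(B' \<circ> g') v = leg_derivative l c0 \<kappa>0 c1 \<kappa>1 v"
      using c l by (cases v) (simp add: B'_def g'_def leg_derivative_def field_simps)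
  qed
  ultimately show "(billiard_map a h has_derivative leg_derivative l c0 \<kappa>0 c1 \<kappa>1) (at (chord_start ?z))" by simp
qed

end

section \<open>Periodic orbits and ellipticity\<close>

lemma det_2_2:
  fixes A :: "'a :: comm_ring_1 mat"
  assumes A: "A \<in> carrier_mat 2 2"
  shows "det A = A $$ (0,0) * A $$ (1,1) - A $$ (0,1) * A $$ (1,0)"
proof -
  have i: "{..<2::nat} = {0, 1}" by auto
  have "cofactor A 0 0 = A $$ (1,1)" "cofactor A 1 0 = - A $$ (0,1)"
    using A by (simp_all add: cofactor_def det_single mat_delete_def)
  then show ?thesis
    using laplace_expansion_column[OF A, of 0] by (simp add: i algebra_simps)
qed

lemma eigenvalue_complex_jacobian:
  assumes "D (1, 0) = (p, q)" "D (0, 1) = (r, s)" "p * s - q * r = 1"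
  shows "eigenvalue (complex_jacobian D) \<mu> \<longleftrightarrow> \<mu>\<^sup>2 - of_real (p + s) * \<mu> + 1 = 0"
proof -
  let ?A = "complex_jacobian D"
  have A: "?A \<in> carrier_mat 2 2"
    by (rule carrier_matI) (simp_all add: complex_jacobian_def mat_of_rows_list_def)
  have e: "?A $$ (0,0) = of_real p" "?A $$ (0,1) = of_real r" "?A $$ (1,0) = of_real q" "?A $$ (1,1) = of_real s"
    by (simp_all add: complex_jacobian_def mat_of_rows_list_def assms)
  have "det (char_matrix ?A \<mu>) = (of_real p - \<mu>) * (of_real s - \<mu>) - of_real r * of_real q"
    using A e by (subst det_2_2) (simp_all add: char_matrix_def)
  also have "\<dots> = \<mu>\<^sup>2 - of_real (p + s) * \<mu> + of_real (p * s - q * r)"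
    by (simp add: algebra_simps power2_eq_square)
  finally show ?thesis using assms(3) by (simp add: eigenvalue_det[OF A])
qed

text \<open>
  With determinant 1 the eigenvalues are the roots of \<open>\<mu>\<^sup>2 - \<tau> \<mu> + 1\<close> for the real trace \<open>\<tau>\<close>: a
  conjugate pair of product 1 if \<open>\<tau>\<^sup>2 < 4\<close>, and real otherwise.
\<close>
lemma elliptic_point_iff_trace:
  assumes D: "(F has_derivative D) (at x)"
    and D1: "D (1, 0) = (p, q)" and D2: "D (0, 1) = (r, s)" and det: "p * s - q * r = 1"
  shows "elliptic_point F x \<longleftrightarrow> \<bar>p + s\<bar> < 2"
proof -
  have "elliptic_point F x \<longleftrightarrow> (\<forall>\<mu>. eigenvalue (complex_jacobian D) \<mu> \<longrightarrow> cmod \<mu> = 1 \<and> Im \<mu> \<noteq> 0)"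
    unfolding elliptic_point_def using D has_derivative_unique by metis
  also have "\<dots> \<longleftrightarrow> (\<forall>\<mu>. \<mu>\<^sup>2 - of_real (p + s) * \<mu> + 1 = 0 \<longrightarrow> cmod \<mu> = 1 \<and> Im \<mu> \<noteq> 0)"
    by (simp only: eigenvalue_complex_jacobian[OF D1 D2 det])
  also have "\<dots> \<longleftrightarrow> \<bar>p + s\<bar> < 2"
  proof
    assume *: "\<forall>\<mu>. \<mu>\<^sup>2 - of_real (p + s) * \<mu> + 1 = 0 \<longrightarrow> cmod \<mu> = 1 \<and> Im \<mu> \<noteq> 0"
    show "\<bar>p + s\<bar> < 2"
    proof (rule ccontr)
      assume "\<not> \<bar>p + s\<bar> < 2"
      then have "2\<^sup>2 \<le> \<bar>p + s\<bar>\<^sup>2" by (intro power_mono) auto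
      then have d: "0 \<le> (p + s)\<^sup>2 - 4" by simp
      define m where "m = (p + s + sqrt ((p + s)\<^sup>2 - 4)) / 2"
      have "2 * m - (p + s) = sqrt ((p + s)\<^sup>2 - 4)" unfolding m_def by (simp add: field_simps)
      then have "(2 * m - (p + s))\<^sup>2 = (p + s)\<^sup>2 - 4" using d by simp
      then have "m\<^sup>2 - (p + s) * m + 1 = 0" by (simp add: power2_eq_square algebra_simps)
      then have "of_real (m\<^sup>2 - (p + s) * m + 1) = (0 :: complex)" by simp
      then have "(of_real m)\<^sup>2 - of_real (p + s) * of_real m + 1 = (0 :: complex)"
        by (simp only: of_real_add of_real_diff of_real_mult of_real_power of_real_1)
      then show False using * by fastforce
    qed
  next
    assume t: "\<bar>p + s\<bar> < 2"
    show "\<forall>\<mu>. \<mu>\<^sup>2 - of_real (p + s) * \<mu> + 1 = 0 \<longrightarrow> cmod \<mu> = 1 \<and> Im \<mu> \<noteq> 0"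
    proof (intro allI impI)
      fix \<mu> :: complex
      assume "\<mu>\<^sup>2 - of_real (p + s) * \<mu> + 1 = 0"
      moreover obtain u v where m: "\<mu> = Complex u v" by (cases \<mu>)
      ultimately have re: "u * u - v * v - (p + s) * u + 1 = 0" and im: "2 * u * v - (p + s) * v = 0"
        by (auto simp: complex_eq_iff power2_eq_square algebra_simps)
      have "(p + s)\<^sup>2 < 2\<^sup>2" using power_strict_mono[OF t, of 2] by simp
      then have "(p + s) * (p + s) < 4" by (simp add: power2_eq_square)
      moreover have "0 \<le> (2 * u - (p + s)) * (2 * u - (p + s))" by simp
      moreover have "(2 * u - (p + s)) * (2 * u - (p + s)) = 4 * (u * u - (p + s) * u) + (p + s) * (p + s)"
        by (simp add: algebra_simps)
      ultimately have v: "v \<noteq> 0" using re by auto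
      have "(2 * u - (p + s)) * v = 0" using im by (simp add: algebra_simps)
      then have "p + s = 2 * u" using v by simp
      then have "u * u + v * v = 1" using re by (simp add: algebra_simps)
      then show "cmod \<mu> = 1 \<and> Im \<mu> \<noteq> 0" using v by (simp add: m cmod_def power2_eq_square)
    qed
  qed
  finally show ?thesis .
qed

text \<open>
  In the coordinates \<open>(cos \<beta> ds, d\<beta>)\<close> the derivative is composed of these two shears: the change of
  direction at a reflection and the spreading along a link.
\<close>
definition kick :: "real \<Rightarrow> real \<times> real \<Rightarrow> real \<times> real" where
  "kick k v = (fst v, snd v - k * fst v)"

definition drift :: "real \<Rightarrow> real \<times> real \<Rightarrow> real \<times> real" where
  "drift l v = (fst v + l * snd v, snd v)"

definition transversal :: "real \<Rightarrow> real \<times> real \<Rightarrow> real \<times> real" where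
  "transversal c v = (c * fst v, snd v)"

lemma kick_scale: "kick k (r *\<^sub>R v) = r *\<^sub>R kick k v"
  and drift_scale: "drift l (r *\<^sub>R v) = r *\<^sub>R drift l v"
  and kick_0: "kick 0 v = v"
  and drift_drift: "drift l (drift m v) = drift (l + m) v"
  and drift_0: "drift 0 v = v"
  by (simp_all add: kick_def drift_def prod_eq_iff algebra_simps)

context elliptical_stadium begin

text \<open>
  In the symplectic coordinates a leg factors into shears: a drift along the link between the two
  kicks of the reflections. The minus sign is due to the angle being measured against a
  tangent that turns around at the other side of the table.
\<close>
lemma leg_derivative_factors:
  assumes "c0 \<noteq> 0" "c1 \<noteq> 0"
  shows "transversal c1 (leg_derivative l c0 \<kappa>0 c1 \<kappa>1 v)
     = - kick (\<kappa>1 / c1) (drift l (kick (\<kappa>0 / c0) (transversal c0 v)))"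
  using assms by (simp add: transversal_def leg_derivative_def kick_def drift_def field_simps)

text \<open>
  An orbit together with the lengths \<open>l\<close> of its links and the cosines \<open>c\<close> and curvatures \<open>\<kappa>\<close> at its
  impacts, at each point of which the billiard map has the classical derivative.
\<close>
definition linearized_orbit ::
  "(nat \<Rightarrow> real \<times> real) \<Rightarrow> (nat \<Rightarrow> real) \<Rightarrow> (nat \<Rightarrow> real) \<Rightarrow> (nat \<Rightarrow> real) \<Rightarrow> bool" where
  "linearized_orbit x l c \<kappa> \<longleftrightarrow>
     (\<forall>k. billiard_map a h (x k) = x (Suc k) \<and> 0 < c k \<and>
        (billiard_map a h has_derivative leg_derivative (l k) (c k) (\<kappa> k) (c (Suc k)) (\<kappa> (Suc k))) (at (x k)))"

lemma linearized_orbit_iterate: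
  assumes "linearized_orbit x l c \<kappa>" shows "(billiard_map a h ^^ k) (x m) = x (m + k)"
  using assms by (induction k) (auto simp: linearized_orbit_def)

text \<open>
  Each reflection contributes its kick to the link before and to the link after it. Multiplying the
  derivative by the kick of the link to come gives a product in which vanishing kicks disappear and
  drifts add up; without it the statement would fail for \<open>k = 0\<close>.
\<close>
lemma flat_run_derivative:
  assumes o: "linearized_orbit x l c \<kappa>" and flat: "\<And>i. 1 \<le> i \<Longrightarrow> i \<le> k \<Longrightarrow> \<kappa> (m + i) = 0"
  shows "\<exists>P. (billiard_map a h ^^ k has_derivative P) (at (x m)) \<and>
     (\<forall>v. kick (\<kappa> (m + k) / c (m + k)) (transversal (c (m + k)) (P v))
        = (-1) ^ k *\<^sub>R drift (\<Sum>i<k. l (m + i)) (kick (\<kappa> m / c m) (transversal (c m) v)))"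
  using flat
proof (induction k)
  case 0
  show ?case by (intro exI[of _ "\<lambda>v. v"]) (auto simp: drift_0 id_def)
next
  case (Suc k)
  then obtain P where P: "(billiard_map a h ^^ k has_derivative P) (at (x m))"
    "\<And>v. kick (\<kappa> (m + k) / c (m + k)) (transversal (c (m + k)) (P v))
        = (-1) ^ k *\<^sub>R drift (\<Sum>i<k. l (m + i)) (kick (\<kappa> m / c m) (transversal (c m) v))"
    by auto
  let ?Q = "leg_derivative (l (m + k)) (c (m + k)) (\<kappa> (m + k)) (c (m + Suc k)) (\<kappa> (m + Suc k))"
  have c: "c (m + k) \<noteq> 0" "c (m + Suc k) \<noteq> 0"
    using o unfolding linearized_orbit_def by (metis less_irrefl)+
  have "(billiard_map a h has_derivative ?Q) (at ((billiard_map a h ^^ k) (x m)))"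
    using o by (simp add: linearized_orbit_iterate[OF o] linearized_orbit_def)
  from diff_chain_at[OF P(1) this]
  have "(billiard_map a h ^^ Suc k has_derivative ?Q \<circ> P) (at (x m))" by simp
  moreover have "kick (\<kappa> (m + Suc k) / c (m + Suc k)) (transversal (c (m + Suc k)) ((?Q \<circ> P) v))
        = (-1) ^ Suc k *\<^sub>R drift (\<Sum>i<Suc k. l (m + i)) (kick (\<kappa> m / c m) (transversal (c m) v))" for v
  proof -
    have "\<kappa> (m + Suc k) = 0" using Suc.prems[of "Suc k"] by simp
    then have "kick (\<kappa> (m + Suc k) / c (m + Suc k)) (transversal (c (m + Suc k)) ((?Q \<circ> P) v))
       = - drift (l (m + k)) (kick (\<kappa> (m + k) / c (m + k)) (transversal (c (m + k)) (P v)))"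
      using leg_derivative_factors[OF c] by (simp add: kick_0)
    then show ?thesis unfolding P(2) by (simp add: drift_scale drift_drift add.commute)
  qed
  ultimately show ?case by blast
qed

lemma half_period_derivative:
  assumes o: "linearized_orbit x l c \<kappa>" and flat: "\<And>i. 1 \<le> i \<Longrightarrow> i \<le> n \<Longrightarrow> \<kappa> (m + i) = 0"
    and K: "\<kappa> m / c m = K" "\<kappa> (m + n + 1) / c (m + n + 1) = K" "\<kappa> (m + n + 2) / c (m + n + 2) = K"
    and l2: "(\<Sum>i\<le>n. l (m + i)) = l2" and l1: "l (m + n + 1) = l1"
  shows "\<exists>P. (billiard_map a h ^^ (n + 2) has_derivative P) (at (x m)) \<and>
     (\<forall>v. transversal (c (m + n + 2)) (P v)
        = (-1) ^ n *\<^sub>R kick K (drift l1 (kick K (kick K (drift l2 (kick K (transversal (c m) v)))))))"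
proof -
  obtain P where P: "(billiard_map a h ^^ n has_derivative P) (at (x m))"
    "\<And>v. kick (\<kappa> (m + n) / c (m + n)) (transversal (c (m + n)) (P v))
        = (-1) ^ n *\<^sub>R drift (\<Sum>i<n. l (m + i)) (kick K (transversal (c m) v))"
    using flat_run_derivative[OF o, of n m] flat K(1) by auto
  let ?B = "billiard_map a h"
  define Q where "Q k = leg_derivative (l k) (c k) (\<kappa> k) (c (Suc k)) (\<kappa> (Suc k))" for k
  have c: "c k \<noteq> 0" for k using o unfolding linearized_orbit_def by (metis less_irrefl)
  have Q: "(?B has_derivative Q k) (at (x k))" for k using o by (simp add: Q_def linearized_orbit_def)
  have Qf: "transversal (c (Suc k)) (Q k v)
     = - kick (\<kappa> (Suc k) / c (Suc k)) (drift (l k) (kick (\<kappa> k / c k) (transversal (c k) v)))" for k v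
    unfolding Q_def by (rule leg_derivative_factors[OF c c])
  have one: "(?B \<circ> (?B ^^ n) has_derivative Q (m + n) \<circ> P) (at (x m))"
    using Q[of "m + n"] by (intro diff_chain_at[OF P(1)]) (simp add: linearized_orbit_iterate[OF o])
  have "(?B \<circ> (?B \<circ> (?B ^^ n)) has_derivative Q (m + n + 1) \<circ> (Q (m + n) \<circ> P)) (at (x m))"
    using Q[of "m + n + 1"] linearized_orbit_iterate[OF o, of "Suc n" m]
    by (intro diff_chain_at[OF one]) (simp add: linearized_orbit_iterate[OF o])
  moreover have "?B \<circ> (?B \<circ> (?B ^^ n)) = ?B ^^ (n + 2)" by (simp add: fun_eq_iff)
  ultimately have "(?B ^^ (n + 2) has_derivative Q (m + n + 1) \<circ> (Q (m + n) \<circ> P)) (at (x m))" by (simp only:)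
  moreover have "transversal (c (m + n + 2)) ((Q (m + n + 1) \<circ> (Q (m + n) \<circ> P)) v)
      = (-1) ^ n *\<^sub>R kick K (drift l1 (kick K (kick K (drift l2 (kick K (transversal (c m) v))))))" for v
  proof -
    have s: "l (m + n) + (\<Sum>i<n. l (m + i)) = l2"
      using l2 by (simp add: lessThan_Suc_atMost[symmetric] add.commute)
    have 1: "transversal (c (m + n + 1)) (Q (m + n) (P v))
        = - ((-1) ^ n *\<^sub>R kick K (drift l2 (kick K (transversal (c m) v))))"
      using Qf[of "m + n" "P v"] K(2) by (simp only: P(2) Suc_eq_plus1 kick_scale drift_scale drift_drift s)
    have "transversal (c (m + n + 2)) (Q (m + n + 1) (Q (m + n) (P v)))
        = - kick K (drift l1 (kick K (transversal (c (m + n + 1)) (Q (m + n) (P v)))))"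
      using Qf[of "m + n + 1" "Q (m + n) (P v)"] K l1 by simp
    also have "\<dots> = (-1) ^ n *\<^sub>R kick K (drift l1 (kick K (kick K (drift l2 (kick K (transversal (c m) v))))))"
    proof -
      have "- ((-1) ^ n *\<^sub>R w) = (- ((-1) ^ n)) *\<^sub>R w" for w :: "real \<times> real" by simp
      then show ?thesis unfolding 1 by (simp only: kick_scale drift_scale) simp
    qed
    finally show ?thesis by simp
  qed
  ultimately show ?thesis by blast
qed

text \<open>
  With \<open>X = l\<^sub>1 K - 1\<close> and \<open>Y = l\<^sub>2 K - 1\<close>, half a period is the product of the unimodular matrices
  with rows \<open>(X, -l\<^sub>1)\<close>, \<open>(K (1 - X), X)\<close> and \<open>(Y, -l\<^sub>2)\<close>, \<open>(K (1 - Y), Y)\<close>, up to the sign \<open>(-1)\<^sup>n\<close>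
  that cancels over the full period. Its trace is \<open>4 X Y - 2\<close>.
\<close>
lemma period_derivative_elliptic:
  assumes o: "linearized_orbit x l c \<kappa>"
    and flat: "\<And>i. 1 \<le> i \<Longrightarrow> i \<le> n \<Longrightarrow> \<kappa> i = 0" "\<And>i. 1 \<le> i \<Longrightarrow> i \<le> n \<Longrightarrow> \<kappa> (n + 2 + i) = 0"
    and K: "\<And>k. k \<in> {0, n + 1, n + 2, n + 2 + n + 1, n + 2 + n + 2} \<Longrightarrow> \<kappa> k / c k = K"
    and c: "c (n + 2) = c 0" "c (n + 2 + n + 2) = c 0"
    and l2: "(\<Sum>i\<le>n. l i) = l2" "(\<Sum>i\<le>n. l (n + 2 + i)) = l2"
    and l1: "l (n + 1) = l1" "l (n + 2 + n + 1) = l1"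
  defines "\<Delta> \<equiv> (l1 * K - 1) * (l2 * K - 1)"
  shows "elliptic_point (billiard_map a h ^^ (4 + 2*n)) (x 0) \<longleftrightarrow> \<bar>(4 * \<Delta> - 2)\<^sup>2 - 2\<bar> < 2"
proof -
  let ?B = "billiard_map a h"
  define H where "H v = kick K (drift l1 (kick K (kick K (drift l2 (kick K v)))))" for v
  obtain P where P: "(?B ^^ (n + 2) has_derivative P) (at (x 0))"
    "\<And>v. transversal (c 0) (P v) = (-1) ^ n *\<^sub>R H (transversal (c 0) v)"
    using half_period_derivative[OF o, of n 0 K l2 l1] assms unfolding H_def by (auto simp: add.commute)
  obtain P' where P': "(?B ^^ (n + 2) has_derivative P') (at (x (n + 2)))"
    "\<And>v. transversal (c 0) (P' v) = (-1) ^ n *\<^sub>R H (transversal (c 0) v)"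
    using half_period_derivative[OF o, of n "n + 2" K l2 l1] assms unfolding H_def by auto
  have "(?B ^^ (n + 2)) (x 0) = x (n + 2)" using linearized_orbit_iterate[OF o, of "n + 2" 0] by simp
  then have "((?B ^^ (n + 2)) \<circ> (?B ^^ (n + 2)) has_derivative P' \<circ> P) (at (x 0))"
    using P(1) P'(1) by (intro diff_chain_at) simp_all
  moreover have "(?B ^^ (n + 2)) \<circ> (?B ^^ (n + 2)) = ?B ^^ (4 + 2*n)"
  proof -
    have "4 + 2*n = (n + 2) + (n + 2)" by simp
    then show ?thesis by (simp only: funpow_add)
  qed
  ultimately have D: "(?B ^^ (4 + 2*n) has_derivative P' \<circ> P) (at (x 0))" by simp
  define X Y where "X = l1 * K - 1" and "Y = l2 * K - 1"
  define \<alpha> \<beta> \<eta> \<delta> where "\<alpha> = X * Y - l1 * K * (1 - Y)" and "\<beta> = - X * l2 - l1 * Y"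
    and "\<eta> = K * (1 - X) * Y + X * K * (1 - Y)" and "\<delta> = X * Y - K * (1 - X) * l2"
  have H: "H v = (\<alpha> * fst v + \<beta> * snd v, \<eta> * fst v + \<delta> * snd v)" for v
    unfolding H_def \<alpha>_def \<beta>_def \<eta>_def \<delta>_def X_def Y_def kick_def drift_def
    by (simp add: algebra_simps)
  have det: "\<alpha> * \<delta> - \<beta> * \<eta> = 1"
  proof -
    have "X * X + l1 * K * (1 - X) = 1" "Y * Y + l2 * K * (1 - Y) = 1"
      unfolding X_def Y_def by (simp_all add: algebra_simps)
    moreover have "\<alpha> * \<delta> - \<beta> * \<eta> = (X * X + l1 * K * (1 - X)) * (Y * Y + l2 * K * (1 - Y))"
      unfolding \<alpha>_def \<beta>_def \<eta>_def \<delta>_def by (simp add: algebra_simps)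
    ultimately show ?thesis by simp
  qed
  have tr: "\<alpha> + \<delta> = 4 * \<Delta> - 2"
    unfolding \<alpha>_def \<delta>_def \<Delta>_def X_def Y_def by (simp add: algebra_simps)
  have c0: "c 0 \<noteq> 0" using o unfolding linearized_orbit_def by (metis less_irrefl)
  have T: "transversal (c 0) ((P' \<circ> P) v) = H (H (transversal (c 0) v))" for v
  proof -
    have "H (r *\<^sub>R w) = r *\<^sub>R H w" for r w unfolding H_def by (simp only: kick_scale drift_scale)
    then show ?thesis by (simp add: P(2) P'(2) flip: power_mult_distrib)
  qed
  have DP: "(P' \<circ> P) v = ((\<alpha> * (\<alpha> * (c 0 * fst v) + \<beta> * snd v) + \<beta> * (\<eta> * (c 0 * fst v) + \<delta> * snd v)) / c 0,
      \<eta> * (\<alpha> * (c 0 * fst v) + \<beta> * snd v) + \<delta> * (\<eta> * (c 0 * fst v) + \<delta> * snd v))" for v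
  proof -
    have "c 0 * fst ((P' \<circ> P) v) = fst (H (H (transversal (c 0) v)))" "snd ((P' \<circ> P) v) = snd (H (H (transversal (c 0) v)))"
      unfolding T[symmetric] by (simp_all add: transversal_def)
    then show ?thesis using c0 unfolding H by (simp add: prod_eq_iff transversal_def field_simps)
  qed
  have e: "(P' \<circ> P) (1, 0) = (\<alpha> * \<alpha> + \<beta> * \<eta>, c 0 * (\<eta> * (\<alpha> + \<delta>)))"
    "(P' \<circ> P) (0, 1) = ((\<beta> * (\<alpha> + \<delta>)) / c 0, \<eta> * \<beta> + \<delta> * \<delta>)"
    unfolding DP using c0 by (simp_all add: field_simps)
  have "(\<alpha> * \<alpha> + \<beta> * \<eta>) * (\<eta> * \<beta> + \<delta> * \<delta>) - c 0 * (\<eta> * (\<alpha> + \<delta>)) * ((\<beta> * (\<alpha> + \<delta>)) / c 0) = 1"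
  proof -
    have "c 0 * (\<eta> * (\<alpha> + \<delta>)) * ((\<beta> * (\<alpha> + \<delta>)) / c 0) = \<eta> * (\<alpha> + \<delta>) * (\<beta> * (\<alpha> + \<delta>))" using c0 by simp
    then have "(\<alpha> * \<alpha> + \<beta> * \<eta>) * (\<eta> * \<beta> + \<delta> * \<delta>) - c 0 * (\<eta> * (\<alpha> + \<delta>)) * ((\<beta> * (\<alpha> + \<delta>)) / c 0)
        = (\<alpha> * \<delta> - \<beta> * \<eta>) * (\<alpha> * \<delta> - \<beta> * \<eta>)"
      by (simp only:) (simp add: algebra_simps)
    then show ?thesis by (simp only: det)
  qed
  moreover have "(\<alpha> * \<alpha> + \<beta> * \<eta>) + (\<eta> * \<beta> + \<delta> * \<delta>) = (4 * \<Delta> - 2)\<^sup>2 - 2"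
  proof -
    have "(\<alpha> * \<alpha> + \<beta> * \<eta>) + (\<eta> * \<beta> + \<delta> * \<delta>) = (\<alpha> + \<delta>)\<^sup>2 - 2 * (\<alpha> * \<delta> - \<beta> * \<eta>)"
      by (simp add: algebra_simps power2_eq_square)
    then show ?thesis unfolding det tr by simp
  qed
  ultimately show ?thesis using elliptic_point_iff_trace[OF D e] by simp
qed

text \<open>
  A sequence of impact points is a billiard orbit if at each of them the incoming and the outgoing
  direction have the same tangential component.
\<close>
lemma orbit_from_chords:
  assumes reg: "\<And>k. regular_at a h (S k) (\<kappa> k)"
    and alt: "\<And>k. snd (\<gamma> (S k)) \<noteq> snd (\<gamma> (S (Suc k)))"
    and refl: "\<And>k. inner (chord_direction (S k, S (Suc k))) (\<tau> (S (Suc k)))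
       = inner (chord_direction (S (Suc k), S (Suc (Suc k)))) (\<tau> (S (Suc k)))"
  defines "x \<equiv> \<lambda>k. chord_start (S k, S (Suc k))"
  shows "linearized_orbit x (\<lambda>k. norm (\<gamma> (S (Suc k)) - \<gamma> (S k))) (\<lambda>k. cos (snd (x k))) \<kappa>"
proof -
  have e: "chord_end (S k, S (Suc k)) = chord_start (S (Suc k), S (Suc (Suc k)))" for k
    unfolding chord_end_def chord_start_def fst_conv snd_conv refl[of k] ..
  have p: "proper_chord (S k, S (Suc k))" for k
    by (rule billiard_leg(1)[OF reg[of k] reg[of "Suc k"] alt[of k]])
  have "billiard_map a h (x k) = x (Suc k)" for k
    unfolding x_def billiard_chord[OF p[of k]] by (rule e)
  moreover have "0 < cos (snd (x k))" for k
    unfolding x_def proper_chord_angles(2)[OF p[of k]] by (rule proper_chord_direction(4)[OF p[of k]])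
  moreover have "(billiard_map a h has_derivative leg_derivative (norm (\<gamma> (S (Suc k)) - \<gamma> (S k)))
      (cos (snd (x k))) (\<kappa> k) (cos (snd (x (Suc k)))) (\<kappa> (Suc k))) (at (x k))" for k
    using billiard_leg(2)[OF reg[of k] reg[of "Suc k"] alt[of k]] unfolding e[of k] x_def .
  ultimately show ?thesis unfolding linearized_orbit_def by blast
qed

end

section \<open>The pantographic orbit\<close>

locale pan_orbit = flat_ellipse a + elliptical_stadium a h for a h :: real +
  fixes n :: nat
begin

abbreviation "t \<equiv> pan_t n a h"
abbreviation "lam \<equiv> pan_lambda n a h"
abbreviation "x_right \<equiv> a * cos lam + h"
abbreviation "eps \<equiv> ((-1) ^ n :: real)"

definition slope :: real where "slope = (a\<^sup>2 * t\<^sup>2 - 1) / (2 * a * t)"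
definition stretch :: real where "stretch = (a\<^sup>2 * t\<^sup>2 + 1) / (2 * a * t)"
definition speed :: real where "speed = ellipse_speed a lam"

lemma t_pos: "0 < t" "1 < a\<^sup>2 * t\<^sup>2"
  using at_gt_1[OF pan_t(1)[OF h_pos]] by auto

lemma sin_eq: "sin lam = t * cos lam" and cos_lam_pos: "0 < cos lam" and sin_lam_pos: "0 < sin lam"
proof -
  show c: "0 < cos lam" unfolding pan_sin_cos(2)[OF h_pos] by (auto intro: add_pos_nonneg)
  show s: "sin lam = t * cos lam" unfolding pan_sin_cos(1,2)[OF h_pos] by simp
  show "0 < sin lam" unfolding s using c t_pos by simp
qed

lemma lam_bounds: "0 < lam" "lam < pi/2" "- (pi/2) < lam" "- (pi/2) < - lam" "- lam < pi/2"
proof -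
  show "0 < lam" "lam < pi/2" unfolding pan_lambda_def using t_pos arctan_bounded by auto
  then show "- (pi/2) < lam" "- (pi/2) < - lam" "- lam < pi/2" by auto
qed

lemma sin_lam_less_1: "sin lam < 1"
proof -
  have "sin lam < sin (pi/2)" using lam_bounds by (intro sin_monotone_2pi) auto
  then show ?thesis by simp
qed

lemma slope_pos: "0 < slope" and stretch_pos: "0 < stretch" and stretch_sq: "stretch\<^sup>2 = 1 + slope\<^sup>2"
  and slope_stretch: "slope + stretch = a * t"
proof -
  show "0 < slope" "0 < stretch" unfolding slope_def stretch_def using t_pos a_pos
    by (auto intro!: divide_pos_pos add_pos_pos)
  show "stretch\<^sup>2 = 1 + slope\<^sup>2" unfolding slope_def stretch_def using t_pos a_pos
    by (simp add: field_simps power2_eq_square)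
  show "slope + stretch = a * t" unfolding slope_def stretch_def using t_pos a_pos
    by (simp add: field_simps power2_eq_square)
qed

lemma speed_pos: "0 < speed" and speed_sq: "speed\<^sup>2 = a\<^sup>2 * (sin lam)\<^sup>2 + (cos lam)\<^sup>2"
  unfolding speed_def using ellipse_speed_ge1[of lam] by (simp, simp add: ellipse_speed_def)

lemma half_width: "real n + sin lam = slope * x_right"
  unfolding slope_def using half_chord_identity[OF h_pos, of n] by (simp add: add.commute)

text \<open>
  This is where \<open>a\<^sup>2 < 2\<close> enters the existence of the orbit: it keeps the impacts on the straight
  segments strictly between the junctions.
\<close>
lemma flat_room: "real n < slope * h"
proof -
  have "slope * (a * cos lam) = (a\<^sup>2 * t\<^sup>2 - 1) / (2 * t) * cos lam"
    unfolding slope_def using a_pos t_pos by (simp add: field_simps)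
  also have "\<dots> < t * cos lam"
  proof -
    have "a\<^sup>2 * t\<^sup>2 < 2 * t\<^sup>2" using a_sq t_pos by (intro mult_strict_right_mono) auto
    then have "a\<^sup>2 * t\<^sup>2 - 1 < 2 * t\<^sup>2" by linarith
    moreover have "2 * t\<^sup>2 = t * (2 * t)" by (simp add: power2_eq_square)
    moreover have "0 < 2 * t" using t_pos by simp
    ultimately have "(a\<^sup>2 * t\<^sup>2 - 1) / (2 * t) < t" by (simp only: pos_divide_less_eq)
    then show ?thesis using cos_lam_pos by (intro mult_strict_right_mono)
  qed
  finally show ?thesis using half_width sin_eq by (simp add: distrib_left)
qed

lemma x_right_gt: "h < x_right" "0 < x_right"
  using a_pos cos_lam_pos h_pos mult_pos_pos[of a "cos lam"] by linarith+

lemma eps_cases: "eps = 1 \<or> eps = -1" and eps_sq: "eps * eps = 1"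
  by (cases "even n"; simp)+

text \<open>
  The impact points over half a period. In the strip unfolded by reflections, \<open>half_vertex j\<close> for
  \<open>1 \<le> j \<le> n\<close> is the point at height \<open>-(2 j - 1)\<close> on the line of the given slope through \<open>(0, -n)\<close>. After
  \<open>n\<close> reflections the strip is upside down if \<open>n\<close> is odd, hence the factor \<open>eps\<close> at the left end.
\<close>
definition half_vertex :: "nat \<Rightarrow> real \<times> real" where
  "half_vertex j = (if j = 0 then (x_right, sin lam)
     else if j \<le> n then ((real n + 1 - 2 * real j) / slope, (-1) ^ j)
     else (- x_right, - eps * sin lam))"

text \<open>
  For \<open>j = Suc n\<close> this is the vertical link on the left, which closes the first half of the period.
\<close>
definition half_direction :: "nat \<Rightarrow> real \<times> real" where
  "half_direction j = (if j \<le> n then (- 1 / stretch, - ((-1) ^ j) * slope / stretch) else (0, eps))"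

definition half_length :: "nat \<Rightarrow> real" where
  "half_length j = (if j \<le> n then (fst (half_vertex j) - fst (half_vertex (Suc j))) * stretch else 2 * sin lam)"

text \<open>
  The symmetry that advances the orbit by half a period: a reflection for even \<open>n\<close> and the point
  reflection for odd \<open>n\<close>.
\<close>
definition sig :: "real \<times> real \<Rightarrow> real \<times> real" where
  "sig p = (- fst p, eps * snd p)"

definition turn :: "nat \<Rightarrow> real \<times> real \<Rightarrow> real \<times> real" where
  "turn b p = (if even b then p else sig p)"

definition vertex :: "nat \<Rightarrow> real \<times> real" where
  "vertex k = turn (k div (n + 2)) (half_vertex (k mod (n + 2)))"

definition direction :: "nat \<Rightarrow> real \<times> real" where
  "direction k = turn (k div (n + 2)) (half_direction (k mod (n + 2)))"

text \<open>
  The counterclockwise unit tangent, read off from the position. It is meant for the impact points,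
  whose heights are \<open>1\<close>, \<open>-1\<close>, \<open>sin lam\<close> or \<open>- sin lam\<close>.
\<close>
definition tangent_at :: "real \<times> real \<Rightarrow> real \<times> real" where
  "tangent_at p = (if \<bar>snd p\<bar> = 1 then (- snd p, 0)
     else (1 / speed) *\<^sub>R (- (a * snd p), sgn (fst p) * cos lam))"

lemma sig_sig: "sig (sig p) = p" using eps_sq by (simp add: sig_def prod_eq_iff)

lemma sig_inner: "inner (sig p) (sig q) = inner p q"
  using eps_cases by (auto simp: sig_def inner_prod_def)

lemma turn_inner: "inner (turn b p) (turn b q) = inner p q"
  by (simp add: turn_def sig_inner)

lemma turn_Suc: "turn (Suc b) p = turn b (sig p)"
  by (simp add: turn_def sig_sig)

lemma turn_diff_scale: "turn b (p - q) = turn b p - turn b q" "turn b (r *\<^sub>R p) = r *\<^sub>R turn b p"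
  by (auto simp: turn_def sig_def prod_eq_iff algebra_simps)

text \<open>
  For even \<open>n\<close> the symmetry reverses the orientation of the curve.
\<close>
lemma tangent_sig: "tangent_at (sig p) = (- eps) *\<^sub>R sig (tangent_at p)"
  using eps_cases by (auto simp: tangent_at_def sig_def sgn_minus)

lemma tangent_turn: "\<exists>c. tangent_at (turn b p) = c *\<^sub>R turn b (tangent_at p)"
proof (cases "even b")
  case True
  then show ?thesis by (intro exI[of _ 1]) (simp add: turn_def)
next
  case False
  then show ?thesis by (intro exI[of _ "- eps"]) (simp only: turn_def if_False tangent_sig)
qed

lemma vertex_step:
  obtains (inside) b j where "j \<le> n" "k = b * (n + 2) + j" "vertex k = turn b (half_vertex j)"
      "vertex (Suc k) = turn b (half_vertex (Suc j))" "direction k = turn b (half_direction j)"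
      "k mod (n + 2) = j" "Suc k mod (n + 2) = Suc j" "direction (Suc k) = turn b (half_direction (Suc j))"
  | (last) b where "k = b * (n + 2) + (n + 1)" "vertex k = turn b (half_vertex (Suc n))"
      "vertex (Suc k) = turn b (sig (half_vertex 0))" "direction k = turn b (half_direction (Suc n))"
      "k mod (n + 2) = Suc n" "Suc k mod (n + 2) = 0" "direction (Suc k) = turn b (sig (half_direction 0))"
proof -
  define b j where "b = k div (n + 2)" and "j = k mod (n + 2)"
  have k: "k = b * (n + 2) + j" unfolding b_def j_def by presburger
  have kd: "k div (n + 2) = b" "k mod (n + 2) = j" by (simp_all only: b_def j_def)
  have v: "vertex k = turn b (half_vertex j)" "direction k = turn b (half_direction j)"
    unfolding vertex_def direction_def kd by (rule refl)+
  have "j < n + 2" unfolding j_def by simp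
  then consider "j \<le> n" | "j = n + 1" by linarith
  then show thesis
  proof cases
    case 1
    then have s: "Suc k = b * (n + 2) + Suc j" "Suc j < n + 2" using k by auto
    have sd: "Suc k div (n + 2) = b" "Suc k mod (n + 2) = Suc j"
      unfolding s(1) using s(2) by (simp_all only: div_mult_self3 mod_mult_self3 div_less mod_less add_0_right)
    have "vertex (Suc k) = turn b (half_vertex (Suc j))" "direction (Suc k) = turn b (half_direction (Suc j))"
      unfolding vertex_def direction_def sd by (rule refl)+
    then show thesis by (intro inside[OF 1 k v(1) _ v(2) kd(2) sd(2)])
  next
    case 2
    then have s: "Suc k = Suc b * (n + 2)" using k by simp
    have sd: "Suc k div (n + 2) = Suc b" "Suc k mod (n + 2) = 0"
      unfolding s by (rule nonzero_mult_div_cancel_right, simp) (rule mod_mult_self2_is_0)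
    have "vertex (Suc k) = turn b (sig (half_vertex 0))" "direction (Suc k) = turn b (sig (half_direction 0))"
      unfolding vertex_def direction_def sd turn_Suc by (rule refl)+
    moreover have "j = Suc n" using 2 by simp
    ultimately show thesis using k v kd(2) sd(2) by (intro last[of b]) simp_all
  qed
qed

lemma half_step:
  assumes "j \<le> n"
  shows "half_vertex (Suc j) - half_vertex j = half_length j *\<^sub>R half_direction j" "0 < half_length j"
proof -
  define w where "w = fst (half_vertex j) - fst (half_vertex (Suc j))"
  have X: "x_right = (real n + sin lam) / slope" using half_width slope_pos by simp
  have pw: "0 < w \<and> snd (half_vertex (Suc j)) - snd (half_vertex j) = - ((-1) ^ j) * slope * w"
  proof -
    consider "j = 0" "n = 0" | "j = 0" "0 < n" | "0 < j" "j < n" | "0 < j" "j = n" using assms by linarith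
    then show ?thesis
    proof cases
      case 1
      have v: "half_vertex j = (x_right, sin lam)" "half_vertex (Suc j) = (- x_right, - sin lam)"
        using 1 unfolding half_vertex_def by simp_all
      have "w = 2 * x_right" unfolding w_def v by simp
      moreover have "sin lam = slope * x_right" using half_width 1(2) by linarith
      ultimately show ?thesis unfolding v using x_right_gt(2) 1(1) by simp
    next
      case 2
      then have w: "w = (real n + sin lam) / slope - (real n - 1) / slope"
        unfolding w_def half_vertex_def X by simp
      also have "\<dots> = (1 + sin lam) / slope" by (simp add: diff_divide_distrib add_divide_distrib)
      finally show ?thesis using 2 slope_pos sin_lam_pos by (simp add: half_vertex_def)
    next
      case 3
      then have w: "w = (real n + 1 - 2 * real j) / slope - (real n + 1 - 2 * (real j + 1)) / slope"
        unfolding w_def half_vertex_def by (simp add: add.commute)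
      also have "\<dots> = 2 / slope" by (simp add: diff_divide_distrib add_divide_distrib)
      finally show ?thesis using 3 slope_pos by (simp add: half_vertex_def)
    next
      case 4
      then have w: "w = (1 - real n) / slope + (real n + sin lam) / slope"
        unfolding w_def half_vertex_def X by simp
      also have "\<dots> = (1 + sin lam) / slope" by (simp add: diff_divide_distrib add_divide_distrib)
      finally have w: "w = (1 + sin lam) / slope" .
      then have "slope * w = 1 + sin lam" using slope_pos by simp
      then have "- ((-1) ^ j) * slope * w = - eps * (1 + sin lam)" unfolding 4(2) mult.assoc by (simp only:)
      moreover have "0 < w" unfolding w using slope_pos sin_lam_pos by simp
      ultimately show ?thesis using 4 by (simp add: half_vertex_def distrib_left)
    qed
  qed
  have L: "half_length j = w * stretch" using assms by (simp add: half_length_def w_def)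
  show "0 < half_length j" unfolding L using pw stretch_pos by simp
  have "half_length j *\<^sub>R half_direction j = (- w, - ((-1) ^ j) * slope * w)"
    unfolding L half_direction_def using assms stretch_pos by simp
  then show "half_vertex (Suc j) - half_vertex j = half_length j *\<^sub>R half_direction j"
    using pw by (simp add: prod_eq_iff w_def)
qed

lemma vertical_step: "sig (half_vertex 0) - half_vertex (Suc n) = half_length (Suc n) *\<^sub>R half_direction (Suc n)"
  by (simp add: half_vertex_def half_length_def half_direction_def sig_def)

lemma half_length_pos: "j \<le> Suc n \<Longrightarrow> 0 < half_length j"
  using half_step(2)[of j] sin_lam_pos by (cases "j \<le> n") (auto simp: half_length_def)

lemma vertex_chord: "vertex (Suc k) - vertex k = half_length (k mod (n + 2)) *\<^sub>R direction k"
proof (cases rule: vertex_step[of k])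
  case (inside b j)
  then show ?thesis by (simp flip: turn_diff_scale add: half_step(1))
next
  case (last b)
  then show ?thesis by (simp flip: turn_diff_scale add: vertical_step)
qed

lemma half_length_mod_pos: "0 < half_length (k mod (n + 2))"
proof -
  have "k mod (n + 2) < n + 2" by simp
  then show ?thesis by (intro half_length_pos) linarith
qed

lemma norm_direction: "norm (direction k) = 1"
proof -
  have "inner (half_direction j) (half_direction j) = 1" for j
  proof (cases "j \<le> n")
    case True
    have "(-1 / stretch) * (-1 / stretch) + (- ((-1) ^ j) * slope / stretch) * (- ((-1) ^ j) * slope / stretch)
        = (1 + slope\<^sup>2) / stretch\<^sup>2"
      by (simp add: power2_eq_square add_divide_distrib)
    then show ?thesis using True stretch_pos by (simp add: half_direction_def inner_Pair stretch_sq[symmetric])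
  next
    case False
    then show ?thesis by (simp add: half_direction_def inner_Pair)
  qed
  then show ?thesis by (simp add: direction_def norm_eq_1 turn_inner)
qed

lemma vertex_heights: "snd (vertex (Suc k)) \<noteq> snd (vertex k)"
proof -
  have "snd (direction k) \<noteq> 0"
    using slope_pos stretch_pos by (simp add: direction_def turn_def sig_def half_direction_def)
  then have "snd (vertex (Suc k) - vertex k) \<noteq> 0"
    unfolding vertex_chord using half_length_mod_pos[of k] by simp
  then show ?thesis by simp
qed

lemma abs_power_minus1: "\<bar>(-1) ^ j :: real\<bar> = 1" by (simp add: power_abs)

lemma tangent_half:
  "tangent_at (half_vertex 0) = (1 / speed) *\<^sub>R (- (a * sin lam), cos lam)"
  "1 \<le> j \<Longrightarrow> j \<le> n \<Longrightarrow> tangent_at (half_vertex j) = (- ((-1) ^ j), 0)"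
  "tangent_at (half_vertex (Suc n)) = (1 / speed) *\<^sub>R (a * eps * sin lam, - cos lam)"
proof -
  have s: "\<bar>sin lam\<bar> \<noteq> 1" "\<bar>eps * sin lam\<bar> \<noteq> 1"
    using sin_lam_pos sin_lam_less_1 by (auto simp: abs_mult abs_power_minus1)
  show "tangent_at (half_vertex 0) = (1 / speed) *\<^sub>R (- (a * sin lam), cos lam)"
    using s x_right_gt by (simp add: tangent_at_def half_vertex_def)
  show "1 \<le> j \<Longrightarrow> j \<le> n \<Longrightarrow> tangent_at (half_vertex j) = (- ((-1) ^ j), 0)"
    by (simp add: tangent_at_def half_vertex_def abs_power_minus1)
  have "sgn (- x_right) = -1" using x_right_gt by (simp only: sgn_minus) simp
  then show "tangent_at (half_vertex (Suc n)) = (1 / speed) *\<^sub>R (a * eps * sin lam, - cos lam)"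
    using s by (simp add: tangent_at_def half_vertex_def)
qed

text \<open>
  The law of reflection at the ends of the vertical links. It reduces to \<open>m + sqrt (1 + m\<^sup>2) = a t\<close> for the
  slope \<open>m\<close>, which is why the slope has this value.
\<close>
lemma bounce_identity: "(a * sin lam - slope * cos lam) / stretch = cos lam"
proof -
  have "a * sin lam - slope * cos lam = (a * t - slope) * cos lam"
    unfolding sin_eq by (simp add: algebra_simps)
  also have "\<dots> = stretch * cos lam" using slope_stretch by simp
  finally show ?thesis using stretch_pos by simp
qed

lemma half_tangential:
  "inner (half_direction 0) (tangent_at (half_vertex 0)) = cos lam / speed"
  "inner (half_direction n) (tangent_at (half_vertex (Suc n))) = - eps * cos lam / speed"
  "inner (half_direction (Suc n)) (tangent_at (half_vertex (Suc n))) = - eps * cos lam / speed"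
proof -
  have "inner (half_direction 0) (tangent_at (half_vertex 0))
      = ((a * sin lam - slope * cos lam) / stretch) / speed"
    by (simp add: tangent_half half_direction_def inner_Pair diff_divide_distrib)
  then show "inner (half_direction 0) (tangent_at (half_vertex 0)) = cos lam / speed"
    by (simp only: bounce_identity)
  have "inner (half_direction n) (tangent_at (half_vertex (Suc n)))
      = - eps * ((a * sin lam - slope * cos lam) / stretch) / speed"
    by (simp add: tangent_half half_direction_def inner_Pair diff_divide_distrib algebra_simps)
  then show "inner (half_direction n) (tangent_at (half_vertex (Suc n))) = - eps * cos lam / speed"
    by (simp only: bounce_identity)
  show "inner (half_direction (Suc n)) (tangent_at (half_vertex (Suc n))) = - eps * cos lam / speed"
    by (simp add: tangent_half half_direction_def inner_Pair)
qed

text \<open>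
  On the segments the horizontal component persists; at the vertical links this is \<open>bounce_identity\<close>; the
  second half of the period follows by symmetry, up to a common factor of the tangent.
\<close>
lemma reflection_law:
  "inner (direction k) (tangent_at (vertex (Suc k))) = inner (direction (Suc k)) (tangent_at (vertex (Suc k)))"
proof (cases rule: vertex_step[of k])
  case (inside b j)
  obtain c where c: "tangent_at (turn b (half_vertex (Suc j))) = c *\<^sub>R turn b (tangent_at (half_vertex (Suc j)))"
    using tangent_turn by blast
  have "inner (half_direction j) (tangent_at (half_vertex (Suc j)))
      = inner (half_direction (Suc j)) (tangent_at (half_vertex (Suc j)))"
  proof (cases "j = n")
    case True
    then show ?thesis by (simp only: half_tangential)
  next
    case False
    then show ?thesis using inside(1) by (simp add: tangent_half(2) half_direction_def inner_Pair)
  qed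
  then show ?thesis unfolding inside(4,5,8) c by (simp add: turn_inner)
next
  case (last b)
  obtain c where c: "tangent_at (turn b (sig (half_vertex 0))) = c *\<^sub>R turn b (tangent_at (sig (half_vertex 0)))"
    using tangent_turn by blast
  have "inner (half_direction (Suc n)) (sig (tangent_at (half_vertex 0))) = eps * (eps * cos lam / speed)"
    by (simp add: tangent_half half_direction_def sig_def inner_Pair)
  then have "inner (half_direction (Suc n)) (tangent_at (sig (half_vertex 0)))
      = inner (sig (half_direction 0)) (tangent_at (sig (half_vertex 0)))"
    unfolding tangent_sig inner_scaleR_right sig_inner half_tangential using eps_sq
    by (simp add: mult.assoc[symmetric])
  then show ?thesis unfolding last(3,4,7) c by (simp add: turn_inner)
qed

definition vertex_curvature :: "nat \<Rightarrow> real" where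
  "vertex_curvature k = (if k mod (n + 2) = 0 \<or> k mod (n + 2) = Suc n then a / speed ^ 3 else 0)"

lemma admissible_ellipse:
  assumes "s1 = 1 \<or> s1 = -1" "s2 = 1 \<or> s2 = -1"
  shows "\<exists>s. regular_at a h s (a / speed ^ 3) \<and> \<gamma> s = (s1 * x_right, s2 * sin lam) \<and>
     \<tau> s = tangent_at (s1 * x_right, s2 * sin lam)"
proof -
  have e: "ellipse_speed a (s2 * lam) = speed" using assms(2) by (auto simp: ellipse_speed_def speed_def)
  have sc: "sin (s2 * lam) = s2 * sin lam" "cos (s2 * lam) = cos lam" using assms(2) by auto
  have b: "- (pi/2) < s2 * lam" "s2 * lam < pi/2" "s2 * lam \<noteq> 0" using assms(2) lam_bounds by auto
  have n1: "\<bar>s2 * sin lam\<bar> \<noteq> 1" using assms(2) sin_lam_pos sin_lam_less_1 by auto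
  have sg: "sgn x_right = 1" using x_right_gt by simp
  from assms(1) show ?thesis
  proof
    assume s1: "s1 = 1"
    then show ?thesis using regular_right[OF b] n1 sg by (simp add: e sc tangent_at_def)
  next
    assume s1: "s1 = -1"
    have m: "s1 * x_right = - x_right" unfolding s1 by simp
    have g: "sgn (- x_right) = -1" unfolding sgn_minus sg ..
    show ?thesis using regular_left[OF b(1,2)] n1 unfolding e sc tangent_at_def
      by (simp only: prod.sel m g if_False mult_minus1)
  qed
qed

lemma flat_vertex_inside: assumes "1 \<le> j" "j \<le> n" shows "\<bar>fst (half_vertex j)\<bar> < h"
proof -
  have "\<bar>real n + 1 - 2 * real j\<bar> \<le> real n" using assms by (simp add: abs_le_iff)
  then have "\<bar>real n + 1 - 2 * real j\<bar> < slope * h" using flat_room by linarith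
  then show ?thesis using assms slope_pos by (simp add: half_vertex_def abs_divide pos_divide_less_eq mult.commute)
qed

lemma vertex_kind:
  obtains (ellipse) s1 s2 where "k mod (n + 2) = 0 \<or> k mod (n + 2) = Suc n" "s1 = 1 \<or> s1 = -1" "s2 = 1 \<or> s2 = -1"
      "vertex k = (s1 * x_right, s2 * sin lam)"
  | (flat) x y where "\<not> (k mod (n + 2) = 0 \<or> k mod (n + 2) = Suc n)" "\<bar>x\<bar> < h" "y = 1 \<or> y = -1" "vertex k = (x, y)"
proof -
  define b j where "b = k div (n + 2)" and "j = k mod (n + 2)"
  have v: "vertex k = turn b (half_vertex j)" by (simp add: vertex_def b_def j_def)
  have "j < n + 2" unfolding j_def by simp
  then consider "j = 0" | "j = Suc n" | "1 \<le> j" "j \<le> n" by linarith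
  then show thesis
  proof cases
    case 1
    then have w: "vertex k = ((if even b then 1 else -1) * x_right, (if even b then 1 else eps) * sin lam)"
      by (simp add: v half_vertex_def turn_def sig_def)
    have m: "k mod (n + 2) = 0 \<or> k mod (n + 2) = Suc n" using 1 unfolding j_def by blast
    have s: "(if even b then 1 else -1 :: real) = 1 \<or> (if even b then 1 else -1 :: real) = -1"
      "(if even b then 1 else eps) = 1 \<or> (if even b then 1 else eps) = -1" using eps_cases by auto
    show thesis by (rule ellipse[OF m s w])
  next
    case 2
    then have w: "vertex k = ((if even b then -1 else 1) * x_right, (if even b then - eps else -1) * sin lam)"
      using eps_sq by (simp add: v half_vertex_def turn_def sig_def)
    have m: "k mod (n + 2) = 0 \<or> k mod (n + 2) = Suc n" using 2 unfolding j_def by blast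
    have s: "(if even b then -1 else 1 :: real) = 1 \<or> (if even b then -1 else 1 :: real) = -1"
      "(if even b then - eps else -1) = 1 \<or> (if even b then - eps else -1) = -1" using eps_cases by auto
    show thesis by (rule ellipse[OF m s w])
  next
    case 3
    have "snd (half_vertex j) = (-1) ^ j" using 3 by (simp add: half_vertex_def)
    then have y: "snd (half_vertex j) = 1 \<or> snd (half_vertex j) = -1" by (cases "even j") auto
    have "\<bar>fst (turn b (half_vertex j))\<bar> < h"
      using flat_vertex_inside[OF 3] by (simp add: turn_def sig_def)
    moreover have "snd (turn b (half_vertex j)) = 1 \<or> snd (turn b (half_vertex j)) = -1"
      using y eps_cases by (auto simp: turn_def sig_def)
    moreover have m: "\<not> (k mod (n + 2) = 0 \<or> k mod (n + 2) = Suc n)" using 3 unfolding j_def by linarith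
    ultimately show thesis unfolding v[symmetric] by (intro flat[OF m _ _ prod.collapse[symmetric]])
  qed
qed

lemma admissible_vertex:
  "\<exists>s. regular_at a h s (vertex_curvature k) \<and> \<gamma> s = vertex k \<and> \<tau> s = tangent_at (vertex k)"
proof (cases rule: vertex_kind[of k])
  case (ellipse s1 s2)
  then show ?thesis using admissible_ellipse[OF ellipse(2,3)] by (simp add: vertex_curvature_def)
next
  case (flat x y)
  then show ?thesis using regular_top[of x] regular_bottom[of x] by (auto simp: vertex_curvature_def tangent_at_def)
qed

text \<open>
  A function of the impact point alone, so that periodicity of the points passes on to the orbit.
\<close>
definition vertex_arc :: "nat \<Rightarrow> real" where "vertex_arc k = inv_into {0..<len} \<gamma> (vertex k)"

lemma vertex_arc: "regular_at a h (vertex_arc k) (vertex_curvature k)" "\<gamma> (vertex_arc k) = vertex k"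
    "\<tau> (vertex_arc k) = tangent_at (vertex k)" "vertex_arc k \<in> {0..<len}"
proof -
  obtain s where s: "regular_at a h s (vertex_curvature k)" "\<gamma> s = vertex k" "\<tau> s = tangent_at (vertex k)"
    using admissible_vertex by blast
  have "0 < s" "s < len" using s(1) unfolding regular_at_def by blast+
  then have "s \<in> {0..<len}" by simp
  from inv_into_f_f[OF point_inj this] have e: "vertex_arc k = s" unfolding vertex_arc_def s(2) .
  show "regular_at a h (vertex_arc k) (vertex_curvature k)" "\<gamma> (vertex_arc k) = vertex k"
    "\<tau> (vertex_arc k) = tangent_at (vertex k)" "vertex_arc k \<in> {0..<len}" unfolding e by fact+
qed

lemma chord_direction_arc: "chord_direction (vertex_arc k, vertex_arc (Suc k)) = direction k"
proof -
  have n: "norm (vertex (Suc k) - vertex k) = half_length (k mod (n + 2))"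
    unfolding vertex_chord using half_length_mod_pos[of k] by (simp add: norm_direction)
  show ?thesis unfolding chord_direction_def using half_length_mod_pos[of k]
    by (simp add: vertex_arc n) (simp add: vertex_chord)
qed

definition state :: "nat \<Rightarrow> real \<times> real" where "state k = chord_start (vertex_arc k, vertex_arc (Suc k))"

lemma state_orbit:
  "linearized_orbit state (\<lambda>k. half_length (k mod (n + 2))) (\<lambda>k. cos (snd (state k))) vertex_curvature"
proof -
  have "linearized_orbit (\<lambda>k. chord_start (vertex_arc k, vertex_arc (Suc k)))
     (\<lambda>k. norm (\<gamma> (vertex_arc (Suc k)) - \<gamma> (vertex_arc k))) (\<lambda>k. cos (snd (chord_start (vertex_arc k, vertex_arc (Suc k))))) vertex_curvature"
    using vertex_heights
    by (intro orbit_from_chords) (simp_all add: vertex_arc chord_direction_arc reflection_law eq_commute)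
  moreover have "norm (\<gamma> (vertex_arc (Suc k)) - \<gamma> (vertex_arc k)) = half_length (k mod (n + 2))" for k
    unfolding vertex_arc vertex_chord using half_length_mod_pos[of k] by (simp add: norm_direction)
  ultimately show ?thesis by (simp add: state_def[abs_def])
qed

lemma state_iterate: "(billiard_map a h ^^ k) (state 0) = state k"
  using linearized_orbit_iterate[OF state_orbit, of k 0] by simp

lemma fst_state: "fst (state k) = vertex_arc k" by (simp add: state_def chord_start_def)

lemma state_sin: "sin (snd (state k)) = inner (direction k) (tangent_at (vertex k))"
  and state_cos_pos: "0 < cos (snd (state k))"
  and state_angle: "snd (state k) \<in> {- (pi/2)<..<pi/2}"
proof -
  have p: "proper_chord (vertex_arc k, vertex_arc (Suc k))"
    using vertex_heights[of k] by (intro billiard_leg(1)[OF vertex_arc(1)[of k] vertex_arc(1)[of "Suc k"]]) (simp add: vertex_arc(2))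
  show "sin (snd (state k)) = inner (direction k) (tangent_at (vertex k))"
    unfolding state_def proper_chord_angles(1)[OF p] by (simp add: chord_direction_arc vertex_arc)
  show "snd (state k) \<in> {- (pi/2)<..<pi/2}" unfolding state_def by (rule proper_chord_angles(5)[OF p])
  then show "0 < cos (snd (state k))" by (intro cos_gt_zero_pi) auto
qed

text \<open>
  At all four impacts on the half-ellipses the tangential component of the direction is \<open>cos lam / speed\<close> up
  to sign, so that the kicks agree.
\<close>
lemma ellipse_state_cos:
  assumes "k mod (n + 2) = 0 \<or> k mod (n + 2) = Suc n"
  shows "cos (snd (state k)) = a * sin lam / speed"
proof -
  define b j where "b = k div (n + 2)" and "j = k mod (n + 2)"
  obtain c where c: "tangent_at (turn b (half_vertex j)) = c *\<^sub>R turn b (tangent_at (half_vertex j))" "c * c = 1"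
  proof (cases "even b")
    case True
    then show thesis using that[of 1] by (simp add: turn_def)
  next
    case False
    then show thesis using that[of "- eps"] eps_sq by (simp add: turn_def tangent_sig)
  qed
  have "sin (snd (state k)) = c * inner (half_direction j) (tangent_at (half_vertex j))"
    unfolding state_sin vertex_def direction_def b_def[symmetric] j_def[symmetric] c(1)
    by (simp add: turn_inner)
  moreover have "(inner (half_direction j) (tangent_at (half_vertex j)))\<^sup>2 = (cos lam / speed)\<^sup>2"
    using assms eps_cases unfolding j_def[symmetric] by (auto simp: half_tangential power2_eq_square)
  ultimately have "(sin (snd (state k)))\<^sup>2 = (cos lam / speed)\<^sup>2"
    using c(2) by (simp add: power_mult_distrib) (simp add: power2_eq_square)
  then have "(cos (snd (state k)))\<^sup>2 = 1 - (cos lam / speed)\<^sup>2" by (simp add: cos_squared_eq)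
  also have "\<dots> = (speed\<^sup>2 - (cos lam)\<^sup>2) / speed\<^sup>2"
    using speed_pos by (simp add: power_divide diff_divide_distrib)
  also have "\<dots> = (a * sin lam / speed)\<^sup>2"
    unfolding speed_sq[unfolded power2_eq_square[of speed]] power_divide by (simp add: speed_sq power_mult_distrib)
  finally show ?thesis
    using state_cos_pos[of k] a_pos sin_lam_pos speed_pos by (simp add: power2_eq_iff_nonneg)
qed

lemma pan_angle: "sin (pan_beta n a h) = cos lam / speed" "cos (pan_beta n a h) = a * sin lam / speed"
proof -
  define r where "r = sqrt (1 + t\<^sup>2)"
  have r: "0 < r" unfolding r_def by (auto intro: add_pos_nonneg)
  have c: "cos lam = 1 / r" using pan_sin_cos(2)[OF h_pos] by (simp add: r_def)
  have "speed = sqrt ((1 + (a * t)\<^sup>2) * (cos lam)\<^sup>2)"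
    unfolding speed_def ellipse_speed_def sin_eq by (simp add: power_mult_distrib algebra_simps)
  also have "\<dots> = sqrt (1 + (a * t)\<^sup>2) * cos lam" using cos_lam_pos by (simp add: real_sqrt_mult)
  finally have s: "speed = sqrt (1 + (a * t)\<^sup>2) * cos lam" .
  show "sin (pan_beta n a h) = cos lam / speed" "cos (pan_beta n a h) = a * sin lam / speed"
    unfolding pan_sin_cos(3,4)[OF h_pos] s sin_eq using cos_lam_pos by simp_all
qed

lemma state_0: "state 0 = (vertex_arc 0, pan_beta n a h)"
proof -
  have "sin (snd (state 0)) = sin (pan_beta n a h)"
    unfolding state_sin pan_angle by (simp add: direction_def vertex_def turn_def half_tangential)
  moreover have "arcsin (sin (snd (state 0))) = snd (state 0)"
    using state_angle[of 0] by (intro arcsin_sin) auto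
  moreover have "arcsin (sin (pan_beta n a h)) = pan_beta n a h"
    unfolding pan_beta_def using arctan_bounded[of "1 / (a * t)"] by (intro arcsin_sin) auto
  ultimately show ?thesis using fst_state by (metis prod.collapse)
qed

lemma vertex_0: "vertex 0 = (x_right, sin lam)"
  by (simp add: vertex_def turn_def half_vertex_def)

text \<open>
  The marked point prescribes position and angle, so only the orbit constructed here has to be
  studied.
\<close>
lemma pantographic_unique: "pantographic n a h x \<Longrightarrow> x = state 0"
proof -
  assume p: "pantographic n a h x"
  then have "\<gamma> (fst x) = \<gamma> (vertex_arc 0)" by (simp add: pantographic_def vertex_arc vertex_0)
  moreover have "fst x \<in> {0..<len}" using p by (auto simp: pantographic_def phase_space_def)
  ultimately have "fst x = vertex_arc 0" using vertex_arc(4) by (auto dest: inj_onD[OF point_inj])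
  then show ?thesis using p by (simp add: state_0 pantographic_def prod_eq_iff)
qed

lemma elliptic_state:
  "elliptic_point (billiard_map a h ^^ (4 + 2*n)) (state 0) \<longleftrightarrow> \<bar>(4 * pan_Delta n a h - 2)\<^sup>2 - 2\<bar> < 2"
proof -
  define K where "K = (a / speed ^ 3) / (a * sin lam / speed)"
  define l2 where "l2 = 2 * sqrt ((h + a * cos lam)\<^sup>2 + (real n + sin lam)\<^sup>2)"
  have m: "(n + 2 + i) mod (n + 2) = i mod (n + 2)" "(n + 2 + n + 2) mod (n + 2) = 0" for i
    using mod_add_self1[of "n + 2" i] mod_add_self1[of "n + 2" "n + 2"] by (simp_all only: mod_self add.assoc)
  have jm: "i mod (n + 2) = i" if "i \<le> n + 1" for i using that by simp
  have sum: "(\<Sum>i\<le>n. half_length i) = l2"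
  proof -
    have "(\<Sum>i\<le>n. half_length i) = (\<Sum>i\<le>n. fst (half_vertex i) - fst (half_vertex (Suc i))) * stretch"
      unfolding sum_distrib_right by (intro sum.cong) (auto simp: half_length_def)
    also have "(\<Sum>i\<le>n. fst (half_vertex i) - fst (half_vertex (Suc i))) = fst (half_vertex 0) - fst (half_vertex (Suc n))"
      by (rule sum_telescope)
    also have "\<dots> = 2 * x_right" by (simp add: half_vertex_def)
    also have "2 * x_right * stretch = l2"
    proof -
      have "(h + a * cos lam)\<^sup>2 + (real n + sin lam)\<^sup>2 = (x_right * stretch)\<^sup>2"
        unfolding half_width power_mult_distrib stretch_sq by (simp add: algebra_simps)
      then show ?thesis unfolding l2_def using x_right_gt stretch_pos by simp
    qed
    finally show ?thesis .
  qed
  have "elliptic_point (billiard_map a h ^^ (4 + 2*n)) (state 0)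
      \<longleftrightarrow> \<bar>(4 * ((2 * sin lam * K - 1) * (l2 * K - 1)) - 2)\<^sup>2 - 2\<bar> < 2"
  proof (rule period_derivative_elliptic[OF state_orbit])
    show "vertex_curvature i = 0" "vertex_curvature (n + 2 + i) = 0" if "1 \<le> i" "i \<le> n" for i
      using that m(1)[of i] jm[of i] by (simp_all add: vertex_curvature_def)
    show "vertex_curvature k / cos (snd (state k)) = K" if "k \<in> {0, n + 1, n + 2, n + 2 + n + 1, n + 2 + n + 2}" for k
    proof -
      have "k mod (n + 2) = 0 \<or> k mod (n + 2) = Suc n" using that m(1)[of "n + 1"] m(2) jm[of "n + 1"] by auto
      then show ?thesis using ellipse_state_cos by (simp add: vertex_curvature_def K_def)
    qed
    show "cos (snd (state (n + 2))) = cos (snd (state 0))" "cos (snd (state (n + 2 + n + 2))) = cos (snd (state 0))"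
      using ellipse_state_cos m(2) by simp_all
    show "(\<Sum>i\<le>n. half_length (i mod (n + 2))) = l2" "(\<Sum>i\<le>n. half_length ((n + 2 + i) mod (n + 2))) = l2"
      unfolding m(1) sum[symmetric] by (intro sum.cong; simp)+
    show "half_length ((n + 1) mod (n + 2)) = 2 * sin lam" "half_length ((n + 2 + n + 1) mod (n + 2)) = 2 * sin lam"
      using m(1)[of "n + 1"] jm[of "n + 1"] by (simp_all add: half_length_def)
  qed
  moreover have "pan_Delta n a h = (2 * sin lam * K - 1) * (l2 * K - 1)"
  proof -
    have "(a\<^sup>2 * (sin lam)\<^sup>2 + (cos lam)\<^sup>2) powr (3/2) = speed ^ 3"
      unfolding speed_sq[symmetric] using speed_pos by (simp add: powr_powr flip: powr_numeral)
    then have "a / (a\<^sup>2 * (sin lam)\<^sup>2 + (cos lam)\<^sup>2) powr (3/2) / cos (pan_beta n a h) = K"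
      by (simp only: K_def pan_angle)
    then show ?thesis unfolding pan_Delta_def Let_def l2_def[symmetric] by (simp only: times_divide_eq_right[symmetric])
  qed
  ultimately show ?thesis by simp
qed

end

text \<open>
  A broken line with strictly decreasing abscissa crosses a level once; the half-open links make a
  vertex on the level count once.
\<close>
lemma unique_crossing:
  fixes f :: "nat \<Rightarrow> real"
  assumes "\<And>k. k < M \<Longrightarrow> f (Suc k) < f k" "f M < c" "c \<le> f 0"
  shows "\<exists>p. {(k, r). k < M \<and> 0 \<le> r \<and> r < 1 \<and> (1 - r) * f k + r * f (Suc k) = c} = {p}"
  using assms
proof (induction M)
  case 0
  then show ?case by simp
next
  case (Suc M)
  have v: "(1 - r) * f k + r * f (Suc k) = f k - r * (f k - f (Suc k))" for k r
    by (simp add: algebra_simps)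
  have d: "0 < f M - f (Suc M)" using Suc.prems(1)[of M] by simp
  show ?case
  proof (cases "c \<le> f M")
    case True
    define r0 where "r0 = (f M - c) / (f M - f (Suc M))"
    have r0: "0 \<le> r0" "r0 < 1" "r0 * (f M - f (Suc M)) = f M - c"
      using True Suc.prems(2) d by (simp_all add: r0_def)
    have dec: "f M \<le> f (Suc k)" if "k < M" for k
    proof -
      have "f (Suc k + i) \<le> f (Suc k)" if "Suc k + i \<le> M" for i
        using that
      proof (induction i)
        case (Suc i)
        then show ?case using Suc.prems \<open>\<And>k. k < Suc M \<Longrightarrow> f (Suc k) < f k\<close>[of "Suc k + i"] by simp
      qed simp
      from this[of "M - Suc k"] that show ?thesis by simp
    qed
    have "k = M \<and> r = r0" if "k < Suc M" "0 \<le> r" "r < 1" "f k - r * (f k - f (Suc k)) = c" for k r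
    proof (cases "k = M")
      case True
      then have "r * (f M - f (Suc M)) = r0 * (f M - f (Suc M))" using that r0 by simp
      then show ?thesis using True d by simp
    next
      case False
      then have k: "k < M" using that by simp
      have "0 < f k - f (Suc k)" using Suc.prems(1)[of k] k by simp
      then have m: "r * (f k - f (Suc k)) < 1 * (f k - f (Suc k))"
        using that(3) by (intro mult_strict_right_mono)
      define X where "X = r * (f k - f (Suc k))"
      have "X < f k - f (Suc k)" using m unfolding X_def mult_1_left .
      moreover have "f k - X = c" using that(4) unfolding X_def .
      ultimately have False using dec[OF k] \<open>c \<le> f M\<close> by linarith
      then show ?thesis ..
    qed
    then have "{(k, r). k < Suc M \<and> 0 \<le> r \<and> r < 1 \<and> (1 - r) * f k + r * f (Suc k) = c} = {(M, r0)}"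
      unfolding v using r0 by auto
    then show ?thesis by blast
  next
    case False
    then obtain p where p: "{(k, r). k < M \<and> 0 \<le> r \<and> r < 1 \<and> (1 - r) * f k + r * f (Suc k) = c} = {p}"
      using Suc by force
    have "f M - r * (f M - f (Suc M)) \<noteq> c" if "0 \<le> r" for r
    proof -
      have "0 \<le> r * (f M - f (Suc M))" using d that by simp
      then show ?thesis using False by linarith
    qed
    then have "{(k, r). k < Suc M \<and> 0 \<le> r \<and> r < 1 \<and> (1 - r) * f k + r * f (Suc k) = c}
       = {(k, r). k < M \<and> 0 \<le> r \<and> r < 1 \<and> (1 - r) * f k + r * f (Suc k) = c}"
      unfolding v by (auto simp: less_Suc_eq)
    then show ?thesis unfolding p by (rule exI)
  qed
qed

context pan_orbit begin

lemma vertex_shift: "vertex (k + (n + 2)) = sig (vertex k)"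
proof -
  have "(k + (n + 2)) div (n + 2) = Suc (k div (n + 2))" "(k + (n + 2)) mod (n + 2) = k mod (n + 2)"
    by (simp_all only: div_add_self2 mod_add_self2 Suc_eq_plus1)
  then have "vertex (k + (n + 2)) = turn (Suc (k div (n + 2))) (half_vertex (k mod (n + 2)))"
    by (simp only: vertex_def)
  then show ?thesis by (simp add: vertex_def turn_def sig_sig)
qed

lemma vertex_period: "vertex (k + i * (2*n + 4)) = vertex k"
proof (induction i)
  case (Suc i)
  have "k + Suc i * (2*n + 4) = (k + i * (2*n + 4) + (n + 2)) + (n + 2)" by simp
  then show ?case using Suc by (simp only: vertex_shift sig_sig)
qed simp

lemma vertex_mod: "vertex k = vertex (k mod (2*n + 4))" "vertex (Suc k) = vertex (Suc (k mod (2*n + 4)))"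
proof -
  show "vertex k = vertex (k mod (2*n + 4))"
    using vertex_period[of "k mod (2*n + 4)" "k div (2*n + 4)"] by (simp only: mod_div_mult_eq)
  show "vertex (Suc k) = vertex (Suc (k mod (2*n + 4)))"
    using vertex_period[of "Suc (k mod (2*n + 4))" "k div (2*n + 4)"] by (simp only: add_Suc mod_div_mult_eq)
qed

lemma vertex_first: "j \<le> n + 1 \<Longrightarrow> vertex j = half_vertex j"
  by (simp add: vertex_def turn_def)

lemma vertex_second: "j \<le> n + 1 \<Longrightarrow> vertex (j + (n + 2)) = sig (half_vertex j)"
  unfolding vertex_shift by (simp only: vertex_first)

lemma vertex_ends:
  "vertex 0 = (x_right, sin lam)" "vertex (n + 1) = (- x_right, - eps * sin lam)"
  "vertex (n + 2) = (- x_right, eps * sin lam)" "vertex (2*n + 3) = (x_right, - sin lam)"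
proof -
  show "vertex 0 = (x_right, sin lam)" by (rule vertex_0)
  show "vertex (n + 1) = (- x_right, - eps * sin lam)"
    by (subst vertex_first) (simp_all add: half_vertex_def)
  show "vertex (n + 2) = (- x_right, eps * sin lam)"
    using vertex_shift[of 0] by (simp add: vertex_0 sig_def)
  have "2*n + 3 = (n + 1) + (n + 2)" by simp
  then have "vertex (2*n + 3) = sig (half_vertex (n + 1))" by (simp only: vertex_second order.refl)
  then show "vertex (2*n + 3) = (x_right, - sin lam)"
    using eps_sq by (simp add: half_vertex_def sig_def mult.assoc[symmetric])
qed

lemma mod_ends:
  assumes "k < 2*n + 4" "k mod (n + 2) = 0 \<or> k mod (n + 2) = Suc n"
  shows "k \<in> {0, n + 1, n + 2, 2*n + 3}"
proof (cases "k < n + 2")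
  case True
  then show ?thesis using assms by auto
next
  case False
  then have "k mod (n + 2) = (k - (n + 2)) mod (n + 2)" by (intro le_mod_geq) simp
  also have "\<dots> = k - (n + 2)" using assms by (intro mod_less) linarith
  finally show ?thesis using assms False by auto
qed

lemma vertex_flat:
  assumes "k < 2*n + 4" "k \<notin> {0, n + 1, n + 2, 2*n + 3}"
  shows "\<bar>fst (vertex k)\<bar> < h" "snd (vertex k) = 1 \<or> snd (vertex k) = -1"
proof -
  have "\<bar>fst (vertex k)\<bar> < h \<and> (snd (vertex k) = 1 \<or> snd (vertex k) = -1)"
  proof (cases rule: vertex_kind[of k])
    case (ellipse s1 s2)
    then show ?thesis using mod_ends[OF assms(1) ellipse(1)] assms(2) by blast
  qed simp
  then show "\<bar>fst (vertex k)\<bar> < h" "snd (vertex k) = 1 \<or> snd (vertex k) = -1" by auto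
qed

lemma impact_vertex: "impact a h (state 0) k = vertex k"
  by (simp add: impact_def state_iterate fst_state vertex_arc)

lemma right_bound: "p \<in> right_half_ellipse a h \<Longrightarrow> h \<le> fst p"
  using a_pos by (auto simp: right_half_ellipse_def intro!: mult_nonneg_nonneg cos_ge_zero)

lemma left_bound: "p \<in> left_half_ellipse a h \<Longrightarrow> fst p \<le> - h"
  using right_bound by (force simp: left_half_ellipse_def)

lemma straight_bound: "p \<in> straight_segments h \<Longrightarrow> \<bar>fst p\<bar> \<le> h"
  by (auto simp: straight_segments_def)

lemma right_points: "s = 1 \<or> s = -1 \<Longrightarrow> (x_right, s * sin lam) \<in> right_half_ellipse a h"
proof -
  assume s: "s = 1 \<or> s = -1"
  have "(x_right, s * sin lam) = (\<lambda>l. (a * cos l + h, sin l)) (s * lam)" using s by auto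
  moreover have "s * lam \<in> {- (pi/2)..pi/2}" using s lam_bounds by auto
  ultimately show ?thesis unfolding right_half_ellipse_def by blast
qed

lemma left_points: "s = 1 \<or> s = -1 \<Longrightarrow> (- x_right, s * sin lam) \<in> left_half_ellipse a h"
  using imageI[OF right_points, of s "\<lambda>(x, y). (- x, y)"] by (simp add: left_half_ellipse_def)

lemma vertex_right_iff: "k < 2*n + 4 \<Longrightarrow> vertex k \<in> right_half_ellipse a h \<longleftrightarrow> k \<in> {0, 2*n + 3}"
proof -
  assume k: "k < 2*n + 4"
  have "vertex k \<in> right_half_ellipse a h" if "k \<in> {0, 2*n + 3}"
    using that right_points[of 1] right_points[of "-1"] vertex_ends(1,4) by (elim insertE emptyE) simp_all
  moreover have "vertex k \<notin> right_half_ellipse a h" if "k \<notin> {0, 2*n + 3}"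
  proof (cases "k = n + 1 \<or> k = n + 2")
    case True
    then have "fst (vertex k) = - x_right" using vertex_ends(2,3) by (elim disjE) (simp_all only: fst_conv)
    then show ?thesis using right_bound[of "vertex k"] x_right_gt h_pos by linarith
  next
    case False
    then show ?thesis using vertex_flat(1)[OF k] that right_bound[of "vertex k"] by force
  qed
  ultimately show ?thesis by blast
qed

lemma vertex_left_iff: "k < 2*n + 4 \<Longrightarrow> vertex k \<in> left_half_ellipse a h \<longleftrightarrow> k \<in> {n + 1, n + 2}"
proof -
  assume k: "k < 2*n + 4"
  have e: "- eps = 1 \<or> - eps = -1" using eps_cases by auto
  have "vertex k \<in> left_half_ellipse a h" if "k \<in> {n + 1, n + 2}"
    using that left_points[OF eps_cases] left_points[OF e] vertex_ends(2,3) by (elim insertE emptyE) (simp_all only:)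
  moreover have "vertex k \<notin> left_half_ellipse a h" if "k \<notin> {n + 1, n + 2}"
  proof (cases "k = 0 \<or> k = 2*n + 3")
    case True
    then have "fst (vertex k) = x_right" using vertex_ends(1,4) by (elim disjE) (simp_all only: fst_conv)
    then show ?thesis using left_bound[of "vertex k"] x_right_gt h_pos by linarith
  next
    case False
    then show ?thesis using vertex_flat(1)[OF k] that left_bound[of "vertex k"] by force
  qed
  ultimately show ?thesis by blast
qed

lemma vertex_straight_iff:
  "k < 2*n + 4 \<Longrightarrow> vertex k \<in> straight_segments h \<longleftrightarrow> k \<notin> {0, n + 1, n + 2, 2*n + 3}"
proof -
  assume k: "k < 2*n + 4"
  have "vertex k \<notin> straight_segments h" if "k \<in> {0, n + 1, n + 2, 2*n + 3}"
  proof -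
    have "\<bar>fst (vertex k)\<bar> = x_right"
      using that vertex_ends x_right_gt(2) by (elim insertE emptyE) (simp_all only: fst_conv abs_minus_cancel abs_of_pos)
    then show ?thesis using straight_bound[of "vertex k"] x_right_gt by linarith
  qed
  moreover have "vertex k \<in> straight_segments h" if "k \<notin> {0, n + 1, n + 2, 2*n + 3}"
    using vertex_flat[OF k that] unfolding straight_segments_def by (auto simp: mem_Times_iff)
  ultimately show ?thesis by blast
qed

definition mirror :: "real \<times> real \<Rightarrow> real \<times> real" where "mirror p = (fst p, - snd p)"

text \<open>
  Time reversal: reflected in the horizontal axis, the orbit is traversed backwards.
\<close>
lemma mirror_half: "j \<le> n + 1 \<Longrightarrow> mirror (half_vertex j) = sig (half_vertex (n + 1 - j))"
proof -
  assume "j \<le> n + 1"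
  then consider "j = 0" | "j = n + 1" | "1 \<le> j" "j \<le> n" by linarith
  then show ?thesis
  proof cases
    case 1
    have "sig (half_vertex (n + 1)) = (x_right, - (eps * eps) * sin lam)"
      by (simp add: half_vertex_def sig_def)
    then show ?thesis using 1 eps_sq by (simp add: half_vertex_def mirror_def)
  next
    case 2
    then show ?thesis by (simp add: half_vertex_def mirror_def sig_def)
  next
    case 3
    then have r: "1 \<le> n + 1 - j" "n + 1 - j \<le> n" by auto
    have x: "real (n + 1 - j) = real n + 1 - real j" using 3 by simp
    have y: "eps * (-1) ^ (n + 1 - j) = - ((-1) ^ j)"
    proof -
      have "eps * (-1) ^ (n + 1 - j) = ((-1) ^ (n + (n + 1 - j)) :: real)" by (simp only: power_add)
      also have "\<dots> = - ((-1) ^ j)"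
        using 3 by (cases "even j") (auto simp: uminus_power_if)
      finally show ?thesis .
    qed
    have "half_vertex (n + 1 - j) = ((real n + 1 - 2 * (real n + 1 - real j)) / slope, (-1) ^ (n + 1 - j))"
      using r by (simp add: half_vertex_def x)
    moreover have "- ((real n + 1 - 2 * (real n + 1 - real j)) / slope) = (real n + 1 - 2 * real j) / slope"
      unfolding minus_divide_left by simp
    ultimately have "sig (half_vertex (n + 1 - j)) = ((real n + 1 - 2 * real j) / slope, - ((-1) ^ j))"
      by (simp only: sig_def fst_conv snd_conv y)
    moreover have "half_vertex j = ((real n + 1 - 2 * real j) / slope, (-1) ^ j)"
      using 3 by (simp add: half_vertex_def)
    ultimately show ?thesis by (simp only: mirror_def fst_conv snd_conv)
  qed
qed

lemma mirror_vertex: assumes "k < 2*n + 4" shows "mirror (vertex k) = vertex (2*n + 3 - k)"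
proof (cases "k \<le> n + 1")
  case True
  then have "2*n + 3 - k = (n + 1 - k) + (n + 2)" by simp
  then have "vertex (2*n + 3 - k) = sig (half_vertex (n + 1 - k))"
    using vertex_second[of "n + 1 - k"] by simp
  then show ?thesis using True by (simp only: vertex_first mirror_half)
next
  case False
  define j where "j = k - (n + 2)"
  have j: "j \<le> n + 1" "k = j + (n + 2)" "2*n + 3 - k = n + 1 - j" using assms False by (auto simp: j_def)
  have "mirror (sig p) = sig (mirror p)" for p by (simp add: mirror_def sig_def)
  then have "mirror (vertex k) = sig (sig (half_vertex (n + 1 - j)))"
    unfolding j(2) vertex_second[OF j(1)] by (simp only: mirror_half[OF j(1)])
  then show ?thesis unfolding j(3) sig_sig by (simp only: vertex_first diff_le_self)
qed

lemma trajectory_vertices: "trajectory a h (state 0) = (\<Union>k. closed_segment (vertex k) (vertex (Suc k)))"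
  by (simp add: trajectory_def impact_vertex)

lemma trajectory_image:
  assumes f: "linear f" "\<And>p. f (f p) = p"
    and seg: "\<And>k. k < 2*n + 4 \<Longrightarrow> \<exists>m. closed_segment (f (vertex k)) (f (vertex (Suc k))) = closed_segment (vertex m) (vertex (Suc m))"
  shows "f ` trajectory a h (state 0) = trajectory a h (state 0)"
proof -
  let ?T = "trajectory a h (state 0)"
  have "f ` closed_segment (vertex k) (vertex (Suc k)) \<subseteq> ?T" for k
  proof -
    let ?k = "k mod (2*n + 4)"
    obtain m where "closed_segment (f (vertex ?k)) (f (vertex (Suc ?k))) = closed_segment (vertex m) (vertex (Suc m))"
      using seg[of ?k] by auto
    then have "f ` closed_segment (vertex ?k) (vertex (Suc ?k)) = closed_segment (vertex m) (vertex (Suc m))"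
      using closed_segment_linear_image[OF f(1)] by metis
    then have "f ` closed_segment (vertex k) (vertex (Suc k)) = closed_segment (vertex m) (vertex (Suc m))"
      using vertex_mod[of k] by simp
    then show ?thesis unfolding trajectory_vertices by blast
  qed
  then have sub: "f ` ?T \<subseteq> ?T" unfolding trajectory_vertices by blast
  moreover have "?T \<subseteq> f ` ?T"
  proof
    fix p assume "p \<in> ?T"
    then have "f p \<in> ?T" using sub by blast
    then show "p \<in> f ` ?T" using f(2)[of p] by (metis imageI)
  qed
  ultimately show ?thesis by blast
qed

lemma trajectory_sig: "sig ` trajectory a h (state 0) = trajectory a h (state 0)"
proof (rule trajectory_image)
  show "linear sig" by (rule linearI) (simp_all add: sig_def algebra_simps)
  show "\<exists>m. closed_segment (sig (vertex k)) (sig (vertex (Suc k))) = closed_segment (vertex m) (vertex (Suc m))" for k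
    using vertex_shift[of k] vertex_shift[of "Suc k"] by (intro exI[of _ "k + (n + 2)"]) simp
qed (rule sig_sig)

lemma trajectory_mirror: "mirror ` trajectory a h (state 0) = trajectory a h (state 0)"
proof (rule trajectory_image)
  show "linear mirror" by (rule linearI) (simp_all add: mirror_def)
  fix k assume k: "k < 2*n + 4"
  show "\<exists>m. closed_segment (mirror (vertex k)) (mirror (vertex (Suc k))) = closed_segment (vertex m) (vertex (Suc m))"
  proof (cases "k = 2*n + 3")
    case True
    have "vertex (Suc k) = vertex 0" using True vertex_period[of 0 1] by (simp add: numeral_eq_Suc)
    moreover have "mirror (vertex 0) = vertex k" "mirror (vertex k) = vertex 0"
      using mirror_vertex[of 0] mirror_vertex[of k] True by simp_all
    ultimately show ?thesis by (intro exI[of _ k]) (simp only: closed_segment_commute)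
  next
    case False
    define m where "m = 2*n + 2 - k"
    have m: "2*n + 3 - k = Suc m" "2*n + 3 - Suc k = m" "Suc k < 2*n + 4" using k False by (auto simp: m_def)
    have "mirror (vertex k) = vertex (Suc m)" "mirror (vertex (Suc k)) = vertex m"
      using mirror_vertex[OF k] mirror_vertex[OF m(3)] unfolding m by simp_all
    then show ?thesis by (intro exI[of _ m]) (simp only: closed_segment_commute)
  qed
qed (simp add: mirror_def)

text \<open>
  The two reflections generate the same group as \<open>sig\<close> and \<open>mirror\<close>.
\<close>
lemma trajectory_symmetric:
  "(\<lambda>(u, v). (- u, v)) ` trajectory a h (state 0) = trajectory a h (state 0)"
  "(\<lambda>(u, v). (u, - v)) ` trajectory a h (state 0) = trajectory a h (state 0)"
proof -
  have m: "(\<lambda>(u, v). (u, - v)) = mirror" by (auto simp: fun_eq_iff mirror_def)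
  show "(\<lambda>(u, v). (u, - v)) ` trajectory a h (state 0) = trajectory a h (state 0)"
    unfolding m by (rule trajectory_mirror)
  have "(\<lambda>(u, v). (- u, v)) = sig \<or> (\<lambda>(u, v). (- u, v)) = sig \<circ> mirror"
    using eps_cases by (auto simp: fun_eq_iff sig_def mirror_def)
  then show "(\<lambda>(u, v). (- u, v)) ` trajectory a h (state 0) = trajectory a h (state 0)"
    using trajectory_sig trajectory_mirror by (elim disjE) (simp_all only: image_comp[symmetric])
qed

lemma abscissa_decreasing: assumes "k < n + 1" shows "fst (vertex (Suc k)) < fst (vertex k)"
proof -
  have "fst (half_vertex (Suc k) - half_vertex k) = half_length k * (- 1 / stretch)"
    using half_step(1)[of k] assms by (simp add: half_direction_def)
  moreover have "half_length k * (- 1 / stretch) < 0"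
    using half_step(2)[of k] assms stretch_pos by (simp add: mult_pos_neg divide_neg_pos)
  ultimately show ?thesis using assms by (simp add: vertex_first)
qed

lemma abscissa_shift: "fst (vertex (k + (n + 2))) = - fst (vertex k)"
  unfolding vertex_shift by (simp add: sig_def)

lemma abscissa_bound: "\<bar>fst (vertex k)\<bar> \<le> x_right"
  using x_right_gt by (cases rule: vertex_kind[of k]) auto

lemma vertical_links: "vertex (2*n + 4) = (x_right, sin lam)"
  using vertex_period[of 0 1] by (simp add: vertex_0)

text \<open>
  The abscissa decreases over the first half of the period and increases over the second, apart from
  the two vertical links, which lie on the extreme abscissas.
\<close>
lemma crossings_card:
  assumes c: "c \<noteq> x_right" "c \<noteq> - x_right"
  shows "crossings a h (state 0) (4 + 2*n) c = {} \<or> card (crossings a h (state 0) (4 + 2*n) c) = 2"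
proof -
  define f where "f k = fst (vertex k)" for k
  define V where "V k r = (1 - r) * f k + r * f (Suc k)" for k r
  have cr: "crossings a h (state 0) (4 + 2*n) c = {(k, r). k < 4 + 2*n \<and> 0 \<le> r \<and> r < 1 \<and> V k r = c}"
    by (simp add: crossings_def impact_vertex V_def f_def)
  show ?thesis
  proof (cases "\<bar>c\<bar> < x_right")
    case False
    have "V k r \<noteq> c" if "0 \<le> r" "r < 1" for k r
    proof -
      have "\<bar>V k r\<bar> \<le> (1 - r) * \<bar>f k\<bar> + r * \<bar>f (Suc k)\<bar>"
        unfolding V_def using that abs_triangle_ineq[of "(1 - r) * f k" "r * f (Suc k)"] by (simp add: abs_mult)
      also have "\<dots> \<le> (1 - r) * x_right + r * x_right"
        using that abscissa_bound unfolding f_def by (intro add_mono mult_left_mono) auto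
      finally have "\<bar>V k r\<bar> \<le> x_right" by (simp add: algebra_simps)
      then show ?thesis using False c by auto
    qed
    then show ?thesis unfolding cr by auto
  next
    case True
    have f0: "f 0 = x_right" "f (n + 1) = - x_right" "f (n + 2) = - x_right" "f (2*n + 3) = x_right" "f (2*n + 4) = x_right"
      unfolding f_def vertex_ends vertical_links by simp_all
    have dec: "\<And>k. k < n + 1 \<Longrightarrow> f (Suc k) < f k" unfolding f_def by (rule abscissa_decreasing)
    have "c < x_right" "- c < x_right" using True by (simp_all only: abs_less_iff)
    then have c1: "f (n + 1) < c" "c \<le> f 0" and c2: "f (n + 1) < - c" "- c \<le> f 0"
      unfolding f0 by linarith+
    obtain p where p: "{(k, r). k < n + 1 \<and> 0 \<le> r \<and> r < 1 \<and> V k r = c} = {p}"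
      using unique_crossing[of "n + 1" f c, OF dec c1] unfolding V_def by blast
    obtain q where q: "{(k, r). k < n + 1 \<and> 0 \<le> r \<and> r < 1 \<and> V k r = - c} = {q}"
      using unique_crossing[of "n + 1" f "- c", OF dec c2] unfolding V_def by blast
    have sh: "V (k + (n + 2)) r = - V k r" for k r
      using abscissa_shift[of k] abscissa_shift[of "Suc k"] by (simp add: V_def f_def)
    have v1: "V (n + 1) r = - x_right" for r
    proof -
      have "Suc (n + 1) = n + 2" by simp
      then have "V (n + 1) r = (1 - r) * (- x_right) + r * (- x_right)" unfolding V_def by (simp only: f0)
      then show ?thesis by (simp add: algebra_simps)
    qed
    have v2: "V (2*n + 3) r = x_right" for r
      using sh[of "n + 1" r] v1[of r] by (simp add: numeral_eq_Suc mult_2)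
    have split: "k < 4 + 2*n \<and> 0 \<le> r \<and> r < 1 \<and> V k r = c \<longleftrightarrow>
       (k < n + 1 \<and> 0 \<le> r \<and> r < 1 \<and> V k r = c)
       \<or> (\<exists>j. k = j + (n + 2) \<and> j < n + 1 \<and> 0 \<le> r \<and> r < 1 \<and> V j r = - c)" (is "?L \<longleftrightarrow> ?R") for k r
    proof
      assume L: ?L
      then have "k \<noteq> n + 1" "k \<noteq> 2*n + 3" using v1 v2 c by metis+
      then consider "k < n + 1" | "n + 2 \<le> k" "k < 2*n + 3" using L by linarith
      then show ?R
      proof cases
        case 1
        then show ?thesis using L by simp
      next
        case 2
        then obtain j where j: "k = j + (n + 2)" by (metis le_add_diff_inverse2)
        then have "V (j + (n + 2)) r = c" using L by blast
        then have "V j r = - c" unfolding sh by linarith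
        moreover have "j < n + 1" using j 2 by simp
        ultimately show ?thesis using L j by blast
      qed
    next
      assume ?R
      then show ?L using sh by (elim disjE exE) simp_all
    qed
    obtain kp rp kq rq where pq: "p = (kp, rp)" "q = (kq, rq)" by (cases p, cases q) auto
    have P: "k < n + 1 \<and> 0 \<le> r \<and> r < 1 \<and> V k r = c \<longleftrightarrow> k = kp \<and> r = rp" for k r
      using p unfolding pq set_eq_iff by (auto simp del: One_nat_def)
    have Q: "k < n + 1 \<and> 0 \<le> r \<and> r < 1 \<and> V k r = - c \<longleftrightarrow> k = kq \<and> r = rq" for k r
      using q unfolding pq set_eq_iff by (auto simp del: One_nat_def)
    have "crossings a h (state 0) (4 + 2*n) c = {(kp, rp), (kq + (n + 2), rq)}"
      unfolding cr split P Q by auto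
    moreover have "kp < n + 1" using P[of kp rp] by simp
    then have "(kp, rp) \<noteq> (kq + (n + 2), rq)" by simp
    ultimately show ?thesis by simp
  qed
qed

lemma pantographic_state: "pantographic n a h (state 0)"
proof -
  let ?N = "4 + 2*n"
  have N: "k < ?N \<longleftrightarrow> k < 2*n + 4" for k by linarith
  have arc_period: "vertex_arc (k + (2*n + 4)) = vertex_arc k" for k
    using vertex_period[of k 1] by (simp add: vertex_arc_def)
  have per: "state ?N = state 0"
    using arc_period[of 0] arc_period[of 1] by (simp add: state_def add.commute)
  have 1: "state 0 \<in> phase_space a h"
    using state_angle[of 0] vertex_arc(4)[of 0] by (simp add: phase_space_def mem_Times_iff fst_state)
  have 2: "(billiard_map a h ^^ k) (state 0) \<noteq> state 0" if "0 < k" "k < ?N" for k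
  proof
    assume "(billiard_map a h ^^ k) (state 0) = state 0"
    then have "vertex_arc k = vertex_arc 0" unfolding state_iterate by (metis fst_state)
    then have e: "vertex k = vertex 0" using vertex_arc(2) by metis
    then have "vertex k \<in> right_half_ellipse a h" using vertex_right_iff[of 0] by simp
    then have "k = 2*n + 3" using vertex_right_iff[of k] that by auto
    then show False using e vertex_ends(1,4) sin_lam_pos by simp
  qed
  have 3: "card {k. k < ?N \<and> impact a h (state 0) k \<in> right_half_ellipse a h} = 2"
  proof -
    have "{k. k < ?N \<and> impact a h (state 0) k \<in> right_half_ellipse a h} = {0, 2*n + 3}"
      unfolding impact_vertex N using vertex_right_iff by auto
    then show ?thesis by simp
  qed
  have 4: "card {k. k < ?N \<and> impact a h (state 0) k \<in> left_half_ellipse a h} = 2"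
  proof -
    have "{k. k < ?N \<and> impact a h (state 0) k \<in> left_half_ellipse a h} = {n + 1, n + 2}"
      unfolding impact_vertex N using vertex_left_iff by auto
    then show ?thesis by simp
  qed
  have 5: "card {k. k < ?N \<and> impact a h (state 0) k \<in> straight_segments h} = 2*n"
  proof -
    have "{k. k < ?N \<and> impact a h (state 0) k \<in> straight_segments h} = {..<2*n + 4} - {0, n + 1, n + 2, 2*n + 3}"
      unfolding impact_vertex N using vertex_straight_iff by blast
    moreover have "card ({..<2*n + 4} - {0, n + 1, n + 2, 2*n + 3}) = card {..<2*n + 4} - card {0, n + 1, n + 2, 2*n + 3}"
      by (intro card_Diff_subset) auto
    ultimately show ?thesis by simp
  qed
  have vr: "vertical_link a h (state 0) (2*n + 3)" "fst (impact a h (state 0) (2*n + 3)) = x_right"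
    and vl: "vertical_link a h (state 0) (n + 1)" "fst (impact a h (state 0) (n + 1)) = - x_right"
    using vertex_ends vertical_links by (simp_all add: vertical_link_def impact_vertex numeral_eq_Suc)
  have 6: "\<exists>k. impact a h (state 0) k \<in> right_half_ellipse a h \<and>
      impact a h (state 0) (Suc k) \<in> right_half_ellipse a h \<and> vertical_link a h (state 0) k"
  proof (intro exI conjI)
    show "impact a h (state 0) (2*n + 3) \<in> right_half_ellipse a h"
      using vertex_right_iff[of "2*n + 3"] by (simp add: impact_vertex)
    have "Suc (2*n + 3) = 2*n + 4" by simp
    then show "impact a h (state 0) (Suc (2*n + 3)) \<in> right_half_ellipse a h"
      using right_points[of 1] by (simp only: impact_vertex vertical_links mult_1 simp_thms)
  qed (rule vr(1))
  have 7: "\<exists>k. impact a h (state 0) k \<in> left_half_ellipse a h \<and>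
      impact a h (state 0) (Suc k) \<in> left_half_ellipse a h \<and> vertical_link a h (state 0) k"
    using vertex_left_iff[of "n + 1"] vertex_left_iff[of "n + 2"] vl(1)
    by (intro exI[of _ "n + 1"]) (simp add: impact_vertex)
  have 8: "\<forall>c. (\<nexists>k. vertical_link a h (state 0) k \<and> fst (impact a h (state 0) k) = c) \<longrightarrow>
      crossings a h (state 0) ?N c = {} \<or> card (crossings a h (state 0) ?N c) = 2"
    using crossings_card vr vl by metis
  have 9: "stadium_point a h (fst (state 0)) = (x_right, sin lam)" "snd (state 0) = pan_beta n a h"
    by (simp only: fst_state vertex_arc(2) vertex_0, simp only: state_0 snd_conv)
  have 10: "\<forall>k. 0 < k \<and> k < ?N \<longrightarrow> (billiard_map a h ^^ k) (state 0) \<noteq> state 0" using 2 by blast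
  have 11: "(billiard_map a h ^^ ?N) (state 0) = state 0" unfolding state_iterate by (rule per)
  show ?thesis
    unfolding pantographic_def by (intro conjI 1 9 11 10 trajectory_symmetric 3 4 5 6 7 8)
qed

lemma pan_elliptic_iff: "pan_elliptic n a h \<longleftrightarrow> \<bar>(4 * pan_Delta n a h - 2)\<^sup>2 - 2\<bar> < 2"
proof
  assume "pan_elliptic n a h"
  then obtain x where x: "pantographic n a h x" "elliptic_point (billiard_map a h ^^ (4 + 2*n)) x"
    unfolding pan_elliptic_def by blast
  from x(2) show "\<bar>(4 * pan_Delta n a h - 2)\<^sup>2 - 2\<bar> < 2"
    unfolding pantographic_unique[OF x(1)] elliptic_state .
next
  assume "\<bar>(4 * pan_Delta n a h - 2)\<^sup>2 - 2\<bar> < 2"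
  then show "pan_elliptic n a h"
    unfolding pan_elliptic_def using pantographic_state elliptic_state by blast
qed

end

section \<open>The upper bound of ellipticity\<close>

theorem mainTheorem3:
  fixes a :: real
  assumes "1 < a" and "a < sqrt 2"
  shows "{h. 0 < h \<and> (\<exists>n. pan_elliptic n a h)} \<noteq> {} \<and>
         bdd_above {h. 0 < h \<and> (\<exists>n. pan_elliptic n a h)} \<and>
         pan_H a = Sup {h. 0 < h \<and> (\<exists>n. pan_elliptic n a h)}"
proof -
  let ?S = "{h. 0 < h \<and> (\<exists>n. pan_elliptic n a h)}"
  interpret flat_ellipse a by standard (rule assms)+
  have iff: "pan_elliptic n a h \<longleftrightarrow> \<bar>(4 * pan_Delta n a h - 2)\<^sup>2 - 2\<bar> < 2" if "0 < h" for n h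
  proof -
    interpret pan_orbit a h n by unfold_locales (use assms that in auto)
    show ?thesis by (rule pan_elliptic_iff)
  qed
  have fin: "finite ((\<lambda>n. pan_h1 n a) ` pan_indices a)"
    using finite_pan_indices by (rule finite_imageI)
  have ne: "(\<lambda>n. pan_h1 n a) ` pan_indices a \<noteq> {}" using zero_in_pan_indices[OF assms] by blast
  have upper: "h \<le> pan_H a" if hS: "h \<in> ?S" for h
  proof -
    obtain n where h: "0 < h" "pan_elliptic n a h" using hS by blast
    then have "(4 * pan_Delta n a h - 2)\<^sup>2 < 2\<^sup>2" using iff by auto
    then have "4 * pan_Delta n a h - 2 < 2" by (rule power_less_imp_less_base) simp
    then have "n \<in> pan_indices a" "h < pan_h1 n a" using pan_Delta_less_1[OF h(1), of n] by auto
    then show ?thesis unfolding pan_H_def using Max_ge[OF fin] by force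
  qed
  have lower: "\<exists>h\<in>?S. y < h" if y: "y < pan_H a" for y
  proof -
    obtain n where n: "n \<in> pan_indices a" "pan_H a = pan_h1 n a"
      using Max_in[OF fin ne] unfolding pan_H_def by auto
    obtain h where h: "0 < h" "y < h" "1/2 < pan_Delta n a h" "pan_Delta n a h < 1"
      using pan_Delta_near_1[OF n(1)] y unfolding n(2) by blast
    have d: "0 < 4 * pan_Delta n a h - 2" "4 * pan_Delta n a h - 2 < 2" using h by auto
    have "(4 * pan_Delta n a h - 2)\<^sup>2 < 2\<^sup>2" by (rule power_strict_mono) (use d in auto)
    moreover have "0 < (4 * pan_Delta n a h - 2)\<^sup>2" by (rule zero_less_power[OF d(1)])
    moreover have "\<bar>z - 2\<bar> < 2" if "z < 2\<^sup>2" "0 < z" for z :: real using that by (simp add: abs_less_iff)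
    ultimately have "pan_elliptic n a h" unfolding iff[OF h(1)] by blast
    then show ?thesis using h by blast
  qed
  have nonempty: "?S \<noteq> {}" using lower[of "pan_H a - 1"] by auto
  moreover have "bdd_above ?S" using upper by (intro bdd_aboveI) blast
  moreover have "Sup ?S = pan_H a"
  proof (rule cSup_eq_non_empty[OF nonempty])
    fix y assume "\<And>x. x \<in> ?S \<Longrightarrow> x \<le> y"
    then show "pan_H a \<le> y" using lower[of y] by (meson not_le)
  qed (rule upper)
  ultimately show ?thesis by simp
qed

end
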